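(* Let $d, n \ge 1$ be integers, let $\mathcal{U}(d)$ be the group of unitary $d\times d$ complex matrices, and let $dU$ denote the unique Haar probability measure on $\mathcal{U}(d)$. Then $$\int_{\mathcal{U}(d)} |\mathrm{Tr}(U)|^{2n}\, dU \;=\; \sum_{\substack{\lambda \vdash n \\ l(\lambda)\le d}} \left(\dim S^\lambda\right)^2 .$$
   Context: A partition $\lambda \vdash n$ is a tuple $\lambda=(\lambda_1,\dots,\lambda_l)$ of integers with $\lambda_1\ge\cdots\ge\lambda_l>0$ and $\lambda_1+\cdots+\lambda_l=n$; its length is $l(\lambda)=l$. $S^\lambda$ denotes the Specht module, i.e. the irreducible complex representation of the symmetric group $\mathcal{S}_n$ indexed by $\lambda$ (its dimension is the number of standard Young tableaux of shape $\lambda$, equivalently $n!$ divided by the product of the hook lengths of the boxes of $\lambda$). *)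

theory Defs
  imports "HOL-Probability.Probability" "HOL-Combinatorics.Permutations"
    "HOL-Library.Function_Algebras"
begin

definition conj_transpose :: "complex^'d^'d \<Rightarrow> complex^'d^'d" where
  "conj_transpose U = (\<chi> i j. cnj (U $ j $ i))"

definition unitary_group :: "(complex^'d::finite^'d) set" where
  "unitary_group = {U. U ** conj_transpose U = mat 1 \<and> conj_transpose U ** U = mat 1}"

text \<open>Every finite Borel measure on this compact metrizable group is regular, so left
  invariance and total mass 1 characterize the Haar probability measure.\<close>

definition haar_prob_measure :: "(complex^'d::finite^'d) measure \<Rightarrow> bool" where
  "haar_prob_measure M \<longleftrightarrow>
     sets M = sets (restrict_space borel unitary_group) \<and>
     prob_space M \<and>
     (\<forall>V\<in>unitary_group. distr M M (\<lambda>U. V ** U) = M)"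

definition partitions :: "nat \<Rightarrow> nat list set" where
  "partitions n = {\<mu>. sorted_wrt (\<ge>) \<mu> \<and> (\<forall>k\<in>set \<mu>. k > 0) \<and> sum_list \<mu> = n}"

lemma finite_partitions: "finite (partitions n)"
proof (rule finite_subset)
  have len: "length xs \<le> sum_list xs" if "\<forall>k\<in>set xs. k > 0" for xs :: "nat list"
    using that by (induction xs) auto
  show "partitions n \<subseteq> {xs. set xs \<subseteq> {..n} \<and> length xs \<le> n}"
    using len by (auto simp: partitions_def intro: member_le_sum_list)
  show "finite {xs. set xs \<subseteq> {..n} \<and> length xs \<le> n}"
    by (rule finite_lists_length_le) simp
qed

definition cells :: "nat list \<Rightarrow> (nat \<times> nat) set" where
  "cells \<mu> = {(i, j). i < length \<mu> \<and> j < \<mu> ! i}"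

text \<open>Tableaux are arbitrary (not necessarily standard) bijective fillings; their values
  outside the diagram are irrelevant to everything below.\<close>

definition tableaux :: "nat list \<Rightarrow> (nat \<times> nat \<Rightarrow> nat) set" where
  "tableaux \<mu> = {T. bij_betw T (cells \<mu>) {1..sum_list \<mu>}}"

text \<open>The row-equivalence class of a tableau, encoded as the list of its row contents.\<close>

definition tabloid :: "nat list \<Rightarrow> (nat \<times> nat \<Rightarrow> nat) \<Rightarrow> nat set list" where
  "tabloid \<mu> T = map (\<lambda>i. (\<lambda>j. T (i, j)) ` {..<\<mu> ! i}) [0..<length \<mu>]"

definition column_stabilizer :: "nat list \<Rightarrow> (nat \<times> nat \<Rightarrow> nat) \<Rightarrow> (nat \<Rightarrow> nat) set" where
  "column_stabilizer \<mu> T =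
     {\<pi>. \<pi> permutes {1..sum_list \<mu>} \<and>
          (\<forall>(i, j)\<in>cells \<mu>. \<exists>i'. (i', j) \<in> cells \<mu> \<and> \<pi> (T (i, j)) = T (i', j))}"

text \<open>The permutation module on tabloids is realized inside the complex-valued functions on
  \<^typ>\<open>nat set list\<close>, a tabloid being identified with its indicator function.\<close>

definition polytabloid :: "nat list \<Rightarrow> (nat \<times> nat \<Rightarrow> nat) \<Rightarrow> (nat set list \<Rightarrow> complex)" where
  "polytabloid \<mu> T =
     (\<lambda>t. \<Sum>\<pi>\<in>column_stabilizer \<mu> T.
            of_int (sign \<pi>) * (if t = tabloid \<mu> (\<pi> \<circ> T) then 1 else 0))"

interpretation cfun: vector_space "\<lambda>(c::complex) (f::'a \<Rightarrow> complex) t. c * f t"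
  by unfold_locales (auto simp: fun_eq_iff algebra_simps)

definition specht_module :: "nat list \<Rightarrow> (nat set list \<Rightarrow> complex) set" where
  "specht_module \<mu> = cfun.span (polytabloid \<mu> ` tableaux \<mu>)"

definition specht_dim :: "nat list \<Rightarrow> nat" where
  "specht_dim \<mu> = cfun.dim (specht_module \<mu>)"

end

theory Submission
  imports Defs "HOL-Combinatorics.Cycles"
begin

text \<open>Both sides are the dimension of the algebra generated by the permutations of the tensor factors
  of \<open>V\<^sup>\<otimes>\<^sup>n\<close>, where \<open>V\<close> is the natural representation of the unitary group.

  The map \<open>Z \<mapsto> \<integral> U\<^sup>\<otimes>\<^sup>n Z (U\<^sup>\<otimes>\<^sup>n)\<^sup>* dU\<close> is a projection onto the commutant of the unitary group whose
  trace is the integral. The commutant condition is polynomial in \<open>U\<close>, so it extends from unitary to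
  all matrices; by polarization their tensor powers span the matrices invariant under permutations, so
  the commutant of the unitary group is the bicommutant of the permutations, which by Maschke
  averaging is the image of the group algebra.

  In the group algebra, the Young symmetrizers \<open>e\<close> satisfy \<open>e a e \<in> \<complex> e\<close>, are mutually orthogonal, and
  generate left ideals isomorphic to the Specht modules, of dimension \<open>f = n! / c\<close> where \<open>e\<^sup>2 = c e\<close>.
  The rescaled sum of the conjugates of \<open>e\<close> is a central idempotent with coefficient \<open>n! / c\<^sup>2\<close> at the
  identity, hence generates an ideal of dimension \<open>(n! / c)\<^sup>2 = f\<^sup>2\<close>. Since there are as many of them
  as cycle types, they add up to 1. The idempotent of \<open>\<lambda>\<close> acts as zero on \<open>V\<^sup>\<otimes>\<^sup>n\<close> exactly if \<open>\<lambda>\<close> has more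
  than \<open>dim V\<close> rows, so the image of the group algebra has dimension \<open>\<Sum> f\<^sup>2\<close> over the other \<open>\<lambda>\<close>.\<close>

section \<open>Linear algebra of finitely supported functions\<close>

text \<open>The dimensions of ideals are computed as traces: right multiplication by
  \<open>a\<close> on the group algebra has trace \<open>n!\<close> times the coefficient of
  \<open>a\<close> at the identity. For \<open>e / c\<close> this is \<open>n! / c\<close>, since
  row and column stabilizers meet trivially and so \<open>e\<close> has coefficient 1 there; for the
  central idempotent it is the square of that number. The constant \<open>c\<close> stays abstract;
  that it is nonzero comes from positivity of the involution \<open>adj\<close>. The factor
  \<open>1 / c\<^sup>2\<close> is forced because \<open>e\<close> is an eigenvector, with eigenvalue
  \<open>c\<^sup>2\<close>, of the sum of its own conjugates. The passage from unitary to all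
  matrices is there because polarization takes sums, under which the unitary matrices are not
  closed. In the last step the kernel of the action is a two-sided ideal; since \<open>e a e\<close>
  is always a multiple of \<open>e\<close>, a kernel element with a nonzero component at
  \<open>\<lambda>\<close> would force \<open>e\<close> itself to act as zero.\<close>

lemma sum_fun_apply: "(\<Sum>i\<in>I. f i) x = (\<Sum>i\<in>I. f i x)"
  for f :: "'i \<Rightarrow> 'a \<Rightarrow> 'b::comm_monoid_add"
  by (induction I rule: infinite_finite_induct) auto

lemma finite_support_in_span:
  fixes f :: "'a \<Rightarrow> complex"
  assumes "finite X" "\<And>x. x \<notin> X \<Longrightarrow> f x = 0"
  shows "f = (\<Sum>x\<in>X. (\<lambda>y. f x * (if y = x then 1 else 0)))"
proof
  fix y
  have "(\<Sum>x\<in>X. f x * (if y = x then 1 else 0)) = (if y \<in> X then f y else 0)"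
    using assms(1) by (simp add: sum.delta' if_distrib[of "\<lambda>t. _ * t"] cong: if_cong)
  then show "f y = (\<Sum>x\<in>X. (\<lambda>y. f x * (if y = x then 1 else 0))) y"
    using assms(2) by (auto simp: sum_fun_apply)
qed

lemma finite_basis_exists:
  fixes V :: "('a \<Rightarrow> complex) set"
  assumes "finite X" "\<And>f x. f \<in> V \<Longrightarrow> x \<notin> X \<Longrightarrow> f x = 0"
  obtains B where "finite B" "B \<subseteq> V" "cfun.independent B" "V \<subseteq> cfun.span B"
    "card B = cfun.dim V"
proof -
  let ?D = "(\<lambda>x y. if y = x then 1 else 0 :: complex) ` X"
  obtain B where B: "B \<subseteq> V" "cfun.independent B" "V \<subseteq> cfun.span B" "card B = cfun.dim V"
    using cfun.basis_exists by blast
  have "V \<subseteq> cfun.span ?D"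
  proof
    fix f assume "f \<in> V"
    then have "f = (\<Sum>x\<in>X. (\<lambda>y. f x * (if y = x then 1 else 0)))"
      using assms by (intro finite_support_in_span) auto
    also have "\<dots> \<in> cfun.span ?D"
      by (intro cfun.span_sum cfun.span_scale cfun.span_base) auto
    finally show "f \<in> cfun.span ?D" .
  qed
  then have "finite B"
    using cfun.independent_span_bound[of ?D B] B assms(1) by auto
  with B that show thesis by blast
qed

text \<open>A kernel with columns in \<open>V\<close> that fixes \<open>V\<close> pointwise is a
  projection onto \<open>V\<close>, so its trace is its rank. This serves both the left ideals of
  the group algebra and the Haar average on matrices.\<close>

lemma trace_eq_dim_range:
  fixes k :: "'a \<Rightarrow> 'a \<Rightarrow> complex" and V :: "('a \<Rightarrow> complex) set"
  assumes X: "finite X"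
    and supp: "\<And>f x. f \<in> V \<Longrightarrow> x \<notin> X \<Longrightarrow> f x = 0"
    and into: "\<And>y. y \<in> X \<Longrightarrow> (\<lambda>x. if x \<in> X then k x y else 0) \<in> V"
    and fix_V: "\<And>f x. f \<in> V \<Longrightarrow> x \<in> X \<Longrightarrow> (\<Sum>y\<in>X. k x y * f y) = f x"
  shows "(\<Sum>x\<in>X. k x x) = of_nat (cfun.dim V)"
proof -
  obtain B where B: "finite B" "B \<subseteq> V" "cfun.independent B" "V \<subseteq> cfun.span B" "card B = cfun.dim V"
    using finite_basis_exists[of X V, OF X] supp by blast
  define c where "c y = (\<lambda>x. if x \<in> X then k x y else 0)" for y
  have c_in: "c y \<in> cfun.span B" if "y \<in> X" for y
    using into[OF that] B(4) by (auto simp: c_def)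
  define r where "r y = cfun.representation B (c y)" for y
  have c_eq: "c y = (\<Sum>b\<in>B. (\<lambda>x. r y b * b x))" if "y \<in> X" for y
    using cfun.sum_representation_eq[OF B(3) c_in[OF that] B(1) order_refl] by (simp add: r_def)
  \<comment> \<open>Expanding the columns of \<open>k\<close> in the identity that \<open>k\<close>
    fixes \<open>b\<close> writes \<open>b\<close> in the basis with these sums as coefficients;
    independence makes them Kronecker deltas.\<close>
  have dual: "(\<Sum>y\<in>X. b y * r y b') = (if b = b' then 1 else 0)" if b: "b \<in> B" "b' \<in> B" for b b'
  proof -
    have eq: "(\<Sum>b'\<in>B. (\<lambda>x. (\<Sum>y\<in>X. b y * r y b') * b' x)) = b"
    proof
      fix x
      have "(\<Sum>b'\<in>B. (\<lambda>x. (\<Sum>y\<in>X. b y * r y b') * b' x)) x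
            = (\<Sum>b'\<in>B. \<Sum>y\<in>X. b y * r y b' * b' x)"
        by (simp add: sum_fun_apply sum_distrib_right)
      also have "\<dots> = (\<Sum>y\<in>X. \<Sum>b'\<in>B. b y * (r y b' * b' x))"
        by (subst sum.swap) (simp add: mult.assoc)
      also have "\<dots> = (\<Sum>y\<in>X. b y * c y x)"
        by (intro sum.cong refl) (simp add: c_eq sum_fun_apply sum_distrib_left)
      also have "\<dots> = b x"
      proof (cases "x \<in> X")
        case True
        then show ?thesis
          using fix_V[of b x] b B(2) by (auto simp: c_def mult.commute)
      next
        case False
        then show ?thesis
          using supp[of b x] b B(2) by (auto simp: c_def)
      qed
      finally show "(\<Sum>b'\<in>B. (\<lambda>x. (\<Sum>y\<in>X. b y * r y b') * b' x)) x = b x" .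
    qed
    have "(\<Sum>b'\<in>B. (\<lambda>x. ((\<Sum>y\<in>X. b y * r y b') - (if b = b' then 1 else 0)) * b' x)) = 0"
    proof
      fix x
      have "(\<Sum>b'\<in>B. (if b = b' then 1 else 0) * b' x) = b x"
        using b B(1) by (simp add: if_distrib[of "\<lambda>t. t * _"] cong: if_cong)
      moreover have "(\<Sum>b'\<in>B. (\<Sum>y\<in>X. b y * r y b') * b' x) = b x"
        using fun_cong[OF eq, of x] by (simp add: sum_fun_apply)
      ultimately show "(\<Sum>b'\<in>B. (\<lambda>x. ((\<Sum>y\<in>X. b y * r y b') - (if b = b' then 1 else 0)) * b' x)) x = 0 x"
        by (simp add: sum_fun_apply left_diff_distrib sum_subtractf)
    qed
    then have "(\<Sum>y\<in>X. b y * r y b') - (if b = b' then 1 else 0) = 0"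
      using cfun.independentD[OF B(3) B(1) order_refl _ b(2),
          of "\<lambda>b'. (\<Sum>y\<in>X. b y * r y b') - (if b = b' then 1 else 0)"] by simp
    then show ?thesis by simp
  qed
  have "(\<Sum>x\<in>X. k x x) = (\<Sum>x\<in>X. c x x)"
    by (simp add: c_def)
  also have "\<dots> = (\<Sum>x\<in>X. \<Sum>b\<in>B. r x b * b x)"
    by (intro sum.cong refl) (simp add: c_eq sum_fun_apply)
  also have "\<dots> = (\<Sum>b\<in>B. \<Sum>x\<in>X. b x * r x b)"
    by (subst sum.swap) (simp add: mult.commute)
  also have "\<dots> = of_nat (card B)"
    using dual by simp
  finally show ?thesis using B(5) by simp
qed

text \<open>Injectivity is asked on \<open>V\<close> alone because both maps it serves,
  \<open>pull\<close> and \<open>rep\<close>, lose information outside \<open>V\<close>.\<close>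

lemma dim_injective_image:
  fixes L :: "('a \<Rightarrow> complex) \<Rightarrow> ('b \<Rightarrow> complex)"
  assumes X: "finite X" and sub: "cfun.subspace V"
    and supp: "\<And>f x. f \<in> V \<Longrightarrow> x \<notin> X \<Longrightarrow> f x = 0"
    and lin: "Vector_Spaces.linear (\<lambda>c f t. c * f t) (\<lambda>c f t. c * f t) L"
    and inj: "\<And>f. f \<in> V \<Longrightarrow> L f = 0 \<Longrightarrow> f = 0"
  shows "cfun.dim (L ` V) = cfun.dim V"
proof -
  interpret L: Vector_Spaces.linear "\<lambda>(c::complex) (f::'a \<Rightarrow> complex) t. c * f t"
      "\<lambda>(c::complex) (f::'b \<Rightarrow> complex) t. c * f t" L
    by (rule lin)
  obtain B where B: "finite B" "B \<subseteq> V" "cfun.independent B" "V \<subseteq> cfun.span B" "card B = cfun.dim V"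
    using finite_basis_exists[of X V, OF X] supp by blast
  have spanV: "cfun.span B = V"
    using B(2,4) cfun.span_minimal[OF B(2) sub] by auto
  have injV: "inj_on L V"
  proof (rule inj_onI)
    fix f g assume "f \<in> V" "g \<in> V" "L f = L g"
    then have "L (f - g) = 0" "f - g \<in> V"
      using sub by (auto simp: L.diff cfun.subspace_diff)
    then show "f = g" using inj by fastforce
  qed
  have "cfun.independent (L ` B)"
    using L.independent_injective_image[OF B(3)] injV spanV by simp
  moreover have "L ` V = cfun.span (L ` B)"
    using L.span_image[of B] spanV by simp
  ultimately have "cfun.dim (L ` V) = card (L ` B)"
    using cfun.dim_span_eq_card_independent by simp
  also have "\<dots> = card B"
    using injV B(2) by (intro card_image) (auto intro: inj_on_subset)
  finally show ?thesis using B(5) by simp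
qed

section \<open>Polynomial functions of one complex variable\<close>

definition polyfun :: "(complex \<Rightarrow> complex) \<Rightarrow> bool" where
  "polyfun f \<longleftrightarrow> (\<exists>p. f = poly p)"

named_theorems polyfun_intros

lemma polyfun_const [polyfun_intros]: "polyfun (\<lambda>z. c)"
  unfolding polyfun_def by (intro exI[of _ "[:c:]"]) auto

lemma polyfun_id [polyfun_intros]: "polyfun (\<lambda>z. z)"
  unfolding polyfun_def by (intro exI[of _ "[:0, 1:]"]) auto

lemma polyfun_if [polyfun_intros]:
  "polyfun f \<Longrightarrow> polyfun g \<Longrightarrow> polyfun (\<lambda>z. if P then f z else g z)"
  by (cases P) simp_all

lemma polyfun_add [polyfun_intros]: "polyfun f \<Longrightarrow> polyfun g \<Longrightarrow> polyfun (\<lambda>z. f z + g z)"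
  by (auto simp: polyfun_def fun_eq_iff intro: exI[of _ "_ + _"])

lemma polyfun_diff [polyfun_intros]: "polyfun f \<Longrightarrow> polyfun g \<Longrightarrow> polyfun (\<lambda>z. f z - g z)"
  by (auto simp: polyfun_def fun_eq_iff intro: exI[of _ "_ - _"])

lemma polyfun_mult [polyfun_intros]: "polyfun f \<Longrightarrow> polyfun g \<Longrightarrow> polyfun (\<lambda>z. f z * g z)"
  by (auto simp: polyfun_def fun_eq_iff intro: exI[of _ "_ * _"])

lemma polyfun_sum [polyfun_intros]: "(\<And>i. i \<in> I \<Longrightarrow> polyfun (f i)) \<Longrightarrow> polyfun (\<lambda>z. \<Sum>i\<in>I. f i z)"
  by (induction I rule: infinite_finite_induct) (auto intro: polyfun_intros)

lemma polyfun_prod [polyfun_intros]: "(\<And>i. i \<in> I \<Longrightarrow> polyfun (f i)) \<Longrightarrow> polyfun (\<lambda>z. \<Prod>i\<in>I. f i z)"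
  by (induction I rule: infinite_finite_induct) (auto intro: polyfun_intros)

text \<open>Plays the part of Zariski density: an identity known at infinitely many parameters of a
  polynomial curve holds along the whole curve.\<close>

lemma polyfun_eq_0:
  assumes "polyfun f" "infinite Z" "\<And>z. z \<in> Z \<Longrightarrow> f z = 0"
  shows "f z = 0"
proof -
  obtain p where p: "f = poly p" using assms(1) by (auto simp: polyfun_def)
  have "Z \<subseteq> {z. poly p z = 0}" using assms(3) p by auto
  then have "p = 0" using assms(2) poly_roots_finite finite_subset by blast
  then show ?thesis using p by simp
qed

section \<open>The group algebra of the symmetric group\<close>

locale perm_algebra =
  fixes n :: nat
begin

definition G :: "(nat \<Rightarrow> nat) set" where
  "G = {\<pi>. \<pi> permutes {1..n}}"

text \<open>Vanishing outside \<open>G\<close> makes equality in the group algebra plain equality of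
  functions.\<close>

definition alg :: "((nat \<Rightarrow> nat) \<Rightarrow> complex) set" where
  "alg = {a. \<forall>g. g \<notin> G \<longrightarrow> a g = 0}"

definition conv :: "((nat \<Rightarrow> nat) \<Rightarrow> complex) \<Rightarrow> ((nat \<Rightarrow> nat) \<Rightarrow> complex) \<Rightarrow> (nat \<Rightarrow> nat) \<Rightarrow> complex"
    (infixl "\<star>" 70) where
  "a \<star> b = (\<lambda>g. if g \<in> G then \<Sum>h\<in>G. a h * b (inv h \<circ> g) else 0)"

definition delta :: "(nat \<Rightarrow> nat) \<Rightarrow> (nat \<Rightarrow> nat) \<Rightarrow> complex" where
  "delta g = (\<lambda>h. if h = g then 1 else 0)"

definition adj :: "((nat \<Rightarrow> nat) \<Rightarrow> complex) \<Rightarrow> (nat \<Rightarrow> nat) \<Rightarrow> complex" where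
  "adj a = (\<lambda>g. if g \<in> G then cnj (a (inv g)) else 0)"

lemma finite_G [simp]: "finite G"
  unfolding G_def by (rule finite_permutations) simp

lemma card_G: "card G = fact n"
  unfolding G_def using card_permutations[of "{1..n}" n] by simp

lemma id_G [simp]: "id \<in> G"
  by (simp add: G_def permutes_id)

lemma comp_G [simp]: "g \<in> G \<Longrightarrow> h \<in> G \<Longrightarrow> g \<circ> h \<in> G"
  by (simp add: G_def permutes_compose)

lemma inv_G [simp]: "g \<in> G \<Longrightarrow> inv g \<in> G"
  by (simp add: G_def permutes_inv)

lemma inv_inv_G [simp]: "g \<in> G \<Longrightarrow> inv (inv g) = g"
  by (auto simp: G_def permutes_inv_inv)

lemma inv_comp_G [simp]: "g \<in> G \<Longrightarrow> inv g \<circ> g = id" "g \<in> G \<Longrightarrow> g \<circ> inv g = id"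
  by (auto simp: G_def permutes_inv_o)

lemma inv_cancel_G [simp]:
  "g \<in> G \<Longrightarrow> inv g \<circ> (g \<circ> h) = h" "g \<in> G \<Longrightarrow> g \<circ> (inv g \<circ> h) = h"
  by (auto simp: o_assoc)

lemma inv_app_G [simp]: "g \<in> G \<Longrightarrow> inv g (g x) = x" "g \<in> G \<Longrightarrow> g (inv g x) = x"
  by (auto simp: G_def permutes_inverses)

lemma inv_o_G: "g \<in> G \<Longrightarrow> h \<in> G \<Longrightarrow> inv (g \<circ> h) = inv h \<circ> inv g"
  by (auto simp: G_def intro!: o_inv_distrib permutes_bij)

lemma sum_G_left:
  assumes "g \<in> G" shows "(\<Sum>h\<in>G. f (g \<circ> h)) = (\<Sum>h\<in>G. f h)"
  using assms by (intro sum.reindex_bij_witness[where i = "\<lambda>h. inv g \<circ> h" and j = "\<lambda>h. g \<circ> h"]) auto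

lemma sum_G_right:
  assumes "g \<in> G" shows "(\<Sum>h\<in>G. f (h \<circ> g)) = (\<Sum>h\<in>G. f h)"
  using assms
  by (intro sum.reindex_bij_witness[where i = "\<lambda>h. h \<circ> inv g" and j = "\<lambda>h. h \<circ> g"])
     (auto simp: comp_assoc)

lemma sum_G_inv: "(\<Sum>h\<in>G. f (inv h)) = (\<Sum>h\<in>G. f h)"
  by (intro sum.reindex_bij_witness[where i = inv and j = inv]) auto

lemma conv_alg [simp]: "a \<star> b \<in> alg"
  by (simp add: conv_def alg_def)

lemma delta_alg [simp]: "g \<in> G \<Longrightarrow> delta g \<in> alg"
  by (auto simp: delta_def alg_def)

lemma alg_eqI:
  assumes "a \<in> alg" "b \<in> alg" "\<And>g. g \<in> G \<Longrightarrow> a g = b g"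
  shows "a = b"
  using assms by (force simp: alg_def)

lemma subspace_alg: "cfun.subspace alg"
  by (auto simp: cfun.subspace_def alg_def)

lemma conv_assoc: "(a \<star> b) \<star> c = a \<star> (b \<star> c)"
proof (rule alg_eqI)
  fix g assume g: "g \<in> G"
  have "((a \<star> b) \<star> c) g = (\<Sum>h\<in>G. \<Sum>k\<in>G. a k * b (inv k \<circ> h) * c (inv h \<circ> g))"
    using g by (simp add: conv_def sum_distrib_right)
  also have "\<dots> = (\<Sum>k\<in>G. \<Sum>h\<in>G. a k * b (inv k \<circ> h) * c (inv h \<circ> g))"
    by (rule sum.swap)
  also have "\<dots> = (\<Sum>k\<in>G. \<Sum>h\<in>G. a k * (b h * c (inv h \<circ> (inv k \<circ> g))))"
  proof (rule sum.cong[OF refl])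
    fix k assume k: "k \<in> G"
    have "(\<Sum>h\<in>G. a k * b (inv k \<circ> h) * c (inv h \<circ> g))
        = (\<Sum>h\<in>G. a k * b (inv k \<circ> (k \<circ> h)) * c (inv (k \<circ> h) \<circ> g))"
      using sum_G_left[OF k, of "\<lambda>h. a k * b (inv k \<circ> h) * c (inv h \<circ> g)"] by simp
    also have "\<dots> = (\<Sum>h\<in>G. a k * (b h * c (inv h \<circ> (inv k \<circ> g))))"
      using k by (intro sum.cong refl) (simp add: inv_o_G comp_assoc mult.assoc)
    finally show "(\<Sum>h\<in>G. a k * b (inv k \<circ> h) * c (inv h \<circ> g))
        = (\<Sum>h\<in>G. a k * (b h * c (inv h \<circ> (inv k \<circ> g))))" .
  qed
  also have "\<dots> = (a \<star> (b \<star> c)) g"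
    using g by (simp add: conv_def sum_distrib_left)
  finally show "((a \<star> b) \<star> c) g = (a \<star> (b \<star> c)) g" .
qed auto

lemma conv_scale_left: "(\<lambda>g. c * a g) \<star> b = (\<lambda>g. c * (a \<star> b) g)"
  by (auto simp: conv_def sum_distrib_left mult_ac)

lemma conv_scale_right: "a \<star> (\<lambda>g. c * b g) = (\<lambda>g. c * (a \<star> b) g)"
  by (auto simp: conv_def sum_distrib_left mult_ac)

lemma conv_sum_left: "(\<lambda>g. \<Sum>i\<in>I. f i g) \<star> b = (\<lambda>g. \<Sum>i\<in>I. (f i \<star> b) g)"
  by (auto simp: conv_def sum_distrib_right fun_eq_iff intro: sum.swap)

lemma conv_sum_right: "a \<star> (\<lambda>g. \<Sum>i\<in>I. f i g) = (\<lambda>g. \<Sum>i\<in>I. (a \<star> f i) g)"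
  by (auto simp: conv_def sum_distrib_left fun_eq_iff intro: sum.swap)

lemma conv_zero [simp]: "(\<lambda>_. 0) \<star> b = (\<lambda>_. 0)" "a \<star> (\<lambda>_. 0) = (\<lambda>_. 0)"
  by (auto simp: conv_def)

lemma conv_zero' [simp]: "0 \<star> b = 0" "a \<star> 0 = 0"
  by (auto simp: conv_def fun_eq_iff)

lemma delta_conv: "g \<in> G \<Longrightarrow> h \<in> G \<Longrightarrow> (delta g \<star> b) h = b (inv g \<circ> h)"
  by (simp add: conv_def delta_def if_distrib[of "\<lambda>t. t * _"] cong: if_cong)

lemma conv_delta:
  assumes "g \<in> G" "h \<in> G" shows "(a \<star> delta g) h = a (h \<circ> inv g)"
proof -
  have "inv k \<circ> h = g \<longleftrightarrow> k = h \<circ> inv g" if "k \<in> G" for k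
    using assms that by (metis comp_assoc comp_id inv_cancel_G(2) inv_comp_G(2) inv_comp_G(1))
  then have "(\<Sum>k\<in>G. a k * delta g (inv k \<circ> h)) = (\<Sum>k\<in>G. if k = h \<circ> inv g then a k else 0)"
    by (intro sum.cong refl) (simp add: delta_def)
  then show ?thesis using assms by (simp add: conv_def)
qed

lemma delta_delta: "g \<in> G \<Longrightarrow> h \<in> G \<Longrightarrow> delta g \<star> delta h = delta (g \<circ> h)"
proof (rule alg_eqI)
  fix k assume gh: "g \<in> G" "h \<in> G" and k: "k \<in> G"
  have "inv g \<circ> k = h \<longleftrightarrow> k = g \<circ> h"
    using gh by (metis inv_cancel_G)
  then show "(delta g \<star> delta h) k = delta (g \<circ> h) k"
    using gh k by (simp add: delta_conv) (simp add: delta_def)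
qed simp_all

lemma delta_id_conv [simp]: "a \<in> alg \<Longrightarrow> delta id \<star> a = a"
  by (rule alg_eqI) (auto simp: delta_conv)

lemma conv_delta_id [simp]: "a \<in> alg \<Longrightarrow> a \<star> delta id = a"
  by (rule alg_eqI) (auto simp: conv_delta)

lemma alg_expand:
  assumes "a \<in> alg" shows "a = (\<lambda>g. \<Sum>h\<in>G. a h * delta h g)"
proof
  fix g
  have "(\<Sum>h\<in>G. a h * delta h g) = (\<Sum>h\<in>G. if h = g then a h else 0)"
    by (intro sum.cong) (auto simp: delta_def)
  then show "a g = (\<Sum>h\<in>G. a h * delta h g)"
    using assms by (simp add: alg_def)
qed

lemma conv_expand_left: "a \<in> alg \<Longrightarrow> a \<star> b = (\<lambda>g. \<Sum>h\<in>G. a h * (delta h \<star> b) g)"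
  by (subst alg_expand[of a], assumption) (simp add: conv_sum_left conv_scale_left)

lemma conv_expand_right: "b \<in> alg \<Longrightarrow> a \<star> b = (\<lambda>g. \<Sum>h\<in>G. b h * (a \<star> delta h) g)"
  by (subst alg_expand[of b], assumption) (simp add: conv_sum_right conv_scale_right)

lemma adj_alg [simp]: "adj a \<in> alg"
  by (simp add: adj_def alg_def)

lemma adj_conv: "adj (a \<star> b) = adj b \<star> adj a"
proof (rule alg_eqI)
  fix g assume g: "g \<in> G"
  have "(adj b \<star> adj a) g = (\<Sum>h\<in>G. cnj (b (inv h)) * cnj (a (inv (inv h \<circ> g))))"
    using g by (simp add: conv_def adj_def)
  also have "\<dots> = (\<Sum>h\<in>G. cnj (b (inv (g \<circ> h))) * cnj (a (inv (inv (g \<circ> h) \<circ> g))))"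
    by (rule sum_G_left[OF g, symmetric])
  also have "\<dots> = (\<Sum>h\<in>G. cnj (a h) * cnj (b (inv h \<circ> inv g)))"
    using g by (intro sum.cong refl) (simp add: inv_o_G comp_assoc)
  finally show "adj (a \<star> b) g = (adj b \<star> adj a) g"
    using g by (simp add: conv_def adj_def)
qed auto

text \<open>Positivity of the involution: the coefficient of \<open>a \<star> adj a\<close> at the
  identity is the sum of the squared moduli of the coefficients of \<open>a\<close>.\<close>

lemma conv_adj_eq_0D:
  assumes "a \<in> alg" "a \<star> adj a = (\<lambda>_. 0)"
  shows "a = (\<lambda>_. 0)"
proof -
  have "(\<Sum>h\<in>G. a h * cnj (a h)) = (a \<star> adj a) id"
    by (simp add: conv_def adj_def)
  then have "complex_of_real (\<Sum>h\<in>G. (cmod (a h))\<^sup>2) = 0"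
    using assms(2) by (simp add: complex_norm_square del: of_real_power)
  then have "(\<Sum>h\<in>G. (cmod (a h))\<^sup>2) = 0"
    by (simp only: of_real_eq_0_iff)
  then have "\<forall>h\<in>G. a h = 0"
    by (subst (asm) sum_nonneg_eq_0_iff) auto
  then show ?thesis using assms(1) by (auto simp: alg_def)
qed

section \<open>Class functions, left ideals and central elements\<close>

definition class_fun :: "((nat \<Rightarrow> nat) \<Rightarrow> complex) \<Rightarrow> bool" where
  "class_fun f \<longleftrightarrow> f \<in> alg \<and> (\<forall>x\<in>G. \<forall>g\<in>G. f (x \<circ> g \<circ> inv x) = f g)"

lemma class_fun_commute:
  assumes "class_fun z" shows "z \<star> a = a \<star> z"
proof (rule alg_eqI)
  fix g assume g: "g \<in> G"
  have "(z \<star> a) g = (\<Sum>h\<in>G. z (inv h) * a (h \<circ> g))"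
    using g sum_G_inv[of "\<lambda>h. z h * a (inv h \<circ> g)"] by (simp add: conv_def)
  also have "\<dots> = (\<Sum>h\<in>G. z (inv (h \<circ> inv g)) * a (h \<circ> inv g \<circ> g))"
    using sum_G_right[OF inv_G[OF g], of "\<lambda>h. z (inv h) * a (h \<circ> g)"] by simp
  also have "\<dots> = (\<Sum>h\<in>G. a h * z (inv h \<circ> g))"
  proof (intro sum.cong refl)
    fix h assume h: "h \<in> G"
    \<comment> \<open>The argument on the left is \<open>g \<circ> inv h\<close>, which is the
      inverse of \<open>h \<circ> inv g\<close>.\<close>
    have "z (h \<circ> (inv h \<circ> g) \<circ> inv h) = z (inv h \<circ> g)"
      using assms g h by (simp add: class_fun_def del: inv_cancel_G)
    then show "z (inv (h \<circ> inv g)) * a (h \<circ> inv g \<circ> g) = a h * z (inv h \<circ> g)"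
      using g h by (simp add: inv_o_G comp_assoc)
  qed
  finally show "(z \<star> a) g = (a \<star> z) g"
    using g by (simp add: conv_def)
qed auto

definition conj_sum :: "((nat \<Rightarrow> nat) \<Rightarrow> complex) \<Rightarrow> (nat \<Rightarrow> nat) \<Rightarrow> complex" where
  "conj_sum a = (\<lambda>g. \<Sum>x\<in>G. (delta x \<star> a \<star> delta (inv x)) g)"

lemma conj_sum_eq: "g \<in> G \<Longrightarrow> conj_sum a g = (\<Sum>x\<in>G. a (inv x \<circ> g \<circ> x))"
  unfolding conj_sum_def by (intro sum.cong refl) (simp add: conv_delta delta_conv comp_assoc)

lemma conj_sum_alg [simp]: "conj_sum a \<in> alg"
  using conv_alg by (auto simp: conj_sum_def alg_def)

lemma class_fun_conj_sum: "class_fun (conj_sum a)"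
  unfolding class_fun_def
proof (intro conjI ballI)
  fix x g assume xg: "x \<in> G" "g \<in> G"
  have "conj_sum a (x \<circ> g \<circ> inv x) = (\<Sum>y\<in>G. a (inv y \<circ> (x \<circ> g \<circ> inv x) \<circ> y))"
    using xg by (simp add: conj_sum_eq)
  also have "\<dots> = (\<Sum>y\<in>G. a (inv (x \<circ> y) \<circ> (x \<circ> g \<circ> inv x) \<circ> (x \<circ> y)))"
    by (rule sum_G_left[OF xg(1), symmetric])
  also have "\<dots> = conj_sum a g"
    using xg by (simp add: conj_sum_eq inv_o_G comp_assoc)
  finally show "conj_sum a (x \<circ> g \<circ> inv x) = conj_sum a g" .
qed simp

definition left_ideal :: "((nat \<Rightarrow> nat) \<Rightarrow> complex) \<Rightarrow> ((nat \<Rightarrow> nat) \<Rightarrow> complex) set" where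
  "left_ideal e = (\<lambda>a. a \<star> e) ` alg"

text \<open>The divisor is the factor by which squaring multiplies the sum of the conjugates of
  \<open>e\<close> when \<open>e \<star> e\<close> is \<open>c\<close> times \<open>e\<close>; see
  \<open>z_z\<close>.\<close>

definition central_idem :: "((nat \<Rightarrow> nat) \<Rightarrow> complex) \<Rightarrow> complex \<Rightarrow> (nat \<Rightarrow> nat) \<Rightarrow> complex" where
  "central_idem e c = (\<lambda>g. conj_sum e g / c\<^sup>2)"

lemma subspace_left_ideal: "cfun.subspace (left_ideal e)"
  unfolding cfun.subspace_def
proof (intro conjI ballI allI)
  show "0 \<in> left_ideal e"
    unfolding left_ideal_def by (rule image_eqI[of _ _ 0]) (simp_all add: alg_def)
  fix x y assume "x \<in> left_ideal e" "y \<in> left_ideal e"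
  then obtain a b where ab: "a \<in> alg" "b \<in> alg" "x = a \<star> e" "y = b \<star> e"
    by (auto simp: left_ideal_def)
  have "x + y = (a + b) \<star> e"
    by (simp add: ab conv_def fun_eq_iff distrib_right sum.distrib)
  moreover have "a + b \<in> alg" using ab by (simp add: alg_def)
  ultimately show "x + y \<in> left_ideal e" by (auto simp: left_ideal_def)
  fix s have "(\<lambda>t. s * x t) = (\<lambda>t. s * a t) \<star> e" by (simp add: ab conv_scale_left)
  moreover have "(\<lambda>t. s * a t) \<in> alg" using ab by (simp add: alg_def)
  ultimately show "(\<lambda>t. s * x t) \<in> left_ideal e" by (auto simp: left_ideal_def)
qed

lemma left_ideal_fixed:
  assumes "e \<star> e = (\<lambda>g. c * e g)" "a \<in> left_ideal e"
  shows "a \<star> e = (\<lambda>g. c * a g)"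
proof -
  obtain b where "a = b \<star> e" using assms(2) by (auto simp: left_ideal_def)
  then show ?thesis by (simp add: conv_assoc assms(1) conv_scale_right)
qed

text \<open>The dimension is the trace of right multiplication by the idempotent \<open>e / c\<close>.\<close>

lemma dim_left_ideal:
  assumes e_e: "e \<star> e = (\<lambda>g. c * e g)" and c_nz: "c \<noteq> 0"
  shows "of_nat (cfun.dim (left_ideal e)) = fact n * e id / c"
proof -
  have "(\<Sum>x\<in>G. e (inv x \<circ> x) / c) = of_nat (cfun.dim (left_ideal e))"
  proof (rule trace_eq_dim_range[where k = "\<lambda>x y. e (inv y \<circ> x) / c"])
    show "f x = 0" if "f \<in> left_ideal e" "x \<notin> G" for f x
      using that conv_alg by (force simp: left_ideal_def alg_def)
    show "(\<lambda>x. if x \<in> G then e (inv y \<circ> x) / c else 0) \<in> left_ideal e" if "y \<in> G" for y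
    proof -
      have "(\<lambda>x. if x \<in> G then e (inv y \<circ> x) / c else 0) = (\<lambda>g. inverse c * (delta y \<star> e) g)"
        using that conv_alg[of "delta y" e] by (auto simp: fun_eq_iff delta_conv field_simps alg_def)
      then have "(\<lambda>x. if x \<in> G then e (inv y \<circ> x) / c else 0) = (\<lambda>g. inverse c * delta y g) \<star> e"
        by (simp only: conv_scale_left)
      moreover have "(\<lambda>g. inverse c * delta y g) \<in> alg"
        using that by (auto simp: alg_def delta_def)
      ultimately show ?thesis by (auto simp: left_ideal_def)
    qed
    show "(\<Sum>y\<in>G. e (inv y \<circ> x) / c * f y) = f x" if "f \<in> left_ideal e" "x \<in> G" for f x
    proof -
      have "(\<Sum>y\<in>G. e (inv y \<circ> x) / c * f y) = (f \<star> e) x / c"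
        using that by (simp add: conv_def sum_divide_distrib mult.commute)
      then show ?thesis using left_ideal_fixed[OF e_e that(1)] c_nz by simp
    qed
  qed simp
  then show ?thesis by (simp add: card_G)
qed

end

text \<open>Captures a primitive idempotent up to a scalar: \<open>sandwich\<close> says that
  \<open>e\<close> cuts the algebra down to a line. The normalization at the identity makes
  \<open>\<phi> a\<close> the coefficient of \<open>e \<star> a \<star> e\<close> there, so scalars
  can be found by evaluating at \<open>id\<close>.\<close>

locale quasi_idempotent = perm_algebra +
  fixes e :: "(nat \<Rightarrow> nat) \<Rightarrow> complex" and \<phi> :: "((nat \<Rightarrow> nat) \<Rightarrow> complex) \<Rightarrow> complex" and c :: complex
  assumes e_alg [simp]: "e \<in> alg"
    and e_id: "e id = 1"
    and sandwich: "\<And>a. a \<in> alg \<Longrightarrow> e \<star> a \<star> e = (\<lambda>g. \<phi> a * e g)"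
    and e_e: "e \<star> e = (\<lambda>g. c * e g)"
    and c_nz: "c \<noteq> 0"
begin

definition z :: "(nat \<Rightarrow> nat) \<Rightarrow> complex" where
  "z = conj_sum e"

lemma phi_e: "\<phi> e = c\<^sup>2"
proof -
  have "e \<star> e \<star> e = (\<lambda>g. c * (c * e g))"
    by (simp add: e_e conv_scale_left)
  then show ?thesis
    using fun_cong[OF sandwich[of e], of id] by (simp add: e_id power2_eq_square)
qed

text \<open>Expand the middle factor of \<open>e \<star> e \<star> e\<close> over the group and read
  off the coefficient at the identity. Up to inverting the summation index, the same sum is the
  eigenvalue computed in \<open>z_e\<close>.\<close>

lemma sum_phi_delta: "(\<Sum>x\<in>G. e x * \<phi> (delta x)) = c\<^sup>2"
proof -
  have "e \<star> e \<star> e = (\<lambda>g. \<Sum>x\<in>G. e x * (e \<star> delta x \<star> e) g)"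
    by (subst conv_expand_right[of e e], simp) (simp add: conv_sum_left conv_scale_left)
  then have "(e \<star> e \<star> e) id = (\<Sum>x\<in>G. e x * (e \<star> delta x \<star> e) id)"
    by simp
  also have "\<dots> = (\<Sum>x\<in>G. e x * \<phi> (delta x))"
    by (intro sum.cong refl) (simp add: sandwich e_id)
  finally show ?thesis
    using fun_cong[OF sandwich[of e], of id] by (simp add: e_id phi_e)
qed

lemma z_class_fun: "class_fun z"
  unfolding z_def by (rule class_fun_conj_sum)

lemma z_alg [simp]: "z \<in> alg"
  by (simp add: z_def)

lemma z_id: "z id = fact n"
  by (simp add: z_def conj_sum_eq e_id comp_def[of _ id] card_G)

text \<open>Centrality turns \<open>z \<star> e \<star> e\<close> into
  \<open>e \<star> z \<star> e\<close>, so \<open>z \<star> e\<close> is a multiple of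
  \<open>e\<close>. The factor is its coefficient at the identity, to which the conjugate by
  \<open>x\<close> contributes \<open>\<phi> (delta (inv x)) * e (inv x)\<close>.\<close>

lemma z_e: "z \<star> e = (\<lambda>g. c\<^sup>2 * e g)"
proof -
  have "(\<lambda>g. c * (z \<star> e) g) = z \<star> e \<star> e"
    by (simp add: conv_assoc e_e conv_scale_right)
  also have "\<dots> = e \<star> z \<star> e"
    by (simp add: class_fun_commute[OF z_class_fun])
  also have "\<dots> = (\<lambda>g. \<phi> z * e g)"
    by (simp add: sandwich)
  finally have *: "c * (z \<star> e) g = \<phi> z * e g" for g
    by (rule fun_cong)
  have "(z \<star> e) id = (\<Sum>x\<in>G. (delta x \<star> (e \<star> delta (inv x) \<star> e)) id)"
    by (simp add: z_def conj_sum_def conv_sum_left conv_assoc)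
  also have "\<dots> = (\<Sum>x\<in>G. \<phi> (delta (inv x)) * e (inv x))"
    by (intro sum.cong refl) (simp add: sandwich conv_scale_right delta_conv)
  also have "\<dots> = c\<^sup>2"
    using sum_G_inv[of "\<lambda>x. \<phi> (delta x) * e x"] sum_phi_delta by (simp add: mult.commute)
  finally have "\<phi> z = c * c\<^sup>2"
    using *[of id] by (simp add: e_id)
  with * c_nz show ?thesis by (simp add: fun_eq_iff mult.assoc)
qed

lemma z_z: "z \<star> z = (\<lambda>g. c\<^sup>2 * z g)"
proof -
  have "z \<star> (delta x \<star> e \<star> delta (inv x)) = (\<lambda>g. c\<^sup>2 * (delta x \<star> e \<star> delta (inv x)) g)" for x
  proof -
    have "z \<star> (delta x \<star> e \<star> delta (inv x)) = delta x \<star> (z \<star> e) \<star> delta (inv x)"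
      by (metis class_fun_commute conv_assoc z_class_fun)
    then show ?thesis by (simp add: z_e conv_scale_left conv_scale_right)
  qed
  then have "z \<star> z = (\<lambda>g. \<Sum>x\<in>G. c\<^sup>2 * (delta x \<star> e \<star> delta (inv x)) g)"
    by (subst (2) z_def) (simp add: conj_sum_def conv_sum_right)
  then show ?thesis by (simp add: z_def conj_sum_def sum_distrib_left)
qed

lemma central_idem_class_fun: "class_fun (central_idem e c)"
  using z_class_fun by (auto simp: class_fun_def central_idem_def z_def[symmetric] alg_def)

lemma central_idem_scale: "central_idem e c = (\<lambda>g. inverse (c\<^sup>2) * z g)"
  by (simp add: central_idem_def z_def[symmetric] field_simps)

lemma central_idem_idem: "central_idem e c \<star> central_idem e c = central_idem e c"
  using c_nz by (auto simp: central_idem_scale conv_scale_left conv_scale_right z_z)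

lemma central_idem_id: "central_idem e c id = fact n / c\<^sup>2"
  by (simp add: central_idem_def z_def[symmetric] z_id)

text \<open>The hypothesis says that \<open>e\<close> annihilates every translate of
  \<open>a\<close> from both sides. Summing conjugates of the left \<open>e\<close> gives
  \<open>z \<star> a \<star> delta y \<star> e = 0\<close>; moving the central \<open>z\<close> to
  \<open>e\<close> turns it into the nonzero scalar \<open>c\<^sup>2\<close>. Summing conjugates of
  the right \<open>e\<close> then gives \<open>a \<star> z = 0\<close>. Later \<open>a\<close> is an
  element acting as zero on tensors.\<close>

lemma conv_central_idem_eq_0:
  assumes a: "a \<in> alg" and "\<And>x y. x \<in> G \<Longrightarrow> y \<in> G \<Longrightarrow> \<phi> (delta x \<star> a \<star> delta y) = 0"
  shows "a \<star> central_idem e c = (\<lambda>_. 0)"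
proof -
  have "a \<star> delta y \<star> e = (\<lambda>_. 0)" if y: "y \<in> G" for y
  proof -
    define b where "b = a \<star> delta y \<star> e"
    have "e \<star> delta x \<star> b = (\<lambda>_. 0)" if "x \<in> G" for x
      using sandwich[of "delta x \<star> a \<star> delta y"] assms(2)[OF that y] by (simp add: b_def conv_assoc)
    then have "delta x \<star> e \<star> delta (inv x) \<star> b = (\<lambda>_. 0)" if "x \<in> G" for x
      using that by (metis conv_assoc conv_zero(2) inv_G)
    then have "z \<star> b = (\<lambda>_. 0)"
      by (simp add: z_def conj_sum_def conv_sum_left)
    moreover have "z \<star> b = (\<lambda>g. c\<^sup>2 * b g)"
    proof -
      have "z \<star> b = (z \<star> (a \<star> delta y)) \<star> e" by (simp add: b_def conv_assoc)
      also have "\<dots> = (a \<star> delta y) \<star> (z \<star> e)"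
        by (simp only: class_fun_commute[OF z_class_fun] conv_assoc)
      also have "\<dots> = (\<lambda>g. c\<^sup>2 * b g)" by (simp add: z_e conv_scale_right b_def)
      finally show ?thesis .
    qed
    ultimately show ?thesis using c_nz by (auto simp: b_def[symmetric] fun_eq_iff)
  qed
  then have "a \<star> (delta y \<star> e \<star> delta (inv y)) = (\<lambda>_. 0)" if "y \<in> G" for y
    using that by (metis conv_assoc conv_zero(1))
  then have "a \<star> z = (\<lambda>_. 0)"
    by (simp add: z_def conj_sum_def conv_sum_right)
  then show ?thesis by (simp add: central_idem_scale conv_scale_right)
qed

end

context perm_algebra
begin

lemma conj_sum_conv_conj_sum_eq_0:
  assumes "\<And>a. a \<in> alg \<Longrightarrow> e \<star> a \<star> e' = (\<lambda>_. 0)"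
  shows "conj_sum e \<star> conj_sum e' = (\<lambda>_. 0)"
proof -
  have "(delta x \<star> e \<star> delta (inv x)) \<star> (delta y \<star> e' \<star> delta (inv y)) = (\<lambda>_. 0)" for x y
  proof -
    have "(delta x \<star> e \<star> delta (inv x)) \<star> (delta y \<star> e' \<star> delta (inv y))
        = delta x \<star> (e \<star> (delta (inv x) \<star> delta y) \<star> e') \<star> delta (inv y)"
      by (simp only: conv_assoc)
    then show ?thesis by (simp add: assms)
  qed
  then show ?thesis
    by (simp add: conj_sum_def conv_sum_left conv_sum_right)
qed

lemma central_idem_orth:
  assumes "\<And>a. a \<in> alg \<Longrightarrow> e \<star> a \<star> e' = (\<lambda>_. 0)"
  shows "central_idem e c \<star> central_idem e' c' = (\<lambda>_. 0)"
proof -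
  have "central_idem e c = (\<lambda>g. inverse (c\<^sup>2) * conj_sum e g)"
    "central_idem e' c' = (\<lambda>g. inverse (c'\<^sup>2) * conj_sum e' g)"
    by (simp_all add: central_idem_def field_simps)
  then show ?thesis
    by (simp add: conv_scale_left conv_scale_right conj_sum_conv_conj_sum_eq_0[OF assms])
qed

text \<open>A class function is constant where \<open>ct\<close> is, because equal types force
  conjugacy. This bounds the dimension of the class functions by the number of types, the
  counterpart of the independence of the idempotents.\<close>

lemma class_fun_in_span:
  assumes "finite I" and f: "class_fun f"
    and ct: "\<And>g. g \<in> G \<Longrightarrow> ct g \<in> I"
    and conj: "\<And>g h. g \<in> G \<Longrightarrow> h \<in> G \<Longrightarrow> ct g = ct h \<Longrightarrow> \<exists>x\<in>G. h = x \<circ> g \<circ> inv x"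
  shows "f \<in> cfun.span ((\<lambda>i g. if g \<in> G \<and> ct g = i then 1 else 0) ` I)"
proof -
  let ?ind = "\<lambda>i g. if g \<in> G \<and> ct g = i then 1 else 0 :: complex"
  define F where "F i = f (SOME g. g \<in> G \<and> ct g = i)" for i
  have F: "f g = F (ct g)" if g: "g \<in> G" for g
  proof -
    have "(SOME h. h \<in> G \<and> ct h = ct g) \<in> G \<and> ct (SOME h. h \<in> G \<and> ct h = ct g) = ct g"
      by (rule someI[of _ g]) (simp add: g)
    then obtain x where "x \<in> G" "(SOME h. h \<in> G \<and> ct h = ct g) = x \<circ> g \<circ> inv x"
      using conj[OF g] by metis
    then show ?thesis using f g by (simp add: F_def class_fun_def)
  qed
  have "f = (\<Sum>i\<in>I. (\<lambda>g. F i * ?ind i g))"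
  proof
    fix g
    show "f g = (\<Sum>i\<in>I. (\<lambda>g. F i * ?ind i g)) g"
    proof (cases "g \<in> G")
      case True
      have "(\<Sum>i\<in>I. F i * ?ind i g) = (\<Sum>i\<in>I. if i = ct g then F i else 0)"
        using True by (intro sum.cong) auto
      then show ?thesis using True assms(1) ct by (simp add: sum_fun_apply F)
    next
      case False
      then show ?thesis using f by (simp add: sum_fun_apply class_fun_def alg_def)
    qed
  qed
  also have "\<dots> \<in> cfun.span (?ind ` I)"
    by (intro cfun.span_sum cfun.span_scale cfun.span_base) auto
  finally show ?thesis .
qed

text \<open>Orthogonal central idempotents, as many as there are conjugacy classes, add up to the unit:
  they are a basis of the class functions, and multiplying an expansion of the unit by each of them
  shows that all its coefficients are 1.\<close>

lemma sum_central_idem: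
  assumes I: "finite I"
    and Q: "\<And>i. i \<in> I \<Longrightarrow> quasi_idempotent n (e i) (\<phi> i) (c i)"
    and orth: "\<And>i j a. i \<in> I \<Longrightarrow> j \<in> I \<Longrightarrow> i \<noteq> j \<Longrightarrow> a \<in> alg \<Longrightarrow> e i \<star> a \<star> e j = (\<lambda>_. 0)"
    and ct: "\<And>g. g \<in> G \<Longrightarrow> ct g \<in> I"
    and conj: "\<And>g h. g \<in> G \<Longrightarrow> h \<in> G \<Longrightarrow> ct g = ct h \<Longrightarrow> \<exists>x\<in>G. h = x \<circ> g \<circ> inv x"
  shows "(\<lambda>g. \<Sum>i\<in>I. central_idem (e i) (c i) g) = delta id"
proof -
  define E where "E i = central_idem (e i) (c i)" for i
  have E_mult: "E i \<star> E j = (if i = j then E i else (\<lambda>_. 0))" if "i \<in> I" "j \<in> I" for i j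
    using that quasi_idempotent.central_idem_idem[OF Q] orth
    by (auto simp: E_def intro: central_idem_orth)
  have E_id: "E i id \<noteq> 0" if "i \<in> I" for i
    using that quasi_idempotent.central_idem_id[OF Q] quasi_idempotent.c_nz[OF Q]
    by (simp add: E_def)
  have E_class: "class_fun (E i)" if "i \<in> I" for i
    using that quasi_idempotent.central_idem_class_fun[OF Q] by (simp add: E_def)
  have inj: "inj_on E I"
  proof (rule inj_onI, rule ccontr)
    fix i j assume ij: "i \<in> I" "j \<in> I" "E i = E j" "i \<noteq> j"
    then have "E i = (\<lambda>_. 0)" using E_mult[of i i] E_mult[of i j] by simp
    then show False using E_id[of i] ij by simp
  qed
  let ?B = "E ` I"
  have B_mult: "b \<star> b' = (if b = b' then b else (\<lambda>_. 0))" if "b \<in> ?B" "b' \<in> ?B" for b b'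
    using that E_mult inj by (auto simp: inj_on_def)
  have coeff: "(\<Sum>b\<in>?B. (\<lambda>g. u b * b g)) \<star> b' = (\<lambda>g. u b' * b' g)" if b': "b' \<in> ?B" for u b'
  proof -
    have "(\<Sum>b\<in>?B. (\<lambda>g. u b * b g)) = (\<lambda>g. \<Sum>b\<in>?B. u b * b g)"
      by (simp add: fun_eq_iff sum_fun_apply)
    then have "(\<Sum>b\<in>?B. (\<lambda>g. u b * b g)) \<star> b' = (\<lambda>g. \<Sum>b\<in>?B. u b * b g) \<star> b'"
      by simp
    also have "\<dots> = (\<lambda>g. \<Sum>b\<in>?B. u b * (b \<star> b') g)"
      by (simp only: conv_sum_left conv_scale_left)
    also have "\<dots> = (\<lambda>g. \<Sum>b\<in>?B. if b = b' then u b * b g else 0)"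
      by (intro ext sum.cong refl) (simp add: B_mult b')
    also have "\<dots> = (\<lambda>g. u b' * b' g)"
      using b' I by simp
    finally show ?thesis .
  qed
  have indep: "cfun.independent ?B"
  proof (rule cfun.independent_if_scalars_zero)
    fix u b' assume "(\<Sum>b\<in>?B. (\<lambda>g. u b * b g)) = 0" "b' \<in> ?B"
    then have "(\<lambda>g. u b' * b' g) = 0" using coeff[of b' u] by simp
    then have "u b' * b' id = 0" by (metis zero_fun_apply)
    then show "u b' = 0" using E_id \<open>b' \<in> ?B\<close> by auto
  qed (use I in simp)
  let ?T = "(\<lambda>i g. if g \<in> G \<and> ct g = i then 1 else 0 :: complex) ` I"
  have delta_class: "class_fun (delta id)"
  proof -
    have "x \<circ> g \<circ> inv x = id \<longleftrightarrow> g = id" if "x \<in> G" "g \<in> G" for x g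
      using that by (metis comp_assoc comp_id id_comp inv_cancel_G(1) inv_comp_G)
    then show ?thesis by (simp add: class_fun_def) (simp add: delta_def)
  qed
  \<comment> \<open>Otherwise the unit and the idempotents would be \<open>card I + 1\<close>
    independent functions in the span of \<open>card I\<close> indicator functions.\<close>
  have "delta id \<in> cfun.span ?B"
  proof (rule ccontr)
    assume not: "delta id \<notin> cfun.span ?B"
    have "cfun.independent (insert (delta id) ?B)"
      using not indep by (rule cfun.independent_insertI)
    moreover have "f \<in> cfun.span ?T" if "f \<in> insert (delta id) ?B" for f
    proof (rule class_fun_in_span[OF I])
      show "class_fun f" using that E_class delta_class by blast
    qed (fact ct conj)+
    ultimately have "card (insert (delta id) ?B) \<le> card ?T"
      using I by (intro cfun.independent_span_bound[THEN conjunct2] subsetI) simp_all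
    moreover have "delta id \<notin> ?B" by (rule contrapos_nn[OF not cfun.span_base])
    moreover have "card ?T \<le> card I" using I by (rule card_image_le)
    moreover have "card ?B = card I" using inj by (rule card_image)
    moreover have "finite ?B" using I by simp
    ultimately show False by simp
  qed
  then obtain u where u: "delta id = (\<Sum>b\<in>?B. (\<lambda>g. u b * b g))"
    using I by (auto simp: cfun.span_finite)
  have "u b = 1" if "b \<in> ?B" for b
  proof -
    have "b \<in> alg" using that E_class by (auto simp: class_fun_def)
    then have "(\<lambda>g. u b * b g) = b" using coeff[OF that, of u, folded u] by simp
    then have "u b * b id = b id" by (rule fun_cong)
    then show ?thesis using that E_id by auto
  qed
  then have "delta id = (\<Sum>b\<in>?B. b)"
    using u by (simp cong: sum.cong)
  also have "\<dots> = (\<Sum>i\<in>I. E i)"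
    using inj by (simp add: sum.reindex)
  finally show ?thesis by (simp add: fun_eq_iff sum_fun_apply E_def)
qed

section \<open>Subgroup sums weighted by a character with values 1 and -1\<close>

definition signed_subgroup :: "(nat \<Rightarrow> nat) set \<Rightarrow> ((nat \<Rightarrow> nat) \<Rightarrow> complex) \<Rightarrow> bool" where
  "signed_subgroup K w \<longleftrightarrow> K \<subseteq> G \<and> id \<in> K \<and>
     (\<forall>g\<in>K. \<forall>h\<in>K. g \<circ> h \<in> K \<and> w (g \<circ> h) = w g * w h) \<and>
     (\<forall>g\<in>K. inv g \<in> K \<and> (w g = 1 \<or> w g = -1))"

text \<open>Row sums are the case of the trivial character and column sums that of the sign.
  Treating both at once gives the absorption, squaring and self-adjointness rules a single
  time.\<close>

definition wsum :: "(nat \<Rightarrow> nat) set \<Rightarrow> ((nat \<Rightarrow> nat) \<Rightarrow> complex) \<Rightarrow> (nat \<Rightarrow> nat) \<Rightarrow> complex" where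
  "wsum K w = (\<lambda>g. if g \<in> K then w g else 0)"

lemma wsum_alg: "signed_subgroup K w \<Longrightarrow> wsum K w \<in> alg"
  by (auto simp: signed_subgroup_def wsum_def alg_def)

lemma signed_subgroup_inv:
  assumes "signed_subgroup K w" "g \<in> K" shows "w (inv g) = w g"
proof -
  have g: "id \<in> K" "inv g \<in> K" "g \<in> G" using assms by (auto simp: signed_subgroup_def)
  have mult: "w (x \<circ> y) = w x * w y" if "x \<in> K" "y \<in> K" for x y
    using assms(1) that by (auto simp: signed_subgroup_def)
  have sgn: "w x = 1 \<or> w x = -1" if "x \<in> K" for x
    using assms(1) that by (auto simp: signed_subgroup_def)
  have "w id = 1" using mult[of id id] sgn[of id] g by auto
  then have "w (inv g) * w g = 1" using mult[of "inv g" g] g assms(2) by simp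
  moreover have "w g = 1 \<or> w g = -1" "w (inv g) = 1 \<or> w (inv g) = -1"
    using sgn g assms(2) by blast+
  ultimately show ?thesis by auto
qed

lemma signed_subgroup_mem_iff:
  assumes "signed_subgroup K w" "g \<in> K" "h \<in> G"
  shows "inv g \<circ> h \<in> K \<longleftrightarrow> h \<in> K" "h \<circ> inv g \<in> K \<longleftrightarrow> h \<in> K"
proof -
  have K: "g \<in> G" "inv g \<in> K" "\<And>h. h \<in> K \<Longrightarrow> g \<circ> h \<in> K" "\<And>h. h \<in> K \<Longrightarrow> h \<circ> g \<in> K"
    "\<And>h. h \<in> K \<Longrightarrow> inv g \<circ> h \<in> K" "\<And>h. h \<in> K \<Longrightarrow> h \<circ> inv g \<in> K"
    using assms by (auto simp: signed_subgroup_def)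
  show "inv g \<circ> h \<in> K \<longleftrightarrow> h \<in> K"
    using K inv_cancel_G(2)[OF K(1), of h] by metis
  show "h \<circ> inv g \<in> K \<longleftrightarrow> h \<in> K"
    using K inv_comp_G(1)[OF K(1)] by (metis comp_assoc comp_id)
qed

lemma delta_wsum:
  assumes K: "signed_subgroup K w" "g \<in> K"
  shows "delta g \<star> wsum K w = (\<lambda>h. w g * wsum K w h)"
proof (rule alg_eqI)
  show "(\<lambda>h. w g * wsum K w h) \<in> alg" using wsum_alg[OF K(1)] by (simp add: alg_def)
  fix h assume h: "h \<in> G"
  have "g \<in> G" "inv g \<in> K" using K by (auto simp: signed_subgroup_def)
  moreover from this have "w (inv g \<circ> h) = w g * w h" if "h \<in> K"
    using K(1) that signed_subgroup_inv[OF K] by (simp add: signed_subgroup_def)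
  ultimately show "(delta g \<star> wsum K w) h = w g * wsum K w h"
    using h by (simp add: delta_conv wsum_def signed_subgroup_mem_iff[OF K])
qed simp

lemma wsum_delta:
  assumes K: "signed_subgroup K w" "g \<in> K"
  shows "wsum K w \<star> delta g = (\<lambda>h. w g * wsum K w h)"
proof (rule alg_eqI)
  show "(\<lambda>h. w g * wsum K w h) \<in> alg" using wsum_alg[OF K(1)] by (simp add: alg_def)
  fix h assume h: "h \<in> G"
  have "g \<in> G" "inv g \<in> K" using K by (auto simp: signed_subgroup_def)
  moreover from this have "w (h \<circ> inv g) = w g * w h" if "h \<in> K"
    using K(1) that signed_subgroup_inv[OF K] by (simp add: signed_subgroup_def)
  ultimately show "(wsum K w \<star> delta g) h = w g * wsum K w h"
    using h by (simp add: conv_delta wsum_def signed_subgroup_mem_iff[OF K])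
qed simp

lemma wsum_wsum:
  assumes K: "signed_subgroup K w"
  shows "wsum K w \<star> wsum K w = (\<lambda>g. of_nat (card K) * wsum K w g)"
proof
  fix g
  have KG: "K \<subseteq> G" and sq: "\<And>h. h \<in> K \<Longrightarrow> w h * w h = 1"
    using K by (auto simp: signed_subgroup_def)
  have "(wsum K w \<star> wsum K w) g = (\<Sum>h\<in>G. wsum K w h * (delta h \<star> wsum K w) g)"
    by (subst conv_expand_left[OF wsum_alg[OF K]]) simp
  also have "\<dots> = (\<Sum>h\<in>K. wsum K w h * (delta h \<star> wsum K w) g)"
    using KG by (intro sum.mono_neutral_right) (auto simp: wsum_def)
  also have "\<dots> = (\<Sum>h\<in>K. wsum K w g)"
  proof (intro sum.cong refl)
    fix h assume h: "h \<in> K"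
    have "wsum K w h * (delta h \<star> wsum K w) g = (w h * w h) * wsum K w g"
      using h by (simp add: delta_wsum[OF K h]) (simp add: wsum_def)
    then show "wsum K w h * (delta h \<star> wsum K w) g = wsum K w g"
      using sq[OF h] by simp
  qed
  finally show "(wsum K w \<star> wsum K w) g = of_nat (card K) * wsum K w g" by simp
qed

lemma adj_wsum:
  assumes K: "signed_subgroup K w"
  shows "adj (wsum K w) = wsum K w"
proof (rule alg_eqI)
  fix g assume g: "g \<in> G"
  have "inv g \<in> K \<longleftrightarrow> g \<in> K" using K g unfolding signed_subgroup_def by (metis inv_inv_G)
  moreover have "cnj (w g) = w g" if "g \<in> K"
    using K that by (auto simp: signed_subgroup_def)
  ultimately show "adj (wsum K w) g = wsum K w g"
    using g signed_subgroup_inv[OF K, of g] by (auto simp: adj_def wsum_def)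
qed (simp_all add: wsum_alg[OF K])

lemma adj_delta: "g \<in> G \<Longrightarrow> adj (delta g) = delta (inv g)"
proof (rule alg_eqI)
  fix h assume "g \<in> G" "h \<in> G"
  then have "inv h = g \<longleftrightarrow> h = inv g" by auto
  then show "adj (delta g) h = delta (inv g) h"
    using \<open>h \<in> G\<close> by (simp add: adj_def delta_def)
qed simp_all

lemma adj_adj: "a \<in> alg \<Longrightarrow> adj (adj a) = a"
  by (rule alg_eqI[OF adj_alg]) (simp_all add: adj_def)

end

section \<open>Young symmetrizers\<close>

text \<open>Extension by zero lets diagrams with different numbers of rows be compared row by
  row.\<close>

definition part :: "nat list \<Rightarrow> nat \<Rightarrow> nat" where
  "part \<mu> i = (if i < length \<mu> then \<mu> ! i else 0)"

lemma cells_part: "cells \<mu> = {(i, j). j < part \<mu> i}"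
  by (auto simp: cells_def part_def split: if_splits)

lemma finite_cells: "finite (cells \<mu>)"
proof -
  have "cells \<mu> = (SIGMA i:{..<length \<mu>}. {..<\<mu> ! i})" by (auto simp: cells_def)
  then show ?thesis by simp
qed

lemma card_cells: "card (cells \<mu>) = sum_list \<mu>"
proof -
  have "cells \<mu> = (SIGMA i:{..<length \<mu>}. {..<\<mu> ! i})" by (auto simp: cells_def)
  then show ?thesis by (simp add: sum_list_sum_nth atLeast0LessThan)
qed

lemma card_cells_rows: "card {(i, j) \<in> cells \<mu>. i < k} = (\<Sum>i<k. part \<mu> i)"
proof -
  have "{(i, j) \<in> cells \<mu>. i < k} = (SIGMA i:{..<k}. {..<part \<mu> i})" by (auto simp: cells_part)
  then show ?thesis by simp
qed

lemma part_antimono: "sorted_wrt (\<ge>) \<mu> \<Longrightarrow> i \<le> i' \<Longrightarrow> part \<mu> i' \<le> part \<mu> i"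
  by (cases "i = i'") (auto simp: part_def sorted_wrt_iff_nth_less)

text \<open>Row lengths are differences of these cumulative counts, the quantities that dominance
  compares. Positivity of the parts then recovers the length of the list from its extension by
  zero.\<close>

lemma partitions_eqI:
  assumes "\<mu> \<in> partitions n" "\<nu> \<in> partitions n"
    and "\<And>k. card {(i, j) \<in> cells \<mu>. i < k} = card {(i, j) \<in> cells \<nu>. i < k}"
  shows "\<mu> = \<nu>"
proof -
  have "(\<Sum>i<Suc k. part \<mu> i) = (\<Sum>i<Suc k. part \<nu> i)" "(\<Sum>i<k. part \<mu> i) = (\<Sum>i<k. part \<nu> i)" for k
    using assms(3) unfolding card_cells_rows by blast+
  then have eq: "part \<mu> k = part \<nu> k" for k by (metis add_left_cancel sum.lessThan_Suc)
  have pos: "0 < part \<xi> k \<longleftrightarrow> k < length \<xi>" if "\<xi> \<in> partitions n" for \<xi> k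
    using that by (auto simp: part_def partitions_def)
  have "k < length \<mu> \<longleftrightarrow> k < length \<nu>" for k
    using pos[OF assms(1), of k] pos[OF assms(2), of k] eq[of k] by simp
  then have len: "length \<mu> = length \<nu>" by (metis linorder_neqE_nat nat_less_le)
  show ?thesis
  proof (rule nth_equalityI[OF len])
    fix i assume "i < length \<mu>"
    then show "\<mu> ! i = \<nu> ! i" using eq[of i] len by (simp add: part_def)
  qed
qed

context perm_algebra
begin

text \<open>A tableau of shape \<open>\<mu>\<close> is encoded by the functions sending an entry to its row and to its
  column.\<close>

definition coords :: "nat list \<Rightarrow> (nat \<Rightarrow> nat) \<Rightarrow> (nat \<Rightarrow> nat) \<Rightarrow> bool" where
  "coords \<mu> r c \<longleftrightarrow> bij_betw (\<lambda>x. (r x, c x)) {1..n} (cells \<mu>)"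

lemma G_mem: "g \<in> G \<Longrightarrow> g x \<in> {1..n} \<longleftrightarrow> x \<in> {1..n}"
  unfolding G_def by (simp add: permutes_in_image del: atLeastAtMost_iff)

lemma G_bij: "g \<in> G \<Longrightarrow> bij_betw g {1..n} {1..n}"
  by (simp add: G_def permutes_imp_bij)

lemma coords_perm:
  assumes "coords \<mu> r c" "g \<in> G" shows "coords \<mu> (r \<circ> g) (c \<circ> g)"
  using bij_betw_trans[OF G_bij[OF assms(2)] assms(1)[unfolded coords_def]]
  by (simp add: coords_def comp_def)

section \<open>Dominance between fillings\<close>

lemma coords_card_rows:
  assumes "coords \<mu> r c"
  shows "card {x \<in> {1..n}. r x < k} = card {(i, j) \<in> cells \<mu>. i < k}"
proof (rule bij_betw_same_card[of "\<lambda>x. (r x, c x)"])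
  show "bij_betw (\<lambda>x. (r x, c x)) {x \<in> {1..n}. r x < k} {(i, j) \<in> cells \<mu>. i < k}"
    unfolding bij_betw_def
  proof
    have inj: "inj_on (\<lambda>x. (r x, c x)) {1..n}" and img: "cells \<mu> = (\<lambda>x. (r x, c x)) ` {1..n}"
      using assms by (simp_all add: coords_def bij_betw_def)
    show "inj_on (\<lambda>x. (r x, c x)) {x \<in> {1..n}. r x < k}"
      by (rule inj_on_subset[OF inj]) blast
    show "(\<lambda>x. (r x, c x)) ` {x \<in> {1..n}. r x < k} = {(i, j) \<in> cells \<mu>. i < k}"
      unfolding img by blast
  qed
qed

text \<open>Rows weakly shrink downwards, so the diagram is closed under moving up in a column, and
  a column fills an initial segment of the rows, counted from 0.\<close>

lemma coords_column:
  assumes "sorted_wrt (\<ge>) \<mu>" "coords \<mu> r c"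
  shows "inj_on r {x \<in> {1..n}. c x = j}"
    and "r ` {x \<in> {1..n}. c x = j} = {..<card {x \<in> {1..n}. c x = j}}"
proof -
  let ?X = "{x \<in> {1..n}. c x = j}"
  show inj: "inj_on r ?X"
    using assms(2) unfolding coords_def bij_betw_def inj_on_def by blast
  have cells_eq: "cells \<mu> = (\<lambda>x. (r x, c x)) ` {1..n}"
    using assms(2) by (simp add: coords_def bij_betw_def)
  have img: "r ` ?X = {i. (i, j) \<in> cells \<mu>}"
    unfolding cells_eq by blast
  have down: "i' \<in> r ` ?X" if "i \<in> r ` ?X" "i' \<le> i" for i i'
  proof -
    have "j < part \<mu> i" using that(1) unfolding img cells_part by simp
    then have "j < part \<mu> i'" using part_antimono[OF assms(1) that(2)] by simp
    then show ?thesis unfolding img cells_part by simp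
  qed
  have fin: "finite (r ` ?X)" by simp
  have "\<exists>m. r ` ?X = {..<m}"
  proof (cases "r ` ?X = {}")
    case False
    then have "r ` ?X = {..<Suc (Max (r ` ?X))}"
      using down[OF Max_in[OF fin False]] Max_ge[OF fin] by (auto simp: less_Suc_eq_le)
    then show ?thesis by blast
  qed auto
  then obtain m where m: "r ` ?X = {..<m}" by blast
  then have "card ?X = m" using card_image[OF inj] by (simp only: card_lessThan)
  then show "r ` ?X = {..<card ?X}" using m by (simp only:)
qed

lemma card_by_columns:
  "card {x \<in> {1..n}. P x} = (\<Sum>j\<in>c ` {1..n}. card {x \<in> {1..n}. c x = j \<and> P x})"
proof -
  have "card {x \<in> {1..n}. P x} = (\<Sum>x\<in>{x \<in> {1..n}. P x}. 1)" by simp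
  also have "\<dots> = (\<Sum>j\<in>c ` {1..n}. \<Sum>x\<in>{x \<in> {x \<in> {1..n}. P x}. c x = j}. 1)"
    by (rule sum.group[symmetric]) auto
  finally show ?thesis by (simp add: conj_commute conj_left_commute)
qed

text \<open>A column of height \<open>h\<close> has \<open>min h k\<close> entries in the first
  \<open>k\<close> rows of \<open>r\<close>, since it is packed from the top. No assignment of
  distinct rows to its entries can place more of them there.\<close>

lemma column_card_le:
  assumes "sorted_wrt (\<ge>) \<mu>" "coords \<mu> r c" and inj: "inj_on (\<lambda>x. (s x, c x)) {1..n}"
  shows "card {x \<in> {1..n}. c x = j \<and> s x < k} \<le> card {x \<in> {1..n}. c x = j \<and> r x < (k::nat)}"
proof -
  let ?X = "{x \<in> {1..n}. c x = j}"
  let ?Y = "{x \<in> {1..n}. c x = j \<and> r x < k}"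
  have "inj_on r ?Y"
    by (rule inj_on_subset[OF coords_column(1)[OF assms(1,2), of j]]) auto
  moreover have "r ` ?Y = r ` ?X \<inter> {..<k}" by blast
  then have "r ` ?Y = {..<min (card ?X) k}"
    unfolding coords_column(2)[OF assms(1,2)] by auto
  ultimately have "card ?Y = min (card ?X) k"
    using card_image[of r ?Y] by simp
  moreover have "card {x \<in> {1..n}. c x = j \<and> s x < k} \<le> card ?X"
    by (rule card_mono) auto
  moreover have "card {x \<in> {1..n}. c x = j \<and> s x < k} \<le> card {..<k}"
  proof (rule card_inj_on_le[of s])
    show "inj_on s {x \<in> {1..n}. c x = j \<and> s x < k}"
      using inj unfolding inj_on_def by blast
  qed auto
  ultimately show ?thesis by simp
qed

text \<open>Dominance: if no two entries share a row of \<open>s\<close> and a column of \<open>c\<close>, then the first \<open>k\<close> rows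
  of \<open>s\<close> have at most \<open>k\<close> entries in each column of \<open>c\<close>.\<close>

lemma coords_dominance:
  assumes "sorted_wrt (\<ge>) \<mu>" "coords \<mu> r c" and "inj_on (\<lambda>x. (s x, c x)) {1..n}"
  shows "card {x \<in> {1..n}. s x < k} \<le> card {x \<in> {1..n}. r x < (k::nat)}"
proof -
  have "card {x \<in> {1..n}. s x < k} = (\<Sum>j\<in>c ` {1..n}. card {x \<in> {1..n}. c x = j \<and> s x < k})"
    by (rule card_by_columns)
  also have "\<dots> \<le> (\<Sum>j\<in>c ` {1..n}. card {x \<in> {1..n}. c x = j \<and> r x < k})"
    by (intro sum_mono column_card_le[OF assms])
  also have "\<dots> = card {x \<in> {1..n}. r x < k}"
    by (rule card_by_columns[symmetric])
  finally show ?thesis .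
qed

text \<open>Equal totals force equality in each columnwise inequality. With \<open>k\<close> the
  height of the column of \<open>x\<close>, all of its entries lie in the first \<open>k\<close>
  rows of \<open>r\<close>, hence also of \<open>s\<close>, and these rows all meet the column
  inside the diagram.\<close>

lemma coords_dominance_eq:
  assumes "sorted_wrt (\<ge>) \<mu>" "coords \<mu> r c" and inj: "inj_on (\<lambda>x. (s x, c x)) {1..n}"
    and eq: "\<And>k. card {x \<in> {1..n}. s x < k} = card {x \<in> {1..n}. r x < k}"
    and x: "x \<in> {1..n}"
  shows "(s x, c x) \<in> cells \<mu>"
proof -
  let ?X = "{y \<in> {1..n}. c y = c x}"
  let ?k = "card ?X"
  have "(\<Sum>j\<in>c ` {1..n}. card {x \<in> {1..n}. c x = j \<and> s x < ?k})
      = (\<Sum>j\<in>c ` {1..n}. card {x \<in> {1..n}. c x = j \<and> r x < ?k})"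
    using eq[of ?k] card_by_columns[of "\<lambda>x. s x < ?k" c] card_by_columns[of "\<lambda>x. r x < ?k" c]
    by simp
  then have "card {y \<in> {1..n}. c y = c x \<and> s y < ?k} = card {y \<in> {1..n}. c y = c x \<and> r y < ?k}"
    by (rule sum_mono_inv[OF _ column_card_le[OF assms(1-3)]]) (use x in auto)
  also have "{y \<in> {1..n}. c y = c x \<and> r y < ?k} = ?X"
    using coords_column(2)[OF assms(1,2), of "c x"] by (auto simp: set_eq_iff image_iff)
  finally have "{y \<in> {1..n}. c y = c x \<and> s y < ?k} = ?X"
    by (intro card_subset_eq) auto
  then have "s x \<in> {..<?k}" using x by auto
  then obtain y where "y \<in> ?X" "s x = r y"
    using coords_column(2)[OF assms(1,2), of "c x"] by (metis (no_types, lifting) imageE)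
  moreover have "(r y, c y) \<in> cells \<mu>"
    using assms(2) \<open>y \<in> ?X\<close> unfolding coords_def bij_betw_def by blast
  ultimately show ?thesis by simp
qed

section \<open>Row sums, column sums and Young symmetrizers\<close>

definition stab :: "(nat \<Rightarrow> 'b) \<Rightarrow> (nat \<Rightarrow> nat) set" where
  "stab f = {g \<in> G. \<forall>x. f (g x) = f x}"

definition row_sum :: "(nat \<Rightarrow> nat) \<Rightarrow> (nat \<Rightarrow> nat) \<Rightarrow> complex" where
  "row_sum r = wsum (stab r) (\<lambda>_. 1)"

definition col_sum :: "(nat \<Rightarrow> nat) \<Rightarrow> (nat \<Rightarrow> nat) \<Rightarrow> complex" where
  "col_sum c = wsum (stab c) (\<lambda>g. of_int (sign g))"

text \<open>The row sum stands on the right because functions of tabloids correspond to functions on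
  the group that are invariant under right translation by the row stabilizer.\<close>

definition young :: "(nat \<Rightarrow> nat) \<Rightarrow> (nat \<Rightarrow> nat) \<Rightarrow> (nat \<Rightarrow> nat) \<Rightarrow> complex" where
  "young r c = col_sum c \<star> row_sum r"

lemma G_permutation: "g \<in> G \<Longrightarrow> permutation g"
  unfolding G_def using permutes_imp_permutation[of "{1..n}"] by auto

lemma stab_inv: "g \<in> stab f \<Longrightarrow> inv g \<in> stab f"
  unfolding stab_def by (auto, metis inv_app_G(2))

lemma signed_subgroup_row: "signed_subgroup (stab r) (\<lambda>_. 1)"
  using stab_inv by (auto simp: signed_subgroup_def) (auto simp: stab_def)

lemma signed_subgroup_col: "signed_subgroup (stab c) (\<lambda>g. of_int (sign g))"
proof -
  have "sign (g \<circ> h) = sign g * sign h" if "g \<in> stab c" "h \<in> stab c" for g h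
    using that by (intro sign_compose G_permutation) (auto simp: stab_def)
  moreover have "of_int (sign g) = (1::complex) \<or> of_int (sign g) = (-1::complex)" for g
    by (auto simp: sign_def)
  moreover have "stab c \<subseteq> G" "id \<in> stab c" "\<And>g h. g \<in> stab c \<Longrightarrow> h \<in> stab c \<Longrightarrow> g \<circ> h \<in> stab c"
    by (auto simp: stab_def)
  ultimately show ?thesis
    using stab_inv unfolding signed_subgroup_def by (auto simp del: comp_apply)
qed

lemma row_sum_alg [simp]: "row_sum r \<in> alg"
  unfolding row_sum_def by (rule wsum_alg[OF signed_subgroup_row])

lemma col_sum_alg [simp]: "col_sum c \<in> alg"
  unfolding col_sum_def by (rule wsum_alg[OF signed_subgroup_col])

lemma delta_row_sum: "g \<in> stab r \<Longrightarrow> delta g \<star> row_sum r = row_sum r"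
  unfolding row_sum_def by (subst delta_wsum[OF signed_subgroup_row]) auto

lemma col_sum_delta: "g \<in> stab c \<Longrightarrow> col_sum c \<star> delta g = (\<lambda>h. of_int (sign g) * col_sum c h)"
  unfolding col_sum_def by (rule wsum_delta[OF signed_subgroup_col])

lemma transpose_G: "x \<in> {1..n} \<Longrightarrow> y \<in> {1..n} \<Longrightarrow> Transposition.transpose x y \<in> G"
  by (simp add: G_def permutes_swap_id)

lemma transpose_stab:
  "x \<in> {1..n} \<Longrightarrow> y \<in> {1..n} \<Longrightarrow> f x = f y \<Longrightarrow> Transposition.transpose x y \<in> stab f"
  by (auto simp: stab_def transpose_G Transposition.transpose_def)

text \<open>A transposition inside both a row and a column changes the sign of the product.\<close>

lemma col_sum_delta_row_sum_eq_0:
  assumes g: "g \<in> G" and not_inj: "\<not> inj_on (\<lambda>x. (r x, c (g x))) {1..n}"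
  shows "col_sum c \<star> delta g \<star> row_sum r = (\<lambda>_. 0)"
proof -
  obtain x y where xy: "x \<in> {1..n}" "y \<in> {1..n}" "x \<noteq> y" "r x = r y" "c (g x) = c (g y)"
    using not_inj by (auto simp: inj_on_def)
  let ?t = "Transposition.transpose x y" and ?t' = "Transposition.transpose (g x) (g y)"
  have t: "?t \<in> stab r" and t': "?t' \<in> stab c"
    using xy G_mem[OF g] by (blast intro: transpose_stab)+
  have ne: "g x \<noteq> g y" using xy(3) g by (metis inv_app_G(1))
  have "g a = g b \<longleftrightarrow> a = b" for a b using inv_app_G(1)[OF g] by metis
  then have comm: "g \<circ> ?t = ?t' \<circ> g"
    by (auto simp: Transposition.transpose_def fun_eq_iff)
  have "col_sum c \<star> delta g \<star> row_sum r = col_sum c \<star> delta g \<star> (delta ?t \<star> row_sum r)"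
    by (simp add: delta_row_sum[OF t])
  also have "\<dots> = col_sum c \<star> (delta g \<star> delta ?t) \<star> row_sum r"
    by (simp only: conv_assoc)
  also have "delta g \<star> delta ?t = delta ?t' \<star> delta g"
    using t t' g by (simp add: delta_delta comm stab_def)
  also have "col_sum c \<star> (delta ?t' \<star> delta g) \<star> row_sum r = (col_sum c \<star> delta ?t') \<star> delta g \<star> row_sum r"
    by (simp only: conv_assoc)
  also have "\<dots> = (\<lambda>h. - 1 * (col_sum c \<star> delta g \<star> row_sum r) h)"
    using ne by (simp only: col_sum_delta[OF t'] conv_scale_left) (simp add: sign_swap_id)
  finally have "(col_sum c \<star> delta g \<star> row_sum r) h = - 1 * (col_sum c \<star> delta g \<star> row_sum r) h" for h
    by (rule fun_cong)
  then show ?thesis by (simp add: fun_eq_iff)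
qed

text \<open>The involution \<open>adj\<close> fixes row and column sums, reverses products and
  inverts \<open>g\<close>, which reduces this to the opposite order of the factors.\<close>

lemma row_sum_delta_col_sum_eq_0:
  assumes g: "g \<in> G" and not_inj: "\<not> inj_on (\<lambda>x. (r x, c (inv g x))) {1..n}"
  shows "row_sum r \<star> delta g \<star> col_sum c = (\<lambda>_. 0)"
proof -
  have "row_sum r \<star> delta g \<star> col_sum c = adj (adj (row_sum r \<star> delta g \<star> col_sum c))"
    by (simp add: adj_adj)
  also have "adj (row_sum r \<star> delta g \<star> col_sum c) = col_sum c \<star> delta (inv g) \<star> row_sum r"
    using g by (simp add: adj_conv adj_delta row_sum_def col_sum_def
        adj_wsum[OF signed_subgroup_row] adj_wsum[OF signed_subgroup_col] conv_assoc)
  also have "\<dots> = (\<lambda>_. 0)"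
    using g not_inj by (intro col_sum_delta_row_sum_eq_0) auto
  also have "adj (\<lambda>_. 0) = (\<lambda>_. 0)" by (simp add: adj_def fun_eq_iff)
  finally show ?thesis .
qed

text \<open>Under the injectivity hypothesis \<open>g\<close> factors as \<open>q \<circ> u\<close>
  with \<open>q\<close> in the column stabilizer and \<open>u\<close> in the row stabilizer; each
  factor is absorbed by its sum, at the cost of the sign of \<open>q\<close>. The cells needed to
  define \<open>u\<close> exist by the equality case of dominance, as \<open>r\<close> and
  \<open>r \<circ> g\<close> have equally many entries in the first \<open>k\<close> rows.\<close>

lemma col_sum_delta_row_sum:
  assumes \<mu>: "sorted_wrt (\<ge>) \<mu>" and rc: "coords \<mu> r c" and g: "g \<in> G"
    and inj: "inj_on (\<lambda>x. (r x, c (g x))) {1..n}"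
  shows "\<exists>s. col_sum c \<star> delta g \<star> row_sum r = (\<lambda>h. s * young r c h)"
proof -
  have cg: "coords \<mu> (r \<circ> g) (c \<circ> g)" by (rule coords_perm[OF rc g])
  have inj': "inj_on (\<lambda>x. (r x, (c \<circ> g) x)) {1..n}" using inj by simp
  have "card {x \<in> {1..n}. r x < k} = card {x \<in> {1..n}. (r \<circ> g) x < k}" for k
    by (simp only: coords_card_rows[OF rc] coords_card_rows[OF cg])
  then have mem: "(r x, c (g x)) \<in> cells \<mu>" if "x \<in> {1..n}" for x
    using coords_dominance_eq[OF \<mu> cg inj' _ that] by simp
  define t where "t = inv_into {1..n} (\<lambda>x. (r x, c x))"
  have t: "t p \<in> {1..n}" "r (t p) = fst p" "c (t p) = snd p" if "p \<in> cells \<mu>" for p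
  proof -
    have "p \<in> (\<lambda>x. (r x, c x)) ` {1..n}" using that rc by (simp add: coords_def bij_betw_def)
    then have "t p \<in> {1..n}" "(r (t p), c (t p)) = p"
      unfolding t_def by (rule inv_into_into, rule f_inv_into_f)
    then show "t p \<in> {1..n}" "r (t p) = fst p" "c (t p) = snd p" by (auto simp: prod_eq_iff)
  qed
  \<comment> \<open>Inside its row, \<open>x\<close> is moved to the column in which
    \<open>g x\<close> lies; then \<open>g \<circ> inv u\<close> preserves columns.\<close>
  define u where "u x = (if x \<in> {1..n} then t (r x, c (g x)) else x)" for x
  have u: "u x \<in> {1..n}" "r (u x) = r x" "c (u x) = c (g x)" if "x \<in> {1..n}" for x
    using t[OF mem[OF that]] that by (auto simp: u_def)
  have u_out: "u x = x" if "x \<notin> {1..n}" for x using that by (auto simp: u_def)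
  have "inj_on u {1..n}"
    using inj u by (auto simp: inj_on_def simp del: atLeastAtMost_iff) metis
  moreover from this have "u ` {1..n} = {1..n}"
    using u(1) by (intro endo_inj_surj) auto
  ultimately have "bij_betw u {1..n} {1..n}"
    by (simp add: bij_betw_def)
  then have uG: "u \<in> G"
    unfolding G_def using u_out by (auto intro!: bij_imp_permutes simp del: atLeastAtMost_iff)
  have "r (u x) = r x" for x using u(2) u_out by metis
  then have u_stab: "u \<in> stab r" using uG by (simp add: stab_def)
  define q where "q = g \<circ> inv u"
  have qG: "q \<in> G" using g uG by (simp add: q_def)
  have "c (q y) = c y" for y
  proof (cases "y \<in> {1..n}")
    case True
    then have "inv u y \<in> {1..n}" using uG G_mem inv_G by blast
    then show ?thesis using u(3)[of "inv u y"] uG by (simp add: q_def)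
  next
    case False
    then show ?thesis using qG by (metis G_def mem_Collect_eq permutes_def)
  qed
  then have q_stab: "q \<in> stab c" using qG by (simp add: stab_def)
  have "g = q \<circ> u" using uG by (simp add: q_def comp_assoc)
  then have "delta g = delta q \<star> delta u" using qG uG by (simp add: delta_delta)
  then have "col_sum c \<star> delta g \<star> row_sum r = (col_sum c \<star> delta q) \<star> (delta u \<star> row_sum r)"
    by (simp add: conv_assoc)
  also have "\<dots> = (\<lambda>h. of_int (sign q) * young r c h)"
    by (simp add: delta_row_sum[OF u_stab] col_sum_delta[OF q_stab] young_def conv_scale_left)
  finally show ?thesis by blast
qed

lemma col_sum_conv_row_sum:
  assumes \<mu>: "sorted_wrt (\<ge>) \<mu>" and rc: "coords \<mu> r c" and a: "a \<in> alg"
  shows "\<exists>s. col_sum c \<star> a \<star> row_sum r = (\<lambda>h. s * young r c h)"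
proof -
  have "\<exists>s. col_sum c \<star> delta g \<star> row_sum r = (\<lambda>h. s * young r c h)" if "g \<in> G" for g
  proof (cases "inj_on (\<lambda>x. (r x, c (g x))) {1..n}")
    case True
    then show ?thesis by (rule col_sum_delta_row_sum[OF \<mu> rc that])
  next
    case False
    then show ?thesis
      using col_sum_delta_row_sum_eq_0[OF that, of r c] by (intro exI[of _ 0]) simp
  qed
  then obtain s where s: "\<And>g. g \<in> G \<Longrightarrow> col_sum c \<star> delta g \<star> row_sum r = (\<lambda>h. s g * young r c h)"
    by metis
  have "col_sum c \<star> a \<star> row_sum r = (\<lambda>h. \<Sum>g\<in>G. a g * (col_sum c \<star> delta g \<star> row_sum r) h)"
    by (subst conv_expand_right[OF a]) (simp add: conv_sum_left conv_scale_left)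
  also have "\<dots> = (\<lambda>h. (\<Sum>g\<in>G. a g * s g) * young r c h)"
    by (simp add: s sum_distrib_right mult.assoc)
  finally show ?thesis by blast
qed

text \<open>An entry is determined by its row and column, so the two stabilizers share just the
  identity, and a single term of the convolution survives.\<close>

lemma young_id:
  assumes rc: "coords \<mu> r c" shows "young r c id = 1"
proof -
  have triv: "h = id" if "h \<in> stab c" "h \<in> stab r" for h
  proof
    fix x
    have hG: "h \<in> G" and "(r (h x), c (h x)) = (r x, c x)" using that by (auto simp: stab_def)
    then have "h x = x" if "x \<in> {1..n}"
      using rc that G_mem[OF hG, of x] unfolding coords_def bij_betw_def inj_on_def by blast
    moreover have "h x = x" if "x \<notin> {1..n}"
      using hG that by (simp add: G_def permutes_def)
    ultimately show "h x = id x" by auto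
  qed
  have "young r c id = (\<Sum>h\<in>G. col_sum c h * row_sum r (inv h))"
    by (simp add: young_def conv_def)
  also have "\<dots> = (\<Sum>h\<in>G. if h = id then 1 else 0)"
  proof (rule sum.cong[OF refl])
    fix h assume h: "h \<in> G"
    have "h = id" if "h \<in> stab c" "inv h \<in> stab r"
      using triv[OF that(1)] stab_inv[OF that(2)] h by simp
    moreover have "id \<in> stab r" "id \<in> stab c" by (simp_all add: stab_def)
    ultimately show "col_sum c h * row_sum r (inv h) = (if h = id then 1 else 0)"
      by (auto simp: col_sum_def row_sum_def wsum_def sign_id)
  qed
  finally show ?thesis by simp
qed

text \<open>With \<open>\<kappa>\<close> and \<open>\<rho>\<close> self-adjoint and idempotent up to positive scalars, \<open>\<kappa>\<rho>\<kappa>\<rho> = 0\<close> would give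
  \<open>(\<kappa>\<rho>\<kappa>)(\<kappa>\<rho>\<kappa>)\<^sup>* = 0\<close>, hence \<open>(\<kappa>\<rho>)(\<kappa>\<rho>)\<^sup>* = 0\<close> and \<open>\<kappa>\<rho> = 0\<close>.\<close>

lemma young_square_nz:
  assumes rc: "coords \<mu> r c" shows "young r c \<star> young r c \<noteq> (\<lambda>_. 0)"
proof
  let ?k = "col_sum c" and ?p = "row_sum r"
  assume "young r c \<star> young r c = (\<lambda>_. 0)"
  then have 0: "?k \<star> ?p \<star> ?k \<star> ?p = (\<lambda>_. 0)" by (simp add: young_def conv_assoc)
  have adj: "adj ?k = ?k" "adj ?p = ?p"
    by (simp_all add: col_sum_def row_sum_def adj_wsum[OF signed_subgroup_row] adj_wsum[OF signed_subgroup_col])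
  have sq: "?k \<star> ?k = (\<lambda>g. of_nat (card (stab c)) * ?k g)" "?p \<star> ?p = (\<lambda>g. of_nat (card (stab r)) * ?p g)"
    by (simp_all add: col_sum_def row_sum_def wsum_wsum[OF signed_subgroup_row] wsum_wsum[OF signed_subgroup_col])
  have "?k \<star> ?p \<star> ?k \<star> adj (?k \<star> ?p \<star> ?k) = ?k \<star> ?p \<star> (?k \<star> ?k) \<star> ?p \<star> ?k"
    by (simp add: adj_conv adj conv_assoc)
  also have "\<dots> = (\<lambda>_. 0)"
    using 0 by (simp add: sq conv_scale_left conv_scale_right)
  finally have kpk: "?k \<star> ?p \<star> ?k = (\<lambda>_. 0)"
    by (rule conv_adj_eq_0D[OF conv_alg])
  have "?k \<star> ?p \<star> adj (?k \<star> ?p) = ?k \<star> (?p \<star> ?p) \<star> ?k"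
    by (simp add: adj_conv adj conv_assoc)
  also have "\<dots> = (\<lambda>_. 0)"
    using kpk by (simp add: sq conv_scale_left conv_scale_right)
  finally have "young r c = (\<lambda>_. 0)"
    unfolding young_def by (rule conv_adj_eq_0D[OF conv_alg])
  then show False using young_id[OF rc] by simp
qed

text \<open>In \<open>e \<star> a \<star> e\<close> the outermost factors are a column sum on the
  left and a row sum on the right, so the product is a multiple of \<open>e\<close>. Both scalars
  are read off at the identity, where \<open>e\<close> has coefficient 1.\<close>

lemma quasi_idempotent_young:
  assumes \<mu>: "sorted_wrt (\<ge>) \<mu>" and rc: "coords \<mu> r c"
  shows "quasi_idempotent n (young r c) (\<lambda>a. (young r c \<star> a \<star> young r c) id)
    ((young r c \<star> young r c) id)"
proof -
  let ?e = "young r c"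
  have sandwich: "?e \<star> a \<star> ?e = (\<lambda>g. (?e \<star> a \<star> ?e) id * ?e g)" if "a \<in> alg" for a
  proof -
    obtain s where "col_sum c \<star> (row_sum r \<star> a \<star> col_sum c) \<star> row_sum r = (\<lambda>h. s * ?e h)"
      using col_sum_conv_row_sum[OF \<mu> rc conv_alg] by blast
    then have "?e \<star> a \<star> ?e = (\<lambda>h. s * ?e h)" by (simp add: young_def conv_assoc)
    then show ?thesis by (simp add: young_id[OF rc])
  qed
  have sq: "?e \<star> ?e = (\<lambda>g. (?e \<star> ?e) id * ?e g)"
    using sandwich[OF delta_alg[OF id_G]] by (simp add: young_def)
  show ?thesis
  proof
    show "?e \<in> alg" by (simp add: young_def)
    show "?e id = 1" by (rule young_id[OF rc])
    show "(?e \<star> ?e) id \<noteq> 0" using young_square_nz[OF rc] sq by auto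
  qed (fact sandwich sq)+
qed

text \<open>Distinct shapes have different numbers of cells in their first \<open>k\<close> rows for
  some \<open>k\<close>. Depending on which is larger, dominance excludes the injectivity required
  by the inner pair, row sum of \<open>\<mu>\<close> and column sum of \<open>\<nu>\<close>, or by
  the outer pair, column sum of \<open>\<mu>\<close> and row sum of \<open>\<nu>\<close>.\<close>

lemma young_orth:
  assumes \<mu>: "\<mu> \<in> partitions n" and \<nu>: "\<nu> \<in> partitions n" and ne: "\<mu> \<noteq> \<nu>"
    and rc: "coords \<mu> r c" and rc': "coords \<nu> r' c'" and a: "a \<in> alg"
  shows "young r c \<star> a \<star> young r' c' = (\<lambda>_. 0)"
proof -
  let ?D = "\<lambda>\<mu> k. card {(i, j) \<in> cells \<mu>. i < k}"
  have sorted: "sorted_wrt (\<ge>) \<mu>" "sorted_wrt (\<ge>) \<nu>" using \<mu> \<nu> by (auto simp: partitions_def)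
  obtain k where "?D \<mu> k \<noteq> ?D \<nu> k" using partitions_eqI[OF \<mu> \<nu>] ne by blast
  then consider "?D \<mu> k > ?D \<nu> k" | "?D \<nu> k > ?D \<mu> k" by linarith
  then show ?thesis
  proof cases
    case 1
    have "row_sum r \<star> delta g \<star> col_sum c' = (\<lambda>_. 0)" if g: "g \<in> G" for g
    proof (rule row_sum_delta_col_sum_eq_0[OF g], rule notI)
      assume "inj_on (\<lambda>x. (r x, c' (inv g x))) {1..n}"
      then have "card {x \<in> {1..n}. r x < k} \<le> card {x \<in> {1..n}. (r' \<circ> inv g) x < k}"
        by (intro coords_dominance[OF sorted(2) coords_perm[OF rc' inv_G[OF g]]]) (simp add: comp_def)
      then show False
        using 1 coords_card_rows[OF rc] coords_card_rows[OF coords_perm[OF rc' inv_G[OF g]]] by simp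
    qed
    then have "row_sum r \<star> a \<star> col_sum c' = (\<lambda>_. 0)"
      by (subst conv_expand_right[OF a]) (simp add: conv_sum_left conv_scale_left)
    then have "col_sum c \<star> (row_sum r \<star> a \<star> col_sum c') \<star> row_sum r' = (\<lambda>_. 0)" by simp
    then show ?thesis by (simp add: young_def conv_assoc)
  next
    case 2
    have "col_sum c \<star> delta g \<star> row_sum r' = (\<lambda>_. 0)" if g: "g \<in> G" for g
    proof (rule col_sum_delta_row_sum_eq_0[OF g], rule notI)
      assume "inj_on (\<lambda>x. (r' x, c (g x))) {1..n}"
      then have "card {x \<in> {1..n}. r' x < k} \<le> card {x \<in> {1..n}. (r \<circ> g) x < k}"
        by (intro coords_dominance[OF sorted(1) coords_perm[OF rc g]]) (simp add: comp_def)
      then show False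
        using 2 coords_card_rows[OF rc'] coords_card_rows[OF coords_perm[OF rc g]] by simp
    qed
    then have "col_sum c \<star> (row_sum r \<star> a \<star> col_sum c') \<star> row_sum r' = (\<lambda>_. 0)"
      by (subst conv_expand_right[OF conv_alg]) (simp add: conv_sum_left conv_scale_left)
    then show ?thesis by (simp add: young_def conv_assoc)
  qed
qed

end

section \<open>Cycle types and Specht modules\<close>

text \<open>Makes the inductive decomposition explicit as disjoint lists covering \<open>I\<close>,
  ready to be used as the rows of a tableau. Fixed points in \<open>I\<close> appear as lists of
  length 1.\<close>

lemma cycle_decomp_lists:
  assumes "cycle_decomp I p"
  shows "\<exists>css. distinct (concat css) \<and> set (concat css) = I \<and> (\<forall>x. x \<notin> I \<longrightarrow> p x = x) \<and>
    (\<forall>cs\<in>set css. cs \<noteq> [] \<and> (\<forall>j<length cs. p (cs ! j) = cs ! (Suc j mod length cs)))"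
  using assms
proof induction
  case empty
  show ?case by (intro exI[of _ "[]"]) simp
next
  case (comp I p cs)
  then obtain css where css: "distinct (concat css)" "set (concat css) = I"
    "\<And>x. x \<notin> I \<Longrightarrow> p x = x" "\<And>cs. cs \<in> set css \<Longrightarrow> cs \<noteq> []"
    "\<And>cs j. cs \<in> set css \<Longrightarrow> j < length cs \<Longrightarrow> p (cs ! j) = cs ! (Suc j mod length cs)"
    by blast
  show ?case
  \<comment> \<open>The empty list counts as a cycle; it is dropped because it would become a row of
    length 0.\<close>
  proof (cases "cs = []")
    case True
    then show ?thesis using css by (intro exI[of _ css]) simp
  next
    case False
    have rot: "cycle_of_list cs (cs ! j) = cs ! (Suc j mod length cs)" if "j < length cs" for j
    proof -
      have "map (cycle_of_list cs) cs = rotate 1 cs"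
        using cyclic_rotation[OF comp.hyps(2), of 1] by simp
      then have "map (cycle_of_list cs) cs ! j = rotate 1 cs ! j" by simp
      then show ?thesis using that by (simp add: nth_rotate1)
    qed
    have step: "(cycle_of_list cs \<circ> p) (ds ! j) = ds ! (Suc j mod length ds)"
      if ds: "ds \<in> set (cs # css)" and j: "j < length ds" for ds j
    proof (cases "ds = cs")
      case True
      have "cs ! j \<notin> I" using True j comp.hyps(3) nth_mem by blast
      then show ?thesis using True j css(3) rot by simp
    next
      case False
      then have ds: "ds \<in> set css" using ds by simp
      have "ds ! (Suc j mod length ds) \<in> set ds" using j by (intro nth_mem mod_less_divisor) auto
      then have "ds ! (Suc j mod length ds) \<notin> set cs"
        using ds css(2) comp.hyps(3) by auto
      then show ?thesis using css(5)[OF ds j] by (simp add: id_outside_supp)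
    qed
    have out: "(cycle_of_list cs \<circ> p) x = x" if "x \<notin> set cs \<union> I" for x
      using that css(3) by (simp add: id_outside_supp)
    have "distinct (concat (cs # css))" "set (concat (cs # css)) = set cs \<union> I"
      "\<forall>ds\<in>set (cs # css). ds \<noteq> []"
      using css(1,2,4) comp.hyps(2,3) False by auto
    then show ?thesis
      using step out by blast
  qed
qed

context perm_algebra
begin

text \<open>The rows are the cycles of \<open>g\<close>, sorted by decreasing length. This is what
  bounds the number of conjugacy classes by the number of partitions.\<close>

lemma cycle_tableau:
  assumes g: "g \<in> G"
  shows "\<exists>\<mu> T. \<mu> \<in> partitions n \<and> T \<in> tableaux \<mu> \<and>
    (\<forall>(i, j)\<in>cells \<mu>. g (T (i, j)) = T (i, Suc j mod \<mu> ! i))"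
proof -
  have "cycle_decomp {1..n} g"
    using g by (intro cycle_decomposition) (auto simp: G_def)
  from cycle_decomp_lists[OF this] obtain css' where
    *: "distinct (concat css') \<and> set (concat css') = {1..n} \<and> (\<forall>x. x \<notin> {1..n} \<longrightarrow> g x = x) \<and>
    (\<forall>cs\<in>set css'. cs \<noteq> [] \<and> (\<forall>j<length cs. g (cs ! j) = cs ! (Suc j mod length cs)))" ..
  then have css': "distinct (concat css')" "set (concat css') = {1..n}"
    "cs \<in> set css' \<Longrightarrow> cs \<noteq> []"
    "cs \<in> set css' \<Longrightarrow> j < length cs \<Longrightarrow> g (cs ! j) = cs ! (Suc j mod length cs)" for cs j
    by simp_all
  define css where "css = rev (sort_key length css')"
  have set_css: "set css = set css'" by (simp add: css_def)
  have "mset css = mset css'" by (simp add: css_def)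
  then have "mset (concat css) = mset (concat css')" by (simp add: mset_concat flip: sum_mset_sum_list)
  then have css: "distinct (concat css)" "set (concat css) = {1..n}"
    using css'(1,2) mset_eq_imp_distinct_iff mset_eq_setD by metis+
  define \<mu> where "\<mu> = map length css"
  define T where "T = (\<lambda>(i, j). css ! i ! j)"
  have len: "sum_list \<mu> = n"
    using distinct_card[OF css(1)] css(2) by (simp add: \<mu>_def length_concat)
  have "sorted (rev \<mu>)"
    by (simp add: \<mu>_def css_def rev_map)
  then have "sorted_wrt (\<ge>) \<mu>"
    using sorted_wrt_rev[of "(\<le>)" \<mu>] by simp
  then have mu: "\<mu> \<in> partitions n"
    using len css'(3) set_css by (auto simp: partitions_def \<mu>_def)
  have img: "T ` cells \<mu> = {1..n}"
  proof -
    have "T ` cells \<mu> = set (concat css)"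
    proof (intro equalityI subsetI)
      fix x assume "x \<in> T ` cells \<mu>"
      then obtain i j where "i < length css" "j < length (css ! i)" "x = css ! i ! j"
        by (auto simp: T_def cells_def \<mu>_def)
      then show "x \<in> set (concat css)" using nth_mem by fastforce
    next
      fix x assume "x \<in> set (concat css)"
      then obtain i j where "i < length css" "j < length (css ! i)" "x = css ! i ! j"
        by (auto simp: in_set_conv_nth)
      then have "(i, j) \<in> cells \<mu>" "x = T (i, j)" by (auto simp: T_def cells_def \<mu>_def)
      then show "x \<in> T ` cells \<mu>" by blast
    qed
    then show ?thesis using css by simp
  qed
  have "inj_on T (cells \<mu>)"
    using img len by (intro eq_card_imp_inj_on) (simp_all add: card_cells finite_cells)
  then have "T \<in> tableaux \<mu>"
    using img len by (simp add: tableaux_def bij_betw_def)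
  moreover have "g (T (i, j)) = T (i, Suc j mod \<mu> ! i)" if "(i, j) \<in> cells \<mu>" for i j
  proof -
    have ij: "i < length css" "j < length (css ! i)" using that by (auto simp: cells_def \<mu>_def)
    then have "css ! i \<in> set css'" using set_css nth_mem by blast
    then show ?thesis using css'(4) ij by (simp add: \<mu>_def T_def)
  qed
  ultimately show ?thesis using mu by blast
qed

lemma tableaux_transfer:
  assumes mu: "\<mu> \<in> partitions n" and T: "T \<in> tableaux \<mu>" and T': "T' \<in> tableaux \<mu>"
  obtains h where "h \<in> G" "\<And>p. p \<in> cells \<mu> \<Longrightarrow> T' p = h (T p)"
proof -
  have n: "sum_list \<mu> = n" using mu by (simp add: partitions_def)
  have bij: "bij_betw T (cells \<mu>) {1..n}" "bij_betw T' (cells \<mu>) {1..n}"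
    using T T' n by (simp_all add: tableaux_def)
  define h where "h x = (if x \<in> {1..n} then T' (inv_into (cells \<mu>) T x) else x)" for x
  have "bij_betw (T' \<circ> inv_into (cells \<mu>) T) {1..n} {1..n}"
    using bij by (intro bij_betw_trans[OF bij_betw_inv_into])
  then have "bij_betw h {1..n} {1..n}"
    by (rule bij_betw_cong[THEN iffD1, rotated]) (simp add: h_def)
  then have "h \<in> G"
    unfolding G_def by (auto intro!: bij_imp_permutes simp: h_def simp del: atLeastAtMost_iff)
  moreover have "T' p = h (T p)" if "p \<in> cells \<mu>" for p
    using bij(1) that by (auto simp: h_def bij_betw_def inv_into_f_f)
  ultimately show thesis using that by blast
qed

definition cycle_type :: "(nat \<Rightarrow> nat) \<Rightarrow> nat list" where
  "cycle_type g = (SOME \<mu>. \<mu> \<in> partitions n \<and> (\<exists>T\<in>tableaux \<mu>.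
     \<forall>(i, j)\<in>cells \<mu>. g (T (i, j)) = T (i, Suc j mod \<mu> ! i)))"

lemma cycle_type_props:
  assumes "g \<in> G"
  shows "cycle_type g \<in> partitions n"
    and "\<exists>T\<in>tableaux (cycle_type g).
       \<forall>(i, j)\<in>cells (cycle_type g). g (T (i, j)) = T (i, Suc j mod cycle_type g ! i)"
proof -
  have "\<exists>\<mu>. \<mu> \<in> partitions n \<and> (\<exists>T\<in>tableaux \<mu>.
     \<forall>(i, j)\<in>cells \<mu>. g (T (i, j)) = T (i, Suc j mod \<mu> ! i))"
    using cycle_tableau[OF assms] by blast
  from someI_ex[OF this] show "cycle_type g \<in> partitions n"
    and "\<exists>T\<in>tableaux (cycle_type g).
       \<forall>(i, j)\<in>cells (cycle_type g). g (T (i, j)) = T (i, Suc j mod cycle_type g ! i)"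
    unfolding cycle_type_def by blast+
qed

text \<open>The relabelling that carries the cycle tableau of \<open>g\<close> to that of
  \<open>h\<close> conjugates \<open>g\<close> into \<open>h\<close>, because both shift the rows of
  their tableau cyclically.\<close>

lemma cycle_type_conj:
  assumes g: "g \<in> G" and h: "h \<in> G" and eq: "cycle_type g = cycle_type h"
  shows "\<exists>x\<in>G. h = x \<circ> g \<circ> inv x"
proof -
  define \<mu> where "\<mu> = cycle_type g"
  have mu: "\<mu> \<in> partitions n" using cycle_type_props(1)[OF g] by (simp add: \<mu>_def)
  obtain T where T: "T \<in> tableaux \<mu>"
    "\<And>i j. (i, j) \<in> cells \<mu> \<Longrightarrow> g (T (i, j)) = T (i, Suc j mod \<mu> ! i)"
    using cycle_type_props(2)[OF g] by (auto simp: \<mu>_def)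
  obtain T' where T': "T' \<in> tableaux \<mu>"
    "\<And>i j. (i, j) \<in> cells \<mu> \<Longrightarrow> h (T' (i, j)) = T' (i, Suc j mod \<mu> ! i)"
    using cycle_type_props(2)[OF h] by (auto simp: \<mu>_def eq)
  obtain x where x: "x \<in> G" "\<And>p. p \<in> cells \<mu> \<Longrightarrow> T' p = x (T p)"
    using tableaux_transfer[OF mu T(1) T'(1)] by blast
  have "h (x y) = x (g y)" for y
  proof (cases "y \<in> {1..n}")
    case True
    then have "y \<in> T ` cells \<mu>"
      using T(1) mu by (simp add: tableaux_def bij_betw_def partitions_def)
    then obtain i j where ij: "(i, j) \<in> cells \<mu>" "y = T (i, j)" by auto
    have ij': "(i, Suc j mod \<mu> ! i) \<in> cells \<mu>" using ij(1) by (auto simp: cells_def)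
    show ?thesis using ij ij' T(2) T'(2) x(2) by metis
  next
    case False
    then show ?thesis using g h x(1) by (simp add: G_def permutes_def)
  qed
  then have "h \<circ> x = x \<circ> g" by auto
  then have "h = x \<circ> g \<circ> inv x" using x(1) by (metis comp_assoc comp_id inv_comp_G(2))
  then show ?thesis using x(1) by blast
qed

section \<open>The Specht module as a left ideal\<close>

definition row_of :: "nat list \<Rightarrow> (nat \<times> nat \<Rightarrow> nat) \<Rightarrow> nat \<Rightarrow> nat" where
  "row_of \<mu> T x = fst (inv_into (cells \<mu>) T x)"

definition col_of :: "nat list \<Rightarrow> (nat \<times> nat \<Rightarrow> nat) \<Rightarrow> nat \<Rightarrow> nat" where
  "col_of \<mu> T x = snd (inv_into (cells \<mu>) T x)"

context
  fixes \<mu> T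
  assumes mu: "\<mu> \<in> partitions n" and T: "T \<in> tableaux \<mu>"
begin

private abbreviation "r \<equiv> row_of \<mu> T"
private abbreviation "c \<equiv> col_of \<mu> T"

lemma tableau_bij: "bij_betw T (cells \<mu>) {1..n}"
  using mu T by (simp add: tableaux_def partitions_def)

lemma coords_tableau: "coords \<mu> r c"
  using bij_betw_inv_into[OF tableau_bij] by (simp add: coords_def row_of_def col_of_def)

lemma row_col_T: "(i, j) \<in> cells \<mu> \<Longrightarrow> r (T (i, j)) = i" "(i, j) \<in> cells \<mu> \<Longrightarrow> c (T (i, j)) = j"
  using tableau_bij by (auto simp: row_of_def col_of_def bij_betw_def inv_into_f_f)

lemma T_row_col: "x \<in> {1..n} \<Longrightarrow> (r x, c x) \<in> cells \<mu> \<and> T (r x, c x) = x"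
  using tableau_bij inv_into_into[of x T "cells \<mu>"] f_inv_into_f[of x T "cells \<mu>"]
  by (simp add: row_of_def col_of_def bij_betw_def)

lemma T_mem: "p \<in> cells \<mu> \<Longrightarrow> T p \<in> {1..n}"
  using tableau_bij by (auto simp: bij_betw_def)

lemma tabloid_comp: "tabloid \<mu> (g \<circ> T) = map (\<lambda>i. g ` {x \<in> {1..n}. r x = i}) [0..<length \<mu>]"
proof -
  have "(\<lambda>j. (g \<circ> T) (i, j)) ` {..<\<mu> ! i} = g ` {x \<in> {1..n}. r x = i}" if "i < length \<mu>" for i
  proof -
    have "(\<lambda>j. T (i, j)) ` {..<\<mu> ! i} = {x \<in> {1..n}. r x = i}"
    proof (intro equalityI subsetI)
      fix x assume "x \<in> (\<lambda>j. T (i, j)) ` {..<\<mu> ! i}"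
      then obtain j where "j < \<mu> ! i" "x = T (i, j)" by blast
      then have "(i, j) \<in> cells \<mu>" "x = T (i, j)" using that by (auto simp: cells_def)
      then show "x \<in> {x \<in> {1..n}. r x = i}" using T_mem row_col_T by blast
    next
      fix x assume "x \<in> {x \<in> {1..n}. r x = i}"
      then have "(i, c x) \<in> cells \<mu>" "x = T (i, c x)" using T_row_col[of x] by auto
      then show "x \<in> (\<lambda>j. T (i, j)) ` {..<\<mu> ! i}" by (auto simp: cells_def)
    qed
    then show ?thesis by (metis (no_types, lifting) comp_apply image_cong image_image)
  qed
  then show ?thesis by (simp add: tabloid_def)
qed

text \<open>Tabloids thus correspond to the left cosets of the row stabilizer, which is what makes
  the pullback to the group possible.\<close>

lemma tabloid_eq_iff:
  assumes g: "g \<in> G" and h: "h \<in> G"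
  shows "tabloid \<mu> (g \<circ> T) = tabloid \<mu> (h \<circ> T) \<longleftrightarrow> inv h \<circ> g \<in> stab r"
proof
  assume eq: "tabloid \<mu> (g \<circ> T) = tabloid \<mu> (h \<circ> T)"
  have "r (inv h (g x)) = r x" for x
  proof (cases "x \<in> {1..n}")
    case True
    then have "r x < length \<mu>" using T_row_col[of x] by (auto simp: cells_def)
    then have "g ` {y \<in> {1..n}. r y = r x} = h ` {y \<in> {1..n}. r y = r x}"
      using eq unfolding tabloid_comp by simp
    then have "g x \<in> h ` {y \<in> {1..n}. r y = r x}" using True by blast
    then show ?thesis using h by auto
  next
    case False
    then have "inv h (g x) = x" using inv_G[OF h] g by (simp add: G_def permutes_def)
    then show ?thesis by simp
  qed
  then show "inv h \<circ> g \<in> stab r" using g h by (simp add: stab_def)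
next
  assume p: "inv h \<circ> g \<in> stab r"
  let ?p = "inv h \<circ> g"
  have "?p ` {x \<in> {1..n}. r x = i} = {x \<in> {1..n}. r x = i}" for i
  proof (rule endo_inj_surj)
    have "?p \<in> G" "\<And>x. r (?p x) = r x" using p by (auto simp: stab_def)
    then show "?p ` {x \<in> {1..n}. r x = i} \<subseteq> {x \<in> {1..n}. r x = i}"
      using G_mem by blast
    show "inj_on ?p {x \<in> {1..n}. r x = i}"
      using g h by (intro inj_onI) (metis comp_apply inv_app_G)
  qed simp
  then have "h ` (?p ` {x \<in> {1..n}. r x = i}) = h ` {x \<in> {1..n}. r x = i}" for i by simp
  moreover have "h ` (?p ` A) = g ` A" for A using h by (simp add: image_image)
  ultimately show "tabloid \<mu> (g \<circ> T) = tabloid \<mu> (h \<circ> T)"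
    unfolding tabloid_comp by simp
qed

lemma column_stabilizer_comp:
  assumes h: "h \<in> G"
  shows "bij_betw (\<lambda>q. h \<circ> q \<circ> inv h) (stab c) (column_stabilizer \<mu> (h \<circ> T))"
proof (rule bij_betw_byWitness[where f' = "\<lambda>p. inv h \<circ> p \<circ> h"])
  have n: "sum_list \<mu> = n" using mu by (simp add: partitions_def)
  show "\<forall>q\<in>stab c. inv h \<circ> (h \<circ> q \<circ> inv h) \<circ> h = q"
    using h by (simp add: comp_assoc)
  show "\<forall>p\<in>column_stabilizer \<mu> (h \<circ> T). h \<circ> (inv h \<circ> p \<circ> h) \<circ> inv h = p"
    using h by (simp add: comp_assoc)
  show "(\<lambda>q. h \<circ> q \<circ> inv h) ` stab c \<subseteq> column_stabilizer \<mu> (h \<circ> T)"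
  proof (rule image_subsetI)
    fix q assume q: "q \<in> stab c"
    then have qG: "q \<in> G" and qc: "\<And>x. c (q x) = c x" by (auto simp: stab_def)
    have "h \<circ> q \<circ> inv h \<in> G" using h qG by simp
    moreover have "\<exists>i'. (i', j) \<in> cells \<mu> \<and> (h \<circ> q \<circ> inv h) ((h \<circ> T) (i, j)) = (h \<circ> T) (i', j)"
      if ij: "(i, j) \<in> cells \<mu>" for i j
    proof -
      have "q (T (i, j)) \<in> {1..n}" using T_mem[OF ij] G_mem[OF qG] by blast
      moreover have "c (q (T (i, j))) = j" using qc row_col_T[OF ij] by simp
      ultimately have "(r (q (T (i, j))), j) \<in> cells \<mu>" "T (r (q (T (i, j))), j) = q (T (i, j))"
        using T_row_col by metis+
      then show ?thesis using h by auto
    qed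
    ultimately show "h \<circ> q \<circ> inv h \<in> column_stabilizer \<mu> (h \<circ> T)"
      unfolding column_stabilizer_def n by (auto simp: G_def)
  qed
  show "(\<lambda>p. inv h \<circ> p \<circ> h) ` column_stabilizer \<mu> (h \<circ> T) \<subseteq> stab c"
  proof (rule image_subsetI)
    fix p assume "p \<in> column_stabilizer \<mu> (h \<circ> T)"
    then have pG: "p \<in> G" and pc: "\<And>i j. (i, j) \<in> cells \<mu> \<Longrightarrow>
        \<exists>i'. (i', j) \<in> cells \<mu> \<and> p (h (T (i, j))) = h (T (i', j))"
      unfolding column_stabilizer_def n by (auto simp: G_def)
    have "c (inv h (p (h x))) = c x" for x
    proof (cases "x \<in> {1..n}")
      case True
      then obtain i' where i': "(i', c x) \<in> cells \<mu>" "p (h (T (r x, c x))) = h (T (i', c x))"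
        using T_row_col[OF True] pc by blast
      then have "inv h (p (h x)) = T (i', c x)" using T_row_col[OF True] h by simp
      then show ?thesis using row_col_T[OF i'(1)] by simp
    next
      case False
      then have "inv h (p (h x)) = x" using inv_G[OF h] h pG by (simp add: G_def permutes_def)
      then show ?thesis by simp
    qed
    then show "inv h \<circ> p \<circ> h \<in> stab c" using h pG by (simp add: stab_def)
  qed
qed

lemma polytabloid_comp:
  assumes h: "h \<in> G"
  shows "polytabloid \<mu> (h \<circ> T) t
    = (\<Sum>q\<in>stab c. of_int (sign q) * (if t = tabloid \<mu> (h \<circ> q \<circ> T) then 1 else 0))"
proof -
  have "polytabloid \<mu> (h \<circ> T) t = (\<Sum>q\<in>stab c. of_int (sign (h \<circ> q \<circ> inv h)) *
      (if t = tabloid \<mu> (h \<circ> q \<circ> inv h \<circ> (h \<circ> T)) then 1 else 0))"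
    unfolding polytabloid_def
    by (rule sum.reindex_bij_betw[OF column_stabilizer_comp[OF h], symmetric])
  also have "\<dots> = (\<Sum>q\<in>stab c. of_int (sign q) * (if t = tabloid \<mu> (h \<circ> q \<circ> T) then 1 else 0))"
  proof (rule sum.cong[OF refl])
    fix q assume "q \<in> stab c"
    then have qG: "q \<in> G" by (simp add: stab_def)
    have perm: "permutation h" "permutation q" "permutation (inv h)"
      using h qG by (simp_all add: G_permutation)
    have "sign (h \<circ> q \<circ> inv h) = sign h * sign q * sign h"
      using perm by (simp add: sign_compose permutation_compose sign_inverse)
    also have "\<dots> = sign q" by (simp add: sign_def)
    finally have "sign (h \<circ> q \<circ> inv h) = sign q" .
    moreover have "h \<circ> q \<circ> inv h \<circ> (h \<circ> T) = h \<circ> q \<circ> T"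
      using h by (simp add: comp_assoc)
    ultimately show "of_int (sign (h \<circ> q \<circ> inv h)) *
        (if t = tabloid \<mu> (h \<circ> q \<circ> inv h \<circ> (h \<circ> T)) then 1 else 0)
      = (of_int (sign q) * (if t = tabloid \<mu> (h \<circ> q \<circ> T) then 1 else 0) :: complex)" by simp
  qed
  finally show ?thesis .
qed

text \<open>A tableau is arbitrary outside its diagram, so another tableau equals some
  \<open>h \<circ> T\<close> just on the cells.\<close>

lemma polytabloid_cong:
  assumes "\<And>p. p \<in> cells \<mu> \<Longrightarrow> T1 p = T2 p"
  shows "polytabloid \<mu> T1 = polytabloid \<mu> T2"
proof -
  have "column_stabilizer \<mu> T1 = column_stabilizer \<mu> T2"
    using assms unfolding column_stabilizer_def by (force split: prod.splits)
  moreover have "tabloid \<mu> (p \<circ> T1) = tabloid \<mu> (p \<circ> T2)" for p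
    using assms by (auto simp: tabloid_def cells_def intro!: image_cong)
  ultimately show ?thesis by (simp add: polytabloid_def)
qed

lemma polytabloids_eq: "polytabloid \<mu> ` tableaux \<mu> = (\<lambda>h. polytabloid \<mu> (h \<circ> T)) ` G"
proof (intro equalityI subsetI)
  fix F assume "F \<in> polytabloid \<mu> ` tableaux \<mu>"
  then obtain T' where T': "T' \<in> tableaux \<mu>" "F = polytabloid \<mu> T'" by blast
  obtain h where "h \<in> G" "\<And>p. p \<in> cells \<mu> \<Longrightarrow> T' p = h (T p)"
    using tableaux_transfer[OF mu T T'(1)] by blast
  then show "F \<in> (\<lambda>h. polytabloid \<mu> (h \<circ> T)) ` G"
    using T'(2) polytabloid_cong[of T' "h \<circ> T"] by auto
next
  fix F assume "F \<in> (\<lambda>h. polytabloid \<mu> (h \<circ> T)) ` G"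
  then obtain h where h: "h \<in> G" "F = polytabloid \<mu> (h \<circ> T)" by blast
  have "h \<circ> T \<in> tableaux \<mu>"
    using bij_betw_trans[OF tableau_bij G_bij[OF h(1)]] mu by (simp add: tableaux_def partitions_def)
  then show "F \<in> polytabloid \<mu> ` tableaux \<mu>" using h(2) by blast
qed

definition pull :: "(nat set list \<Rightarrow> complex) \<Rightarrow> (nat \<Rightarrow> nat) \<Rightarrow> complex" where
  "pull F = (\<lambda>g. if g \<in> G then F (tabloid \<mu> (g \<circ> T)) else 0)"

text \<open>For \<open>h = id\<close> this recovers the Young symmetrizer itself: its coefficient at
  \<open>g\<close> is the sum of the signs of the column permutations \<open>q\<close> for which
  \<open>inv q \<circ> g\<close> preserves rows, that is, for which \<open>g\<close> and
  \<open>q\<close> give the same tabloid.\<close>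

lemma pull_polytabloid:
  assumes h: "h \<in> G"
  shows "pull (polytabloid \<mu> (h \<circ> T)) = delta h \<star> young r c"
proof (rule alg_eqI)
  fix g assume g: "g \<in> G"
  have "(delta h \<star> young r c) g = (\<Sum>k\<in>G. col_sum c k * row_sum r (inv k \<circ> (inv h \<circ> g)))"
    using g h by (simp add: delta_conv young_def) (simp add: conv_def)
  also have "\<dots> = (\<Sum>k\<in>stab c. col_sum c k * row_sum r (inv k \<circ> (inv h \<circ> g)))"
    by (intro sum.mono_neutral_right) (auto simp: stab_def col_sum_def wsum_def)
  also have "\<dots> = (\<Sum>q\<in>stab c. of_int (sign q) * (if tabloid \<mu> (g \<circ> T) = tabloid \<mu> (h \<circ> q \<circ> T) then 1 else 0))"
  proof (rule sum.cong[OF refl])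
    fix q assume q: "q \<in> stab c"
    then have qG: "q \<in> G" by (simp add: stab_def)
    show "col_sum c q * row_sum r (inv q \<circ> (inv h \<circ> g))
      = of_int (sign q) * (if tabloid \<mu> (g \<circ> T) = tabloid \<mu> (h \<circ> q \<circ> T) then 1 else 0)"
      using q h qG g tabloid_eq_iff[OF g comp_G[OF h qG]]
      by (simp add: col_sum_def row_sum_def wsum_def inv_o_G comp_assoc)
  qed
  finally show "pull (polytabloid \<mu> (h \<circ> T)) g = (delta h \<star> young r c) g"
    using g by (simp add: pull_def polytabloid_comp[OF h])
qed (simp_all add: pull_def alg_def conv_def)

text \<open>Functions on tabloids pull back injectively to functions on the group, and this carries the
  Specht module to the left ideal generated by the Young symmetrizer.\<close>

lemma specht_dim_eq: "specht_dim \<mu> = cfun.dim (left_ideal (young r c))"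
proof -
  let ?P = "(\<lambda>h. polytabloid \<mu> (h \<circ> T)) ` G"
  let ?X = "(\<lambda>g. tabloid \<mu> (g \<circ> T)) ` G"
  have V: "specht_module \<mu> = cfun.span ?P"
    by (simp add: specht_module_def polytabloids_eq)
  have lin: "Vector_Spaces.linear (\<lambda>c f t. c * f t) (\<lambda>c f t. c * f t) pull"
    by unfold_locales (auto simp: pull_def fun_eq_iff algebra_simps)
  interpret pull: Vector_Spaces.linear "\<lambda>(c::complex) (f::nat set list \<Rightarrow> complex) t. c * f t"
    "\<lambda>(c::complex) (f::(nat \<Rightarrow> nat) \<Rightarrow> complex) t. c * f t" pull
    by (rule lin)
  have supp: "F t = 0" if "F \<in> specht_module \<mu>" "t \<notin> ?X" for F t
  proof -
    have "?P \<subseteq> {F. \<forall>t. t \<notin> ?X \<longrightarrow> F t = 0}"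
    proof clarify
      fix h t assume h: "h \<in> G" and t: "t \<notin> ?X"
      have "t \<noteq> tabloid \<mu> (h \<circ> q \<circ> T)" if "q \<in> stab c" for q
        using t h that by (auto simp: stab_def)
      then show "polytabloid \<mu> (h \<circ> T) t = 0"
        by (simp add: polytabloid_comp[OF h])
    qed
    moreover have "cfun.subspace {F. \<forall>t. t \<notin> ?X \<longrightarrow> F t = 0}"
      by (auto simp: cfun.subspace_def)
    ultimately have "specht_module \<mu> \<subseteq> {F. \<forall>t. t \<notin> ?X \<longrightarrow> F t = 0}"
      unfolding V by (rule cfun.span_minimal)
    then show ?thesis using that by blast
  qed
  have "cfun.dim (pull ` specht_module \<mu>) = cfun.dim (specht_module \<mu>)"
  proof (rule dim_injective_image[where X = ?X])
    show "finite ?X" by simp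
    show "F t = 0" if "F \<in> specht_module \<mu>" "t \<notin> ?X" for F t
      using that by (rule supp)
    show "Vector_Spaces.linear (\<lambda>c f t. c * f t) (\<lambda>c f t. c * f t) pull" by (rule lin)
    show "cfun.subspace (specht_module \<mu>)" by (simp add: V)
    fix F assume F: "F \<in> specht_module \<mu>" "pull F = 0"
    have "F t = 0" for t
    proof (cases "t \<in> ?X")
      case True
      then obtain g where "g \<in> G" "t = tabloid \<mu> (g \<circ> T)" by blast
      then show ?thesis using fun_cong[OF F(2), of g] by (simp add: pull_def)
    qed (use supp F in blast)
    then show "F = 0" by (simp add: fun_eq_iff)
  qed
  moreover have "pull ` specht_module \<mu> = left_ideal (young r c)"
  proof -
    let ?Q = "(\<lambda>h. delta h \<star> young r c) ` G"
    have "pull ` ?P = ?Q"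
      unfolding image_image by (rule image_cong[OF refl pull_polytabloid])
    then have "pull ` specht_module \<mu> = cfun.span ?Q"
      by (simp only: V pull.span_image[symmetric])
    also have "\<dots> = left_ideal (young r c)"
    proof (rule antisym)
      show "cfun.span ?Q \<subseteq> left_ideal (young r c)"
        by (intro cfun.span_minimal subspace_left_ideal) (auto simp: left_ideal_def)
      show "left_ideal (young r c) \<subseteq> cfun.span ?Q"
      proof
        fix x assume "x \<in> left_ideal (young r c)"
        then obtain a where "a \<in> alg" "x = a \<star> young r c" by (auto simp: left_ideal_def)
        then have "x = (\<Sum>h\<in>G. (\<lambda>g. a h * (delta h \<star> young r c) g))"
          using conv_expand_left[of a "young r c"] by (simp add: fun_eq_iff sum_fun_apply)
        also have "\<dots> \<in> cfun.span ?Q"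
          by (intro cfun.span_sum cfun.span_scale cfun.span_base) auto
        finally show "x \<in> cfun.span ?Q" .
      qed
    qed
    finally show ?thesis .
  qed
  ultimately show ?thesis by (simp add: specht_dim_def)
qed

end

end

section \<open>Tensor powers\<close>

context perm_algebra
begin

text \<open>Extensional functions, so that words with the same letters are equal. Since elements of
  \<open>G\<close> fix all points outside \<open>{1..n}\<close>, composition with them preserves
  words.\<close>

definition words :: "(nat \<Rightarrow> 'd) set" where
  "words = {1..n} \<rightarrow>\<^sub>E UNIV"

definition mats :: "((nat \<Rightarrow> 'd) \<times> (nat \<Rightarrow> 'd) \<Rightarrow> complex) set" where
  "mats = {X. \<forall>p. p \<notin> words \<times> words \<longrightarrow> X p = 0}"

definition mmul :: "((nat \<Rightarrow> 'd) \<times> (nat \<Rightarrow> 'd) \<Rightarrow> complex) \<Rightarrow> ((nat \<Rightarrow> 'd) \<times> (nat \<Rightarrow> 'd) \<Rightarrow> complex)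
    \<Rightarrow> (nat \<Rightarrow> 'd) \<times> (nat \<Rightarrow> 'd) \<Rightarrow> complex" (infixl "\<bullet>\<bullet>" 70) where
  "X \<bullet>\<bullet> Y = (\<lambda>(a, b). if a \<in> words \<and> b \<in> words then \<Sum>x\<in>words. X (a, x) * Y (x, b) else 0)"

definition mone :: "(nat \<Rightarrow> 'd) \<times> (nat \<Rightarrow> 'd) \<Rightarrow> complex" where
  "mone = (\<lambda>(a, b). if a \<in> words \<and> a = b then 1 else 0)"

text \<open>The matrix of the \<open>n\<close>-th tensor power of \<open>A\<close>, with words of length \<open>n\<close> as indices.\<close>

definition tens :: "complex^'d^'d \<Rightarrow> (nat \<Rightarrow> 'd) \<times> (nat \<Rightarrow> 'd) \<Rightarrow> complex" where
  "tens A = (\<lambda>(a, b). if a \<in> words \<and> b \<in> words then \<Prod>k\<in>{1..n}. A $ a k $ b k else 0)"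

text \<open>Composition on the right is a right action on words; letting it act on the row index
  \<open>a\<close> makes \<open>rep\<close> multiplicative without inverting
  \<open>g\<close>.\<close>

definition rep :: "((nat \<Rightarrow> nat) \<Rightarrow> complex) \<Rightarrow> (nat \<Rightarrow> 'd) \<times> (nat \<Rightarrow> 'd) \<Rightarrow> complex" where
  "rep s = (\<lambda>(a, b). if a \<in> words \<and> b \<in> words then \<Sum>g\<in>G. s g * (if a \<circ> g = b then 1 else 0) else 0)"

definition perm_inv :: "((nat \<Rightarrow> 'd) \<times> (nat \<Rightarrow> 'd) \<Rightarrow> complex) \<Rightarrow> bool" where
  "perm_inv Y \<longleftrightarrow> (\<forall>g\<in>G. \<forall>a\<in>words. \<forall>b\<in>words. Y (a \<circ> g, b \<circ> g) = Y (a, b))"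

lemma finite_words [simp]: "finite (words :: (nat \<Rightarrow> 'd::finite) set)"
  unfolding words_def by (intro finite_PiE) auto

lemma words_comp: "a \<in> words \<Longrightarrow> g \<in> G \<Longrightarrow> a \<circ> g \<in> words"
  unfolding words_def G_def by (auto simp: PiE_iff extensional_def permutes_def)

lemma words_comp_eq_iff: "g \<in> G \<Longrightarrow> a \<circ> g = b \<longleftrightarrow> a = b \<circ> inv g"
  by (metis comp_assoc comp_id inv_comp_G)

lemma mats_eqI:
  assumes "X \<in> mats" "Y \<in> mats" "\<And>a b. a \<in> words \<Longrightarrow> b \<in> words \<Longrightarrow> X (a, b) = Y (a, b)"
  shows "X = Y"
proof
  fix p show "X p = Y p"
  proof (cases "p \<in> words \<times> words")
    case True
    then show ?thesis using assms(3) by (cases p) simp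
  next
    case False
    then show ?thesis using assms(1,2) by (cases p) (simp add: mats_def)
  qed
qed

lemma mmul_mats [simp]: "X \<bullet>\<bullet> Y \<in> mats" and tens_mats [simp]: "tens A \<in> mats"
  and rep_mats [simp]: "rep s \<in> mats" and mone_mats [simp]: "mone \<in> mats"
  by (auto simp: mmul_def tens_def rep_def mats_def mone_def)

lemma mmul_apply: "a \<in> words \<Longrightarrow> b \<in> words \<Longrightarrow> (X \<bullet>\<bullet> Y) (a, b) = (\<Sum>x\<in>words. X (a, x) * Y (x, b))"
  by (simp add: mmul_def)

lemma mmul_assoc:
  fixes X :: "(nat \<Rightarrow> 'd::finite) \<times> (nat \<Rightarrow> 'd) \<Rightarrow> complex"
  shows "(X \<bullet>\<bullet> Y) \<bullet>\<bullet> Z = X \<bullet>\<bullet> (Y \<bullet>\<bullet> Z)"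
proof (rule mats_eqI)
  fix a b :: "nat \<Rightarrow> 'd" assume ab: "a \<in> words" "b \<in> words"
  have "((X \<bullet>\<bullet> Y) \<bullet>\<bullet> Z) (a, b) = (\<Sum>x\<in>words. \<Sum>y\<in>words. X (a, y) * Y (y, x) * Z (x, b))"
    using ab by (simp add: mmul_apply sum_distrib_right)
  also have "\<dots> = (\<Sum>y\<in>words. \<Sum>x\<in>words. X (a, y) * Y (y, x) * Z (x, b))"
    by (rule sum.swap)
  also have "\<dots> = (X \<bullet>\<bullet> (Y \<bullet>\<bullet> Z)) (a, b)"
    using ab by (simp add: mmul_apply sum_distrib_left mult.assoc)
  finally show "((X \<bullet>\<bullet> Y) \<bullet>\<bullet> Z) (a, b) = (X \<bullet>\<bullet> (Y \<bullet>\<bullet> Z)) (a, b)" .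
qed simp_all

lemma mone_mmul [simp]:
  fixes X :: "(nat \<Rightarrow> 'd::finite) \<times> (nat \<Rightarrow> 'd) \<Rightarrow> complex"
  assumes "X \<in> mats" shows "mone \<bullet>\<bullet> X = X" "X \<bullet>\<bullet> mone = X"
proof -
  show "mone \<bullet>\<bullet> X = X"
  proof (rule mats_eqI)
    fix a b :: "nat \<Rightarrow> 'd" assume ab: "a \<in> words" "b \<in> words"
    have "(mone \<bullet>\<bullet> X) (a, b) = (\<Sum>x\<in>words. if x = a then X (x, b) else 0)"
      unfolding mmul_apply[OF ab] by (intro sum.cong) (auto simp: mone_def)
    then show "(mone \<bullet>\<bullet> X) (a, b) = X (a, b)" using ab by simp
  qed (simp_all add: assms)
  show "X \<bullet>\<bullet> mone = X"
  proof (rule mats_eqI)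
    fix a b :: "nat \<Rightarrow> 'd" assume ab: "a \<in> words" "b \<in> words"
    have "(X \<bullet>\<bullet> mone) (a, b) = (\<Sum>x\<in>words. if x = b then X (a, x) else 0)"
      unfolding mmul_apply[OF ab] by (intro sum.cong) (auto simp: mone_def)
    then show "(X \<bullet>\<bullet> mone) (a, b) = X (a, b)" using ab by simp
  qed (simp_all add: assms)
qed

lemma tens_mult:
  fixes A B :: "complex^'d::finite^'d"
  shows "tens (A ** B) = tens A \<bullet>\<bullet> tens B"
proof (rule mats_eqI)
  fix a b :: "nat \<Rightarrow> 'd" assume ab: "a \<in> words" "b \<in> words"
  have "tens (A ** B) (a, b) = (\<Prod>k\<in>{1..n}. \<Sum>x\<in>UNIV. A $ a k $ x * B $ x $ b k)"
    using ab by (simp add: tens_def matrix_matrix_mult_def)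
  also have "\<dots> = (\<Sum>x\<in>words. \<Prod>k\<in>{1..n}. A $ a k $ x k * B $ x k $ b k)"
    unfolding words_def by (rule prod_sum_PiE) auto
  also have "\<dots> = (tens A \<bullet>\<bullet> tens B) (a, b)"
    unfolding mmul_apply[OF ab] by (intro sum.cong refl) (simp add: ab tens_def prod.distrib)
  finally show "tens (A ** B) (a, b) = (tens A \<bullet>\<bullet> tens B) (a, b)" .
qed simp_all

lemma tens_one: "tens (mat 1 :: complex^'d::finite^'d) = mone"
proof (rule mats_eqI)
  fix a b :: "nat \<Rightarrow> 'd" assume ab: "a \<in> words" "b \<in> words"
  show "tens (mat 1 :: complex^'d^'d) (a, b) = mone (a, b)"
  proof (cases "a = b")
    case True
    then show ?thesis using ab by (simp add: tens_def mat_def mone_def)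
  next
    case False
    then obtain k where "k \<in> {1..n}" "a k \<noteq> b k"
      using ab PiE_ext unfolding words_def by metis
    then have "(\<Prod>k\<in>{1..n}. (mat 1 :: complex^'d^'d) $ a k $ b k) = 0"
      by (intro prod_zero) (auto simp: mat_def)
    then show ?thesis using ab False by (simp add: tens_def mone_def)
  qed
qed simp_all

lemma sum_tens_diag: "(\<Sum>a\<in>words. tens A (a, a)) = trace A ^ n"
  for A :: "complex^'d::finite^'d"
proof -
  have "(\<Sum>a\<in>words. tens A (a, a)) = (\<Sum>a\<in>words. \<Prod>k\<in>{1..n}. A $ a k $ a k)"
    by (simp add: tens_def)
  also have "\<dots> = (\<Prod>k\<in>{1..n}. \<Sum>x\<in>UNIV. A $ x $ x)"
    unfolding words_def by (rule prod_sum_PiE[symmetric]) auto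
  finally show ?thesis by (simp add: trace_def)
qed

lemma rep_conv:
  fixes X :: "(nat \<Rightarrow> 'd::finite) \<times> (nat \<Rightarrow> 'd) \<Rightarrow> complex"
  assumes "a \<in> words" "b \<in> words"
  shows "(rep s \<bullet>\<bullet> X) (a, b) = (\<Sum>g\<in>G. s g * X (a \<circ> g, b))"
proof -
  have "(rep s \<bullet>\<bullet> X) (a, b) = (\<Sum>x\<in>words. \<Sum>g\<in>G. s g * (if a \<circ> g = x then X (x, b) else 0))"
    unfolding mmul_apply[OF assms]
    by (intro sum.cong refl) (simp add: rep_def assms sum_distrib_right mult.assoc if_distrib[of "\<lambda>t. t * _"] cong: if_cong)
  also have "\<dots> = (\<Sum>g\<in>G. \<Sum>x\<in>words. s g * (if a \<circ> g = x then X (x, b) else 0))"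
    by (rule sum.swap)
  also have "\<dots> = (\<Sum>g\<in>G. s g * X (a \<circ> g, b))"
    by (intro sum.cong refl) (simp add: sum_distrib_left[symmetric] words_comp assms)
  finally show ?thesis .
qed

lemma rep_mult:
  "rep (s \<star> t) = (rep s \<bullet>\<bullet> rep t :: (nat \<Rightarrow> 'd::finite) \<times> (nat \<Rightarrow> 'd) \<Rightarrow> complex)"
proof (rule mats_eqI)
  fix a b :: "nat \<Rightarrow> 'd" assume ab: "a \<in> words" "b \<in> words"
  have "rep (s \<star> t) (a, b) = (\<Sum>g\<in>G. \<Sum>h\<in>G. s h * t (inv h \<circ> g) * (if a \<circ> g = b then 1 else 0))"
    using ab by (simp add: rep_def conv_def sum_distrib_right)
  also have "\<dots> = (\<Sum>h\<in>G. \<Sum>g\<in>G. s h * t (inv h \<circ> g) * (if a \<circ> g = b then 1 else 0))"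
    by (rule sum.swap)
  also have "\<dots> = (\<Sum>h\<in>G. \<Sum>g\<in>G. s h * (t g * (if a \<circ> h \<circ> g = b then 1 else 0)))"
  proof (rule sum.cong[OF refl])
    fix h assume h: "h \<in> G"
    have "(\<Sum>g\<in>G. s h * t (inv h \<circ> g) * (if a \<circ> g = b then 1 else 0))
        = (\<Sum>g\<in>G. s h * t (inv h \<circ> (h \<circ> g)) * (if a \<circ> (h \<circ> g) = b then 1 else 0))"
      using sum_G_left[OF h, of "\<lambda>g. s h * t (inv h \<circ> g) * (if a \<circ> g = b then 1 else 0)"] by simp
    then show "(\<Sum>g\<in>G. s h * t (inv h \<circ> g) * (if a \<circ> g = b then 1 else 0))
        = (\<Sum>g\<in>G. s h * (t g * (if a \<circ> h \<circ> g = b then 1 else 0)))"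
      using h by (simp add: comp_assoc mult.assoc)
  qed
  also have "\<dots> = (rep s \<bullet>\<bullet> rep t) (a, b)"
    unfolding rep_conv[OF ab] using ab
    by (intro sum.cong refl) (simp add: rep_def words_comp sum_distrib_left)
  finally show "rep (s \<star> t) (a, b) = (rep s \<bullet>\<bullet> rep t) (a, b)" .
qed simp_all

lemma rep_delta:
  "g \<in> G \<Longrightarrow> a \<in> words \<Longrightarrow> b \<in> words \<Longrightarrow> rep (delta g) (a, b) = (if a \<circ> g = b then 1 else 0)"
  by (simp add: rep_def delta_def if_distrib[of "\<lambda>t. t * _"] cong: if_cong)

lemma rep_delta_id: "rep (delta id) = mone"
proof (rule mats_eqI)
  fix a b :: "nat \<Rightarrow> 'a" assume "a \<in> words" "b \<in> words"
  then show "rep (delta id) (a, b) = mone (a, b)" by (simp add: rep_delta mone_def)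
qed simp_all

lemma rep_delta_mmul:
  fixes X :: "(nat \<Rightarrow> 'd::finite) \<times> (nat \<Rightarrow> 'd) \<Rightarrow> complex"
  assumes "g \<in> G" "a \<in> words" "b \<in> words"
  shows "(rep (delta g) \<bullet>\<bullet> X) (a, b) = X (a \<circ> g, b)"
  using assms by (simp add: rep_conv delta_def if_distrib[of "\<lambda>t. t * _"] cong: if_cong)

lemma mmul_rep_delta:
  fixes X :: "(nat \<Rightarrow> 'd::finite) \<times> (nat \<Rightarrow> 'd) \<Rightarrow> complex"
  assumes g: "g \<in> G" and ab: "a \<in> words" "b \<in> words"
  shows "(X \<bullet>\<bullet> rep (delta g)) (a, b) = X (a, b \<circ> inv g)"
proof -
  have "(X \<bullet>\<bullet> rep (delta g)) (a, b) = (\<Sum>x\<in>words. if x = b \<circ> inv g then X (a, x) else 0)"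
    unfolding mmul_apply[OF ab] by (intro sum.cong refl) (auto simp: rep_delta g ab words_comp_eq_iff)
  then show ?thesis using g ab by (simp add: words_comp)
qed

lemma perm_inv_commute_iff:
  fixes Y :: "(nat \<Rightarrow> 'd::finite) \<times> (nat \<Rightarrow> 'd) \<Rightarrow> complex"
  shows "perm_inv Y \<longleftrightarrow> (\<forall>g\<in>G. rep (delta g) \<bullet>\<bullet> Y = Y \<bullet>\<bullet> rep (delta g))"
proof
  assume Y: "perm_inv Y"
  show "\<forall>g\<in>G. rep (delta g) \<bullet>\<bullet> Y = Y \<bullet>\<bullet> rep (delta g)"
  proof (intro ballI mats_eqI)
    fix g and a b :: "nat \<Rightarrow> 'd" assume g: "g \<in> G" and ab: "a \<in> words" "b \<in> words"
    have "Y (a \<circ> g, (b \<circ> inv g) \<circ> g) = Y (a, b \<circ> inv g)"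
      using Y g ab words_comp unfolding perm_inv_def by (metis inv_G)
    then show "(rep (delta g) \<bullet>\<bullet> Y) (a, b) = (Y \<bullet>\<bullet> rep (delta g)) (a, b)"
      using g ab by (simp add: rep_delta_mmul mmul_rep_delta comp_assoc)
  qed simp_all
next
  assume Y: "\<forall>g\<in>G. rep (delta g) \<bullet>\<bullet> Y = Y \<bullet>\<bullet> rep (delta g)"
  show "perm_inv Y" unfolding perm_inv_def
  proof (intro ballI)
    fix g and a b :: "nat \<Rightarrow> 'd" assume g: "g \<in> G" and ab: "a \<in> words" "b \<in> words"
    have "(rep (delta g) \<bullet>\<bullet> Y) (a, b \<circ> g) = (Y \<bullet>\<bullet> rep (delta g)) (a, b \<circ> g)" using Y g by simp
    then show "Y (a \<circ> g, b \<circ> g) = Y (a, b)"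
      using g ab by (simp add: rep_delta_mmul mmul_rep_delta words_comp comp_assoc)
  qed
qed

lemma tens_perm_inv: "perm_inv (tens A)" for A :: "complex^'d::finite^'d"
  unfolding perm_inv_def
proof (intro ballI)
  fix g and a b :: "nat \<Rightarrow> 'd" assume g: "g \<in> G" and ab: "a \<in> words" "b \<in> words"
  have "(\<Prod>k\<in>{1..n}. A $ a (g k) $ b (g k)) = (\<Prod>k\<in>{1..n}. A $ a k $ b k)"
    by (rule prod.reindex_bij_betw[OF G_bij[OF g]])
  then show "tens A (a \<circ> g, b \<circ> g) = tens A (a, b)"
    using g ab by (simp add: tens_def words_comp)
qed

lemma mmul_sum_left:
  "(\<lambda>p. \<Sum>i\<in>I. c i * F i p) \<bullet>\<bullet> Y = (\<lambda>p. \<Sum>i\<in>I. c i * (F i \<bullet>\<bullet> Y) p)"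
  unfolding mmul_def
  by (intro ext) (auto simp: sum_distrib_right sum_distrib_left mult.assoc intro: sum.swap)

lemma mmul_sum_right:
  "Y \<bullet>\<bullet> (\<lambda>p. \<Sum>i\<in>I. c i * F i p) = (\<lambda>p. \<Sum>i\<in>I. c i * (Y \<bullet>\<bullet> F i) p)"
  unfolding mmul_def
  by (intro ext) (auto simp: sum_distrib_right sum_distrib_left mult_ac intro: sum.swap)

lemma rep_expand: "rep s p = (\<Sum>g\<in>G. s g * rep (delta g) p)"
  by (cases p) (auto simp: rep_def delta_def if_distrib[of "\<lambda>t. t * _"] cong: if_cong)

lemma rep_commute:
  fixes Y :: "(nat \<Rightarrow> 'd::finite) \<times> (nat \<Rightarrow> 'd) \<Rightarrow> complex"
  assumes "perm_inv Y" shows "rep s \<bullet>\<bullet> Y = Y \<bullet>\<bullet> rep s"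
proof -
  have "rep s \<bullet>\<bullet> Y = (\<lambda>p. \<Sum>g\<in>G. s g * (rep (delta g) \<bullet>\<bullet> Y) p)"
    using mmul_sum_left[of s "\<lambda>g. rep (delta g)" G Y] by (simp add: rep_expand[symmetric])
  also have "\<dots> = (\<lambda>p. \<Sum>g\<in>G. s g * (Y \<bullet>\<bullet> rep (delta g)) p)"
    using assms by (simp add: perm_inv_commute_iff)
  also have "\<dots> = Y \<bullet>\<bullet> rep s"
    using mmul_sum_right[of Y s "\<lambda>g. rep (delta g)" G] by (simp add: rep_expand[symmetric])
  finally show ?thesis .
qed

lemma rep_sum: "rep (\<lambda>g. \<Sum>i\<in>I. c i * f i g) p = (\<Sum>i\<in>I. c i * rep (f i) p)"
proof -
  have "rep (\<lambda>g. \<Sum>i\<in>I. c i * f i g) p = (\<Sum>g\<in>G. \<Sum>i\<in>I. c i * (f i g * rep (delta g) p))"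
    by (subst rep_expand) (simp add: sum_distrib_right mult.assoc)
  also have "\<dots> = (\<Sum>i\<in>I. \<Sum>g\<in>G. c i * (f i g * rep (delta g) p))"
    by (rule sum.swap)
  also have "\<dots> = (\<Sum>i\<in>I. c i * rep (f i) p)"
    by (simp add: sum_distrib_left[symmetric] rep_expand[symmetric])
  finally show ?thesis .
qed

lemma rep_linear: "Vector_Spaces.linear (\<lambda>c f t. c * f t) (\<lambda>c f t. c * f t) rep"
  by unfold_locales (auto simp: rep_def fun_eq_iff algebra_simps sum.distrib sum_distrib_left)

lemma subspace_rep: "cfun.subspace (rep ` alg)"
proof -
  interpret rep: Vector_Spaces.linear "\<lambda>(c::complex) (f::(nat \<Rightarrow> nat) \<Rightarrow> complex) t. c * f t"
    "\<lambda>(c::complex) f t. c * f t" rep by (rule rep_linear)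
  show ?thesis by (rule rep.subspace_image[OF subspace_alg])
qed

text \<open>Maschke averaging of a linear projection onto the image of the group algebra gives a projection
  commuting with left multiplication by permutations. Its matrix entries are themselves
  permutation-invariant matrices, so \<open>X\<close> commutes with it and \<open>X = X \<bullet>\<bullet> P 1 = P X\<close>.\<close>

lemma bicommutant_rep:
  fixes X :: "(nat \<Rightarrow> 'd::finite) \<times> (nat \<Rightarrow> 'd) \<Rightarrow> complex"
  assumes X: "X \<in> mats"
    and comm: "\<And>Y. Y \<in> mats \<Longrightarrow> perm_inv Y \<Longrightarrow> X \<bullet>\<bullet> Y = Y \<bullet>\<bullet> X"
  shows "X \<in> rep ` alg"
proof -
  let ?S = "rep ` alg :: ((nat \<Rightarrow> 'd) \<times> (nat \<Rightarrow> 'd) \<Rightarrow> complex) set"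
  interpret vp: vector_space_pair
    "\<lambda>(c::complex) (f::(nat \<Rightarrow> 'd) \<times> (nat \<Rightarrow> 'd) \<Rightarrow> complex) t. c * f t"
    "\<lambda>(c::complex) (f::(nat \<Rightarrow> 'd) \<times> (nat \<Rightarrow> 'd) \<Rightarrow> complex) t. c * f t" ..
  obtain p where p_range: "range p \<subseteq> ?S"
    and p_lin: "Vector_Spaces.linear (\<lambda>c f t. c * f t) (\<lambda>c f t. c * f t) p"
    and p_fix: "\<forall>v\<in>?S. p v = v"
    using vp.linear_exists_left_inverse_on[OF cfun.linear_id subspace_rep]
    by (auto simp: id_def)
  interpret p: Vector_Spaces.linear
    "\<lambda>(c::complex) (f::(nat \<Rightarrow> 'd) \<times> (nat \<Rightarrow> 'd) \<Rightarrow> complex) t. c * f t"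
    "\<lambda>(c::complex) (f::(nat \<Rightarrow> 'd) \<times> (nat \<Rightarrow> 'd) \<Rightarrow> complex) t. c * f t" p
    by (rule p_lin)
  define L where "L g Y = rep (delta g) \<bullet>\<bullet> Y" for g and Y :: "(nat \<Rightarrow> 'd) \<times> (nat \<Rightarrow> 'd) \<Rightarrow> complex"
  define P where "P Y = (\<Sum>g\<in>G. (\<lambda>t. inverse (fact n) * L g (p (L (inv g) Y)) t))" for Y
  have L_S: "L g Y \<in> ?S" if "Y \<in> ?S" for g Y
    using that by (auto simp: L_def rep_mult[symmetric])
  have L_L: "L g (L h Y) = L (g \<circ> h) Y" if "g \<in> G" "h \<in> G" for g h Y
    using that by (simp add: L_def mmul_assoc[symmetric] rep_mult[symmetric] delta_delta)
  have L_id: "L id Y = Y" if "Y \<in> mats" for Y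
    using that by (simp add: L_def rep_delta_id)
  have S_mats: "?S \<subseteq> mats" by auto
  have P_S: "P Y \<in> ?S" for Y
    unfolding P_def
    by (intro cfun.subspace_sum[OF subspace_rep] cfun.subspace_scale[OF subspace_rep] L_S
        subsetD[OF p_range] rangeI)
  have P_fix: "P Y = Y" if "Y \<in> ?S" for Y
  proof -
    have "L g (p (L (inv g) Y)) = Y" if g: "g \<in> G" for g
    proof -
      have "p (L (inv g) Y) = L (inv g) Y" using \<open>Y \<in> ?S\<close> p_fix L_S by blast
      moreover have "Y \<in> mats" using \<open>Y \<in> ?S\<close> S_mats by blast
      ultimately show ?thesis using g by (simp add: L_L L_id)
    qed
    then show ?thesis
      by (simp add: P_def fun_eq_iff sum_fun_apply card_G)
  qed
  have P_L: "P (L h Y) = L h (P Y)" if h: "h \<in> G" for h Y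
  proof
    fix t
    have LhP: "L h (P Y) = (\<lambda>t. \<Sum>g\<in>G. inverse (fact n) * L h (L g (p (L (inv g) Y))) t)"
    proof -
      have "P Y = (\<lambda>t. \<Sum>g\<in>G. inverse (fact n) * L g (p (L (inv g) Y)) t)"
        by (simp add: P_def fun_eq_iff sum_fun_apply)
      then show ?thesis unfolding L_def by (simp add: mmul_sum_right)
    qed
    have "P (L h Y) t = (\<Sum>g\<in>G. inverse (fact n) * L g (p (L (inv g) (L h Y))) t)"
      by (simp add: P_def sum_fun_apply)
    also have "\<dots> = (\<Sum>g\<in>G. inverse (fact n) * L (h \<circ> g) (p (L (inv (h \<circ> g)) (L h Y))) t)"
      by (rule sum_G_left[OF h, symmetric])
    also have "\<dots> = (\<Sum>g\<in>G. inverse (fact n) * L h (L g (p (L (inv g) Y))) t)"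
      using h by (intro sum.cong refl) (simp add: L_L inv_o_G comp_assoc)
    finally show "P (L h Y) t = L h (P Y) t" by (simp add: LhP)
  qed
  have P_sum: "P (\<Sum>i\<in>I. (\<lambda>t. f i * Y i t)) = (\<lambda>t. \<Sum>i\<in>I. f i * P (Y i) t)"
    for I f and Y :: "_ \<Rightarrow> (nat \<Rightarrow> 'd) \<times> (nat \<Rightarrow> 'd) \<Rightarrow> complex"
  proof
    fix t
    have L_sum: "L g (\<Sum>i\<in>I. (\<lambda>t. f i * Y i t)) = (\<Sum>i\<in>I. (\<lambda>t. f i * L g (Y i) t))"
      for g and Y :: "_ \<Rightarrow> (nat \<Rightarrow> 'd) \<times> (nat \<Rightarrow> 'd) \<Rightarrow> complex"
    proof -
      have eq: "(\<Sum>i\<in>I. (\<lambda>t. f i * Y i t)) = (\<lambda>t. \<Sum>i\<in>I. f i * Y i t)"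
        for Y :: "_ \<Rightarrow> (nat \<Rightarrow> 'd) \<times> (nat \<Rightarrow> 'd) \<Rightarrow> complex"
        by (simp add: fun_eq_iff sum_fun_apply)
      show ?thesis
        unfolding L_def eq by (rule mmul_sum_right)
    qed
    have "P (\<Sum>i\<in>I. (\<lambda>t. f i * Y i t)) t
        = (\<Sum>g\<in>G. \<Sum>i\<in>I. inverse (fact n) * (f i * L g (p (L (inv g) (Y i))) t))"
      by (simp add: P_def sum_fun_apply L_sum p.sum p.scale sum_distrib_left)
    also have "\<dots> = (\<Sum>i\<in>I. \<Sum>g\<in>G. inverse (fact n) * (f i * L g (p (L (inv g) (Y i))) t))"
      by (rule sum.swap)
    also have "\<dots> = (\<Sum>i\<in>I. f i * P (Y i) t)"
      by (simp add: P_def sum_fun_apply sum_distrib_left mult_ac)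
    finally show "P (\<Sum>i\<in>I. (\<lambda>t. f i * Y i t)) t = (\<Sum>i\<in>I. f i * P (Y i) t)" .
  qed
  define E where "E k l = (\<lambda>q. if q = (k, l) then 1 else 0 :: complex)"
    for k l :: "nat \<Rightarrow> 'd"
  \<comment> \<open>The entries of \<open>P\<close> with the column indices \<open>j\<close> and
    \<open>l\<close> held fixed form a matrix in the row indices. That \<open>P\<close> commutes
    with left multiplication by permutations says that this matrix is permutation-invariant.\<close>
  define K where "K j l = (\<lambda>(i, k). if i \<in> words \<and> k \<in> words then P (E k l) (i, j) else 0)"
    for j l :: "nat \<Rightarrow> 'd"
  have K_inv: "perm_inv (K j l)" if "j \<in> words" "l \<in> words" for j l
    unfolding perm_inv_def
  proof (intro ballI)
    fix g and i k :: "nat \<Rightarrow> 'd" assume g: "g \<in> G" and ik: "i \<in> words" "k \<in> words"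
    have "L g (E (k \<circ> g) l) = E k l"
    proof (rule mats_eqI)
      show "L g (E (k \<circ> g) l) \<in> mats" by (simp add: L_def)
      show "E k l \<in> mats" using ik that by (auto simp: mats_def E_def)
      fix a b :: "nat \<Rightarrow> 'd" assume "a \<in> words" "b \<in> words"
      then show "L g (E (k \<circ> g) l) (a, b) = E k l (a, b)"
        using g by (auto simp: L_def rep_delta_mmul E_def words_comp_eq_iff comp_assoc)
    qed
    then have "P (E k l) (i, j) = L g (P (E (k \<circ> g) l)) (i, j)" using P_L[OF g] by metis
    also have "\<dots> = P (E (k \<circ> g) l) (i \<circ> g, j)"
      using g ik that by (simp add: L_def rep_delta_mmul)
    finally show "K j l (i \<circ> g, k \<circ> g) = K j l (i, k)"
      using g ik by (simp add: K_def words_comp)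
  qed
  have K_mats: "K j l \<in> mats" for j l by (auto simp: K_def mats_def)
  have expand: "Y = (\<Sum>q\<in>words \<times> words. (\<lambda>t. Y q * E (fst q) (snd q) t))" if "Y \<in> mats" for Y
  proof -
    have "Y q = 0" if "q \<notin> words \<times> words" for q
      using \<open>Y \<in> mats\<close> that unfolding mats_def by blast
    then show ?thesis
      using finite_support_in_span[of "words \<times> words" Y] by (simp add: E_def)
  qed
  have P_K: "P Y (i, j) = (\<Sum>l\<in>words. (K j l \<bullet>\<bullet> Y) (i, l))"
    if "Y \<in> mats" "i \<in> words" "j \<in> words" for Y i j
  proof -
    have "P Y (i, j) = (\<Sum>q\<in>words \<times> words. Y q * P (E (fst q) (snd q)) (i, j))"
      by (subst expand[OF that(1)]) (simp only: P_sum)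
    also have "\<dots> = (\<Sum>k\<in>words. \<Sum>l\<in>words. Y (k, l) * P (E k l) (i, j))"
      by (simp add: sum.cartesian_product case_prod_beta)
    also have "\<dots> = (\<Sum>l\<in>words. \<Sum>k\<in>words. Y (k, l) * P (E k l) (i, j))"
      by (rule sum.swap)
    also have "\<dots> = (\<Sum>l\<in>words. (K j l \<bullet>\<bullet> Y) (i, l))"
      using that by (intro sum.cong refl) (simp add: mmul_apply K_def mult.commute)
    finally show ?thesis .
  qed
  have "P X = X"
  proof (rule mats_eqI)
    show "P X \<in> mats" using P_S S_mats by blast
    fix i j :: "nat \<Rightarrow> 'd" assume ij: "i \<in> words" "j \<in> words"
    have "P X (i, j) = (\<Sum>l\<in>words. (X \<bullet>\<bullet> K j l) (i, l))"
      using ij by (simp add: P_K[OF X] comm[OF K_mats K_inv])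
    also have "\<dots> = (\<Sum>l\<in>words. \<Sum>k\<in>words. X (i, k) * K j l (k, l))"
      using ij by (simp add: mmul_apply)
    also have "\<dots> = (\<Sum>k\<in>words. \<Sum>l\<in>words. X (i, k) * K j l (k, l))"
      by (rule sum.swap)
    also have "\<dots> = (\<Sum>k\<in>words. X (i, k) * P mone (k, j))"
      using ij by (intro sum.cong refl) (simp add: P_K sum_distrib_left[symmetric] K_mats)
    also have "P mone = mone"
      by (intro P_fix image_eqI[of _ _ "delta id"]) (simp_all add: rep_delta_id)
    also have "(\<Sum>k\<in>words. X (i, k) * mone (k, j)) = (X \<bullet>\<bullet> mone) (i, j)"
      using ij by (simp add: mmul_apply)
    finally show "P X (i, j) = X (i, j)" using X by simp
  qed (rule X)
  then show ?thesis using P_S by metis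
qed

end

section \<open>The commutant of the unitary group\<close>

text \<open>This is the polarization identity for symmetric tensors.\<close>

lemma permanent_ryser:
  fixes F :: "nat \<Rightarrow> nat \<Rightarrow> complex"
  assumes "finite N"
  shows "(\<Sum>\<pi> | \<pi> permutes N. \<Prod>k\<in>N. F (\<pi> k) k)
    = (\<Sum>S\<in>Pow N. (\<Prod>l\<in>N - S. -1) * (\<Prod>k\<in>N. \<Sum>l\<in>S. F l k))"
proof -
  let ?N = "N \<rightarrow>\<^sub>E N"
  have fin: "finite ?N" using assms by (intro finite_PiE) auto
  have "(\<Sum>S\<in>Pow N. (\<Prod>l\<in>N - S. -1) * (\<Prod>k\<in>N. \<Sum>l\<in>S. F l k))
      = (\<Sum>S\<in>Pow N. \<Sum>f\<in>?N. (\<Prod>k\<in>N. F (f k) k) * (if f ` N \<subseteq> S then (\<Prod>l\<in>N - S. -1) else 0))"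
  proof (rule sum.cong[OF refl])
    fix S assume S: "S \<in> Pow N"
    have "(\<Prod>k\<in>N. \<Sum>l\<in>S. F l k) = (\<Sum>f\<in>N \<rightarrow>\<^sub>E S. \<Prod>k\<in>N. F (f k) k)"
      using assms S by (intro prod_sum_PiE) (auto intro: finite_subset)
    also have "N \<rightarrow>\<^sub>E S = {f \<in> ?N. f ` N \<subseteq> S}" using S by (auto simp: PiE_iff extensional_def)
    finally have "(\<Prod>l\<in>N - S. -1) * (\<Prod>k\<in>N. \<Sum>l\<in>S. F l k)
        = (\<Sum>f\<in>{f \<in> ?N. f ` N \<subseteq> S}. (\<Prod>k\<in>N. F (f k) k) * (\<Prod>l\<in>N - S. -1))"
      by (simp only: sum_distrib_left mult.commute)
    also have "\<dots> = (\<Sum>f\<in>?N. if f ` N \<subseteq> S then (\<Prod>k\<in>N. F (f k) k) * (\<Prod>l\<in>N - S. -1) else 0)"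
      by (rule sum.inter_filter[OF fin])
    finally show "(\<Prod>l\<in>N - S. -1) * (\<Prod>k\<in>N. \<Sum>l\<in>S. F l k)
        = (\<Sum>f\<in>?N. (\<Prod>k\<in>N. F (f k) k) * (if f ` N \<subseteq> S then (\<Prod>l\<in>N - S. -1) else 0))"
      by (simp only: if_distrib[of "\<lambda>t. _ * t"] mult_zero_right)
  qed
  also have "\<dots> = (\<Sum>f\<in>?N. (\<Prod>k\<in>N. F (f k) k) * (\<Sum>S\<in>Pow N. if f ` N \<subseteq> S then (\<Prod>l\<in>N - S. -1) else 0))"
    by (subst sum.swap) (simp only: sum_distrib_left)
  also have "\<dots> = (\<Sum>f\<in>?N. (\<Prod>k\<in>N. F (f k) k) * (if f ` N = N then 1 else 0))"
  proof (rule sum.cong[OF refl])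
    fix f assume f: "f \<in> ?N"
    \<comment> \<open>The zeros encode the condition that \<open>S\<close> contains the image of
      \<open>f\<close>. The alternating sum then becomes the product of the factors
      \<open>1 + ?a l\<close>, which vanishes as soon as \<open>f\<close> misses some
      \<open>l\<close>.\<close>
    let ?a = "\<lambda>l. if l \<in> f ` N then 0 else -1 :: complex"
    have "(\<Sum>S\<in>Pow N. if f ` N \<subseteq> S then (\<Prod>l\<in>N - S. -1) else 0)
        = (\<Sum>S\<in>Pow N. (\<Prod>l\<in>S. 1) * (\<Prod>l\<in>N - S. ?a l))"
    proof (rule sum.cong[OF refl])
      fix S assume S: "S \<in> Pow N"
      show "(if f ` N \<subseteq> S then (\<Prod>l\<in>N - S. -1) else 0) = (\<Prod>l\<in>S. 1) * (\<Prod>l\<in>N - S. ?a l)"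
      proof (cases "f ` N \<subseteq> S")
        case True
        then have "(\<Prod>l\<in>N - S. ?a l) = (\<Prod>l\<in>N - S. -1)" by (intro prod.cong) auto
        then show ?thesis using True by simp
      next
        case False
        then obtain l where "l \<in> f ` N" "l \<notin> S" by blast
        then have "\<exists>l\<in>N - S. ?a l = 0" using f by (intro bexI[of _ l]) auto
        then have "(\<Prod>l\<in>N - S. ?a l) = 0" using assms by (intro prod_zero) auto
        then show ?thesis using False by simp
      qed
    qed
    also have "\<dots> = (\<Prod>l\<in>N. 1 + ?a l)" by (rule prod_add[OF assms, symmetric])
    also have "\<dots> = (if f ` N = N then 1 else 0)"
    proof (cases "f ` N = N")
      case True
      then show ?thesis by simp
    next
      case False
      then obtain l where "l \<in> N" "l \<notin> f ` N" using f by auto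
      then have "\<exists>l\<in>N. 1 + ?a l = 0" by (intro bexI[of _ l]) auto
      then show ?thesis using False assms by (simp only: if_False prod_zero)
    qed
    finally show "(\<Prod>k\<in>N. F (f k) k) * (\<Sum>S\<in>Pow N. if f ` N \<subseteq> S then (\<Prod>l\<in>N - S. -1) else 0)
        = (\<Prod>k\<in>N. F (f k) k) * (if f ` N = N then 1 else 0)" by simp
  qed
  also have "\<dots> = (\<Sum>f\<in>?N. if f ` N = N then (\<Prod>k\<in>N. F (f k) k) else 0)"
    by (intro sum.cong refl) simp
  also have "\<dots> = (\<Sum>f\<in>{f \<in> ?N. f ` N = N}. \<Prod>k\<in>N. F (f k) k)"
    by (rule sum.inter_filter[OF fin, symmetric])
  also have "\<dots> = (\<Sum>\<pi> | \<pi> permutes N. \<Prod>k\<in>N. F (\<pi> k) k)"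
  proof (rule sum.reindex_bij_witness[where j = "\<lambda>f x. if x \<in> N then f x else x" and i = "\<lambda>\<pi>. restrict \<pi> N"])
    fix f assume f: "f \<in> {f \<in> ?N. f ` N = N}"
    let ?g = "\<lambda>x. if x \<in> N then f x else x"
    show "restrict ?g N = f" using f by (auto simp: PiE_iff extensional_def restrict_def fun_eq_iff)
    have "inj_on f N" using f assms by (intro eq_card_imp_inj_on) auto
    then have "bij_betw f N N" using f by (simp add: bij_betw_def)
    then have "bij_betw ?g N N" by (rule bij_betw_cong[THEN iffD1, rotated]) simp
    then show "?g \<in> {\<pi>. \<pi> permutes N}" by (auto intro: bij_imp_permutes)
    show "(\<Prod>k\<in>N. F (?g k) k) = (\<Prod>k\<in>N. F (f k) k)" by (intro prod.cong) auto
  next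
    fix \<pi> assume "\<pi> \<in> {\<pi>. \<pi> permutes N}"
    then have \<pi>: "\<pi> permutes N" by simp
    show "(\<lambda>x. if x \<in> N then restrict \<pi> N x else x) = \<pi>"
      using \<pi> by (auto simp: fun_eq_iff permutes_def)
    show "restrict \<pi> N \<in> {f \<in> ?N. f ` N = N}"
      using permutes_image[OF \<pi>] by (auto simp: PiE_iff image_iff permutes_in_image[OF \<pi>])
  qed
  finally show ?thesis by simp
qed

context perm_algebra
begin

text \<open>Two closure properties carry this set from the unitary matrices to all matrices: it is
  closed under products, and it contains a whole polynomial curve once it contains infinitely many
  of its points.\<close>

definition tens_comm :: "((nat \<Rightarrow> 'd::finite) \<times> (nat \<Rightarrow> 'd) \<Rightarrow> complex) \<Rightarrow> (complex^'d^'d) set" where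
  "tens_comm X = {A. X \<bullet>\<bullet> tens A = tens A \<bullet>\<bullet> X}"

lemma tens_comm_mult: "A \<in> tens_comm X \<Longrightarrow> B \<in> tens_comm X \<Longrightarrow> A ** B \<in> tens_comm X"
  unfolding tens_comm_def by (simp add: tens_mult) (metis mmul_assoc)

lemma tens_comm_iff:
  "A \<in> tens_comm X \<longleftrightarrow> (\<forall>a\<in>words. \<forall>b\<in>words. (X \<bullet>\<bullet> tens A) (a, b) = (tens A \<bullet>\<bullet> X) (a, b))"
  unfolding tens_comm_def by (auto intro: mats_eqI)

text \<open>Membership is a polynomial condition on the entries, so it extends from infinitely many
  parameters of a polynomial family to all of them.\<close>

lemma tens_comm_poly:
  fixes A :: "complex \<Rightarrow> complex^'d::finite^'d"
  assumes poly: "\<And>i j. polyfun (\<lambda>z. A z $ i $ j)"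
    and "infinite Z" and Z: "\<And>z. z \<in> Z \<Longrightarrow> A z \<in> tens_comm X"
  shows "A z \<in> tens_comm X"
  unfolding tens_comm_iff
proof (intro ballI)
  fix a b :: "nat \<Rightarrow> 'd" assume ab: "a \<in> words" "b \<in> words"
  let ?f = "\<lambda>z. (\<Sum>x\<in>words. X (a, x) * (\<Prod>k\<in>{1..n}. A z $ x k $ b k))
      - (\<Sum>x\<in>words. (\<Prod>k\<in>{1..n}. A z $ a k $ x k) * X (x, b))"
  have eq: "?f z = (X \<bullet>\<bullet> tens (A z)) (a, b) - (tens (A z) \<bullet>\<bullet> X) (a, b)" for z
    using ab by (simp add: mmul_apply tens_def)
  have "polyfun ?f" by (intro polyfun_intros poly)
  then have "?f z = 0"
  proof (rule polyfun_eq_0[OF _ \<open>infinite Z\<close>])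
    fix z assume "z \<in> Z"
    then show "?f z = 0" using Z[of z] ab unfolding eq tens_comm_iff by simp
  qed
  then show "(X \<bullet>\<bullet> tens (A z)) (a, b) = (tens (A z) \<bullet>\<bullet> X) (a, b)" unfolding eq by simp
qed

lemma words_ext: "a \<in> words \<Longrightarrow> b \<in> words \<Longrightarrow> (\<And>k. k \<in> {1..n} \<Longrightarrow> a k = b k) \<Longrightarrow> a = b"
  unfolding words_def by (rule PiE_ext)

text \<open>The matrix 1 + s u v^T, without conjugation of \<open>v\<close>, so that the entries are
  polynomial in both vectors and can be continued analytically.\<close>

definition rank_one_pert :: "complex^'d::finite \<Rightarrow> complex^'d \<Rightarrow> complex \<Rightarrow> complex^'d^'d" where
  "rank_one_pert u v s = (\<chi> i j. (if i = j then 1 else 0) + s * u $ i * v $ j)"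

text \<open>With v v^* squaring to \<open>N\<close> times itself, the perturbations with parameters
  \<open>x\<close> and \<open>y\<close> multiply to the one with parameter
  \<open>x + y + x * y * N\<close>, and the adjoint conjugates the parameter.\<close>

lemma rank_one_pert_unitary:
  fixes v :: "complex^'d::finite"
  assumes N: "N = (\<Sum>i\<in>UNIV. v $ i * cnj (v $ i))" and s: "s + cnj s + s * cnj s * N = 0"
  shows "rank_one_pert v (\<chi> i. cnj (v $ i)) s \<in> unitary_group"
proof -
  have cnjN: "(\<Sum>i\<in>UNIV. cnj (v $ i) * v $ i) = N" by (simp add: N mult.commute)
  have entry: "(\<Sum>k\<in>UNIV. ((if i = k then 1 else 0) + x * v $ i * cnj (v $ k))
      * ((if k = j then 1 else 0) + y * v $ k * cnj (v $ j)))
    = (if i = j then 1 else 0) + (x + y + x * y * N) * v $ i * cnj (v $ j)" for x y :: complex and i j :: 'd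
  proof -
    have "(\<Sum>k\<in>UNIV. ((if i = k then 1 else 0) + x * v $ i * cnj (v $ k))
      * ((if k = j then 1 else 0) + y * v $ k * cnj (v $ j)))
      = (\<Sum>k\<in>UNIV. (if k = i then (if k = j then 1 else 0) + y * v $ k * cnj (v $ j) else 0)
        + (if k = j then x * v $ i * cnj (v $ k) else 0)
        + x * y * v $ i * cnj (v $ j) * (cnj (v $ k) * v $ k))"
      by (intro sum.cong refl) (auto simp: algebra_simps)
    also have "\<dots> = ((if i = j then 1 else 0) + y * v $ i * cnj (v $ j)) + x * v $ i * cnj (v $ j)
        + x * y * v $ i * cnj (v $ j) * N"
      by (simp only: sum.distrib sum.delta[OF finite] UNIV_I if_True
          sum_distrib_left[symmetric] cnjN)
    also have "\<dots> = (if i = j then 1 else 0) + (x + y + x * y * N) * v $ i * cnj (v $ j)"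
      by (simp add: algebra_simps)
    finally show ?thesis .
  qed
  let ?R = "rank_one_pert v (\<chi> i. cnj (v $ i))"
  have mult: "?R x ** ?R y = ?R (x + y + x * y * N)" for x y
    by (simp add: vec_eq_iff matrix_matrix_mult_def rank_one_pert_def entry)
  have adj: "conj_transpose (?R s) = ?R (cnj s)"
    by (auto simp: vec_eq_iff conj_transpose_def rank_one_pert_def)
  have "?R s ** ?R (cnj s) = ?R 0" "?R (cnj s) ** ?R s = ?R 0"
    using s by (simp_all add: mult mult.commute add.commute)
  moreover have "?R 0 = mat 1"
    by (simp add: vec_eq_iff rank_one_pert_def mat_def)
  ultimately show ?thesis
    by (simp add: unitary_group_def adj)
qed

lemma infinite_reals_complex: "infinite (range complex_of_real)"
  using infinite_UNIV_char_0[where 'a = real] finite_imageD[of complex_of_real UNIV]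
  by (auto simp: inj_on_def)

text \<open>For fixed nonzero \<open>v\<close> the parameters giving unitary matrices form a circle.
  It is infinite and the family is polynomial in \<open>s\<close>, so every complex parameter is
  reached.\<close>

lemma rank_one_pert_comm_self:
  fixes v :: "complex^'d::finite"
  assumes U: "unitary_group \<subseteq> tens_comm X"
  shows "rank_one_pert v (\<chi> i. cnj (v $ i)) s \<in> tens_comm X"
proof (cases "v = 0")
  case True
  have "mat 1 \<in> unitary_group"
    by (auto simp: unitary_group_def conj_transpose_def vec_eq_iff matrix_matrix_mult_def mat_def
        if_distrib[of "\<lambda>t. t * _"] if_distrib[of cnj] cong: if_cong)
  moreover have "rank_one_pert v (\<chi> i. cnj (v $ i)) s = mat 1"
    by (simp add: rank_one_pert_def mat_def True)
  ultimately show ?thesis using U by auto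
next
  case False
  define N where "N = (\<Sum>i\<in>UNIV. v $ i * cnj (v $ i))"
  define M where "M = (\<Sum>i\<in>UNIV. (cmod (v $ i))\<^sup>2)"
  have NM: "N = of_real M"
    by (simp add: N_def M_def complex_norm_square del: of_real_power)
  obtain i where "v $ i \<noteq> 0" using False by (auto simp: vec_eq_iff)
  then have "M > 0" unfolding M_def
    by (intro sum_pos2[of _ i]) auto
  \<comment> \<open>Unitarity means that \<open>1 + s * N\<close>, the eigenvalue at
    \<open>v\<close>, has modulus 1; solve \<open>1 + s * N = cis t\<close> for
    \<open>s\<close>.\<close>
  let ?Z = "(\<lambda>t. (cis t - 1) / N) ` {0..<2 * pi}"
  show ?thesis
  proof (rule tens_comm_poly[where Z = ?Z])
    show "polyfun (\<lambda>z. rank_one_pert v (\<chi> i. cnj (v $ i)) z $ i $ j)" for i j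
      unfolding rank_one_pert_def by (simp only: vec_lambda_beta, intro polyfun_intros)
    have "inj_on (\<lambda>t. (cis t - 1) / N) {0..<2 * pi}"
    proof (rule inj_onI)
      fix x y assume xy: "x \<in> {0..<2 * pi}" "y \<in> {0..<2 * pi}" "(cis x - 1) / N = (cis y - 1) / N"
      then have "cis x = cis y" using NM \<open>M > 0\<close> by simp
      moreover have "Arg2pi (cis t) = t" if "t \<in> {0..<2 * pi}" for t
        by (rule Arg2pi_unique[of 1]) (use that in \<open>simp_all add: cis_conv_exp\<close>)
      ultimately show "x = y" using xy(1,2) by metis
    qed
    then show "infinite ?Z"
      using pi_gt_zero by (auto simp: finite_image_iff infinite_Ico)
    fix s assume "s \<in> ?Z"
    then obtain t where t: "s = (cis t - 1) / N" by blast
    have cN: "cnj N = N" by (simp add: NM)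
    have "N \<noteq> 0" using NM \<open>M > 0\<close> by simp
    then have "s + cnj s + s * cnj s * N = (cis t * cnj (cis t) - 1) / N"
      by (simp add: t cN field_simps)
    also have "\<dots> = 0" by (simp add: cis_cnj cis_mult)
    finally show "rank_one_pert v (\<chi> i. cnj (v $ i)) s \<in> tens_comm X"
      using rank_one_pert_unitary[OF N_def] U by blast
  qed
qed

text \<open>Decouples the two vectors. For real \<open>t\<close> the second vector is the conjugate
  of the first, \<open>x + t y\<close>; the family is polynomial in \<open>t\<close>, and at
  \<open>t = \<i>\<close> the vectors become the independent \<open>u\<close> and
  \<open>v\<close>.\<close>

lemma rank_one_pert_comm:
  fixes u v :: "complex^'d::finite"
  assumes U: "unitary_group \<subseteq> tens_comm X"
  shows "rank_one_pert u v 1 \<in> tens_comm X"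
proof -
  define x where "x = (\<chi> i. (u $ i + cnj (v $ i)) / 2)"
  define y where "y = (\<chi> i. (u $ i - cnj (v $ i)) / (2 * \<i>))"
  define A where "A t = rank_one_pert (\<chi> i. x $ i + t * y $ i) (\<chi> i. cnj (x $ i) + t * cnj (y $ i)) 1" for t
  have "A \<i> \<in> tens_comm X"
  proof (rule tens_comm_poly[where Z = "range complex_of_real"])
    show "polyfun (\<lambda>z. A z $ i $ j)" for i j
      unfolding A_def rank_one_pert_def by (simp only: vec_lambda_beta, intro polyfun_intros)
    show "infinite (range complex_of_real)" by (rule infinite_reals_complex)
    fix t assume "t \<in> range complex_of_real"
    then obtain t' where "t = of_real t'" by blast
    then have "A t = rank_one_pert (\<chi> i. x $ i + t * y $ i) (\<chi> i. cnj ((\<chi> i. x $ i + t * y $ i) $ i)) 1"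
      by (simp add: A_def)
    then show "A t \<in> tens_comm X" by (simp only: rank_one_pert_comm_self[OF U])
  qed
  moreover have "(\<chi> i. x $ i + \<i> * y $ i) = u" "(\<chi> i. cnj (x $ i) + \<i> * cnj (y $ i)) = v"
    by (simp_all add: x_def y_def vec_eq_iff field_simps)
  ultimately show ?thesis by (simp add: A_def)
qed

lemma det_polyfun:
  fixes A :: "complex \<Rightarrow> complex^'d::finite^'d"
  assumes "\<And>i j. polyfun (\<lambda>z. A z $ i $ j)"
  shows "polyfun (\<lambda>z. det (A z))"
  unfolding det_def by (intro polyfun_intros assms)

text \<open>Rows are changed one at a time. Replacing a row of an invertible \<open>B\<close> multiplies \<open>B\<close> by a rank
  one perturbation of the identity, and \<open>(1 - z) 1 + z B\<close> is invertible for all but finitely many \<open>z\<close>.\<close>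

lemma all_matrices_comm:
  fixes X :: "(nat \<Rightarrow> 'd::finite) \<times> (nat \<Rightarrow> 'd) \<Rightarrow> complex"
  assumes U: "unitary_group \<subseteq> tens_comm X"
  shows "A \<in> tens_comm X"
proof -
  have "A \<in> tens_comm X" if "finite K" "\<And>i j. i \<notin> K \<Longrightarrow> A $ i $ j = (if i = j then 1 else 0)"
    for K and A :: "complex^'d^'d"
    using that
  proof (induction K arbitrary: A rule: finite_induct)
    case empty
    then have "A = rank_one_pert 0 0 1" by (simp add: rank_one_pert_def vec_eq_iff)
    then show ?case using rank_one_pert_comm[OF U] by simp
  next
    case (insert r K)
    \<comment> \<open>Both \<open>B z\<close> and \<open>C z\<close> follow the line from the
      identity to \<open>A\<close>, except that \<open>B z\<close> keeps row \<open>r\<close> of the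
      identity and is therefore covered by the induction hypothesis.\<close>
    define B where "B z = (\<chi> i j. if i = r then (if j = r then 1 else 0)
        else (1 - z) * (if i = j then 1 else 0) + z * A $ i $ j)" for z
    define C where "C z = (\<chi> i j. (1 - z) * (if i = j then 1 else 0) + z * A $ i $ j)" for z
    have B_comm: "B z \<in> tens_comm X" for z
      using insert.prems insert.hyps by (intro insert.IH) (auto simp: B_def)
    have pB: "polyfun (\<lambda>z. B z $ i $ j)" for i j
      unfolding B_def by (simp only: vec_lambda_beta, intro polyfun_intros)
    have "\<not> (\<forall>z. det (B z) = 0)"
    proof
      assume "\<forall>z. det (B z) = 0"
      moreover have "B 0 = mat 1" by (auto simp: B_def mat_def vec_eq_iff)
      ultimately show False by (metis det_I zero_neq_one)
    qed
    then have "finite {z. det (B z) = 0}"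
      using polyfun_eq_0[OF det_polyfun[OF pB]] by blast
    then have inf: "infinite {z. det (B z) \<noteq> 0}"
      using infinite_UNIV_char_0[where 'a = complex] finite_Collect_not by blast
    have "C 1 \<in> tens_comm X"
    proof (rule tens_comm_poly[OF _ inf])
      show "polyfun (\<lambda>z. C z $ i $ j)" for i j
        unfolding C_def by (simp only: vec_lambda_beta, intro polyfun_intros)
      fix z assume "z \<in> {z. det (B z) \<noteq> 0}"
      then obtain Bi where inv: "Bi ** B z = mat 1"
        using invertible_det_nz[of "B z"] by (auto simp: invertible_def)
      \<comment> \<open>The difference of \<open>C z\<close> and \<open>B z\<close>, concentrated in
        row \<open>r\<close>. Multiplying it by the inverse of \<open>B z\<close> gives the row
        vector for which the rank one perturbation times \<open>B z\<close> is
        \<open>C z\<close>.\<close>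
      define w where "w = (\<chi> j. C z $ r $ j - (if j = r then 1 else 0))"
      define R where "R = rank_one_pert (axis r 1) (w v* Bi) 1"
      have "(w v* Bi) v* B z = w"
        by (simp add: vector_matrix_mul_assoc inv)
      then have w: "(\<Sum>k\<in>UNIV. (w v* Bi) $ k * B z $ k $ j) = w $ j" for j
        by (simp add: vector_matrix_mult_def vec_eq_iff mult.commute)
      have "(R ** B z) $ i $ j = C z $ i $ j" for i j
      proof -
        have "(R ** B z) $ i $ j = (\<Sum>k\<in>UNIV. (if k = i then B z $ k $ j else 0)
            + axis r 1 $ i * ((w v* Bi) $ k * B z $ k $ j))"
          unfolding R_def rank_one_pert_def matrix_matrix_mult_def
          by (simp, intro sum.cong refl) (auto simp: algebra_simps)
        also have "\<dots> = B z $ i $ j + axis r 1 $ i * w $ j"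
          by (simp add: sum.distrib sum_distrib_left[symmetric] w)
        also have "\<dots> = C z $ i $ j"
          by (cases "i = r") (auto simp: w_def B_def C_def axis_def)
        finally show ?thesis .
      qed
      then have "C z = R ** B z" by (simp add: vec_eq_iff)
      moreover have "R \<in> tens_comm X" unfolding R_def by (rule rank_one_pert_comm[OF U])
      ultimately show "C z \<in> tens_comm X"
        using tens_comm_mult[of R X "B z"] B_comm[of z] by simp
    qed
    moreover have "C 1 = A" by (simp add: C_def vec_eq_iff)
    ultimately show ?case by simp
  qed
  from this[of UNIV] show ?thesis by simp
qed

text \<open>An invariant \<open>Y\<close> is a combination of matrix units summed over their
  permutation orbits. Each such sum has permanents as entries, and polarization writes it as a
  signed sum of tensor powers, with all of which \<open>X\<close> commutes.\<close>

lemma tens_span_perm_inv: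
  fixes X Y :: "(nat \<Rightarrow> 'd::finite) \<times> (nat \<Rightarrow> 'd) \<Rightarrow> complex"
  assumes X: "\<And>A. A \<in> tens_comm X" and Y: "perm_inv Y" "Y \<in> mats"
  shows "X \<bullet>\<bullet> Y = Y \<bullet>\<bullet> X"
proof -
  \<comment> \<open>For \<open>q = (a, b)\<close>, this is the sum over \<open>l\<close> in
    \<open>S\<close> of the elementary matrices with entry 1 at \<open>(a l, b l)\<close>.\<close>
  define M where "M q S = (\<chi> i j. \<Sum>l\<in>S. (if i = fst q l \<and> j = snd q l then 1 else 0 :: complex))"
    for q :: "(nat \<Rightarrow> 'd) \<times> (nat \<Rightarrow> 'd)" and S :: "nat set"
  define sg where "sg S = (\<Prod>l\<in>{1..n} - S. -1 :: complex)" for S :: "nat set"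
  have sym: "(\<Sum>g\<in>G. if a = fst q \<circ> g \<and> b = snd q \<circ> g then 1 else 0)
      = (\<Sum>S\<in>Pow {1..n}. sg S * tens (M q S) (a, b))"
    if q: "q \<in> words \<times> words" and ab: "a \<in> words" "b \<in> words" for q a b
  proof -
    let ?F = "\<lambda>l k. if a k = fst q l \<and> b k = snd q l then 1 else 0 :: complex"
    have "(if a = fst q \<circ> g \<and> b = snd q \<circ> g then 1 else 0) = (\<Prod>k\<in>{1..n}. ?F (g k) k)"
      if g: "g \<in> G" for g
    proof (cases "a = fst q \<circ> g \<and> b = snd q \<circ> g")
      case True
      then show ?thesis by simp
    next
      case False
      have "fst q \<circ> g \<in> words" "snd q \<circ> g \<in> words" using q g by (auto intro: words_comp)
      then have "\<exists>k\<in>{1..n}. ?F (g k) k = 0"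
        using False words_ext[OF ab(1)] words_ext[OF ab(2)] by (metis (mono_tags, lifting) comp_apply)
      then have "(\<Prod>k\<in>{1..n}. ?F (g k) k) = 0" by (intro prod_zero) simp_all
      then show ?thesis using False by simp
    qed
    then have "(\<Sum>g\<in>G. if a = fst q \<circ> g \<and> b = snd q \<circ> g then 1 else 0)
        = (\<Sum>g\<in>G. \<Prod>k\<in>{1..n}. ?F (g k) k)" by simp
    also have "\<dots> = (\<Sum>S\<in>Pow {1..n}. sg S * (\<Prod>k\<in>{1..n}. \<Sum>l\<in>S. ?F l k))"
      unfolding G_def sg_def by (rule permanent_ryser) simp
    also have "\<dots> = (\<Sum>S\<in>Pow {1..n}. sg S * tens (M q S) (a, b))"
      using ab by (simp add: tens_def M_def)
    finally show ?thesis .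
  qed
  \<comment> \<open>Summing the symmetrized matrix units weighted by \<open>Y\<close> returns each
    entry of \<open>Y\<close> once per permutation, by invariance; hence the factor
    \<open>inverse (fact n)\<close>.\<close>
  have Y_eq: "Y = (\<lambda>p. \<Sum>(q, S)\<in>(words \<times> words) \<times> Pow {1..n}.
      (inverse (fact n) * Y q * sg S) * tens (M q S) p)" (is "Y = ?R")
  proof (rule mats_eqI)
    show "?R \<in> mats"
      unfolding mats_def mem_Collect_eq
    proof (intro allI impI)
      fix p :: "(nat \<Rightarrow> 'd) \<times> (nat \<Rightarrow> 'd)" assume "p \<notin> words \<times> words"
      then have "tens (M q S) p = 0" for q S by (cases p) (auto simp: tens_def)
      then show "?R p = 0" by (simp add: case_prod_beta)
    qed
    fix a b :: "nat \<Rightarrow> 'd" assume ab: "a \<in> words" "b \<in> words"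
    have "?R (a, b) = (\<Sum>q\<in>words \<times> words. \<Sum>S\<in>Pow {1..n}. inverse (fact n) * Y q * (sg S * tens (M q S) (a, b)))"
      by (subst sum.cartesian_product[symmetric]) (simp add: mult.assoc)
    also have "\<dots> = (\<Sum>q\<in>words \<times> words. inverse (fact n) * Y q * (\<Sum>g\<in>G. if a = fst q \<circ> g \<and> b = snd q \<circ> g then 1 else 0))"
      by (intro sum.cong refl) (simp only: sum_distrib_left[symmetric] sym[OF _ ab])
    also have "\<dots> = (\<Sum>q\<in>words \<times> words. \<Sum>g\<in>G. inverse (fact n) * (if q = (a \<circ> inv g, b \<circ> inv g) then Y q else 0))"
    proof (rule sum.cong[OF refl])
      fix q :: "(nat \<Rightarrow> 'd) \<times> (nat \<Rightarrow> 'd)"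
      have "a = fst q \<circ> g \<and> b = snd q \<circ> g \<longleftrightarrow> q = (a \<circ> inv g, b \<circ> inv g)" if "g \<in> G" for g
        using words_comp_eq_iff[OF that] by (metis fst_conv prod.collapse snd_conv)
      then show "inverse (fact n) * Y q * (\<Sum>g\<in>G. if a = fst q \<circ> g \<and> b = snd q \<circ> g then 1 else 0)
        = (\<Sum>g\<in>G. inverse (fact n) * (if q = (a \<circ> inv g, b \<circ> inv g) then Y q else 0))"
        unfolding sum_distrib_left by (intro sum.cong refl) simp
    qed
    also have "\<dots> = (\<Sum>g\<in>G. \<Sum>q\<in>words \<times> words. inverse (fact n) * (if q = (a \<circ> inv g, b \<circ> inv g) then Y q else 0))"
      by (rule sum.swap)
    also have "\<dots> = (\<Sum>g\<in>G. inverse (fact n) * Y (a \<circ> inv g, b \<circ> inv g))"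
      by (intro sum.cong refl) (simp add: sum_distrib_left[symmetric] words_comp ab)
    also have "\<dots> = (\<Sum>g\<in>G. inverse (fact n) * Y (a, b))"
      using Y(1) ab by (intro sum.cong refl) (simp add: perm_inv_def)
    also have "\<dots> = Y (a, b)" by (simp add: card_G)
    finally show "Y (a, b) = ?R (a, b)" by simp
  qed (rule Y(2))
  have XT: "X \<bullet>\<bullet> tens A = tens A \<bullet>\<bullet> X" for A using X by (simp add: tens_comm_def)
  show ?thesis
    by (subst (1 2) Y_eq) (simp only: case_prod_unfold mmul_sum_left mmul_sum_right XT)
qed

lemma unitary_commutant:
  "{X \<in> mats. (unitary_group :: (complex^'d::finite^'d) set) \<subseteq> tens_comm X} = rep ` alg"
proof (intro equalityI subsetI)
  fix X :: "(nat \<Rightarrow> 'd) \<times> (nat \<Rightarrow> 'd) \<Rightarrow> complex"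
  assume "X \<in> {X \<in> mats. unitary_group \<subseteq> tens_comm X}"
  then have X: "X \<in> mats" "unitary_group \<subseteq> tens_comm X" by auto
  have "A \<in> tens_comm X" for A using X(2) by (rule all_matrices_comm)
  then show "X \<in> rep ` alg"
    using X(1) by (intro bicommutant_rep tens_span_perm_inv)
next
  fix X :: "(nat \<Rightarrow> 'd) \<times> (nat \<Rightarrow> 'd) \<Rightarrow> complex"
  assume "X \<in> rep ` alg"
  then show "X \<in> {X \<in> mats. unitary_group \<subseteq> tens_comm X}"
    using rep_commute[OF tens_perm_inv] by (auto simp: tens_comm_def)
qed

end

section \<open>The image of the group algebra\<close>

context perm_algebra
begin

lemma mmul_zero [simp]: "(\<lambda>_. 0) \<bullet>\<bullet> Y = (\<lambda>_. 0)" "X \<bullet>\<bullet> (\<lambda>_. 0) = (\<lambda>_. 0)"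
  by (auto simp: mmul_def fun_eq_iff)

lemma rep_scale: "rep (\<lambda>g. c * s g) = (\<lambda>p. c * rep s p)"
  by (auto simp: rep_def fun_eq_iff sum_distrib_left mult.assoc)

lemma rep_sum1: "rep (\<lambda>g. \<Sum>i\<in>I. f i g) = (\<lambda>p. \<Sum>i\<in>I. rep (f i) p)"
  by (rule ext) (use rep_sum[of "\<lambda>_. 1" f I] in simp)

text \<open>The first column has more entries than there are letters, so every word carries the same
  letter at two of them. Swapping these fixes the word but changes the sign of the column
  sum.\<close>

lemma rep_col_sum_eq_0:
  assumes rc: "coords \<mu> r c" and pos: "\<forall>k\<in>set \<mu>. k > 0" and len: "length \<mu> > CARD('d)"
  shows "rep (col_sum c) = (\<lambda>_ :: (nat \<Rightarrow> 'd::finite) \<times> (nat \<Rightarrow> 'd). 0)"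
proof -
  have "rep (col_sum c) (a, b) = 0" if ab: "a \<in> words" "b \<in> words" for a b :: "nat \<Rightarrow> 'd"
  proof -
    define t where "t i = inv_into {1..n} (\<lambda>x. (r x, c x)) (i, 0)" for i
    have t: "t i \<in> {1..n}" "r (t i) = i" "c (t i) = 0" if "i < length \<mu>" for i
    proof -
      have "(i, 0) \<in> cells \<mu>" using that pos by (auto simp: cells_def)
      then have "(i, 0) \<in> (\<lambda>x. (r x, c x)) ` {1..n}" using rc by (simp add: coords_def bij_betw_def)
      then have "t i \<in> {1..n}" "(r (t i), c (t i)) = (i, 0)"
        unfolding t_def by (rule inv_into_into, rule f_inv_into_f)
      then show "t i \<in> {1..n}" "r (t i) = i" "c (t i) = 0" by auto
    qed
    have "\<not> inj_on (\<lambda>i. a (t i)) {..<length \<mu>}"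
    proof
      assume "inj_on (\<lambda>i. a (t i)) {..<length \<mu>}"
      then have "card {..<length \<mu>} \<le> CARD('d)" by (rule card_inj_on_le) auto
      then show False using len by simp
    qed
    then obtain i j where ij: "i < length \<mu>" "j < length \<mu>" "i \<noteq> j" "a (t i) = a (t j)"
      by (auto simp: inj_on_def)
    let ?s = "Transposition.transpose (t i) (t j)"
    have ne: "t i \<noteq> t j" using t(2) ij by metis
    have sc: "?s \<in> stab c" using t ij by (intro transpose_stab) auto
    then have sG: "?s \<in> G" by (simp add: stab_def)
    have as: "a \<circ> ?s = a" using ij(4) by (auto simp: Transposition.transpose_def fun_eq_iff)
    have "rep (col_sum c) (a, b) = rep (col_sum c) (a \<circ> ?s, b)" by (simp only: as)
    also have "\<dots> = rep (delta ?s \<star> col_sum c) (a, b)"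
      by (simp only: rep_mult rep_delta_mmul[OF sG ab])
    also have "delta ?s \<star> col_sum c = (\<lambda>h. - 1 * col_sum c h)"
      unfolding col_sum_def by (subst delta_wsum[OF signed_subgroup_col sc]) (simp add: sign_swap_id ne)
    also have "rep (\<lambda>h. - 1 * col_sum c h) (a, b) = - rep (col_sum c) (a, b)"
      by (simp only: rep_scale) simp
    finally show ?thesis by simp
  qed
  then show ?thesis
    using mats_eqI[of "rep (col_sum c)" "\<lambda>_. 0"] by (auto simp: mats_def rep_def)
qed

lemma rep_central_idem_eq_0:
  assumes "coords \<mu> r c" "\<forall>k\<in>set \<mu>. k > 0" "length \<mu> > CARD('d)"
  shows "rep (central_idem (young r c) s) = (\<lambda>_ :: (nat \<Rightarrow> 'd::finite) \<times> (nat \<Rightarrow> 'd). 0)"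
proof -
  have "rep (young r c) = (\<lambda>_ :: (nat \<Rightarrow> 'd) \<times> (nat \<Rightarrow> 'd). 0)"
    unfolding young_def rep_mult rep_col_sum_eq_0[OF assms] by simp
  then have "rep (conj_sum (young r c)) = (\<lambda>_ :: (nat \<Rightarrow> 'd) \<times> (nat \<Rightarrow> 'd). 0)"
    unfolding conj_sum_def rep_sum1 rep_mult by simp
  moreover have "central_idem (young r c) s = (\<lambda>g. inverse (s\<^sup>2) * conj_sum (young r c) g)"
    by (simp add: central_idem_def field_simps)
  ultimately show ?thesis by (simp add: rep_scale)
qed

text \<open>The diagonal entry at the word whose letters record the row of each entry of the tableau.\<close>

lemma rep_young_nz:
  assumes rc: "coords \<mu> r c" and len: "length \<mu> \<le> CARD('d)"
  shows "rep (young r c) \<noteq> (\<lambda>_ :: (nat \<Rightarrow> 'd::finite) \<times> (nat \<Rightarrow> 'd). 0)"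
proof -
  obtain l :: "nat \<Rightarrow> 'd" where l: "inj_on l {..<length \<mu>}"
    using card_le_inj[of "{..<length \<mu>}" "UNIV :: 'd set"] len by auto
  define a where "a x = (if x \<in> {1..n} then l (r x) else undefined)" for x
  have a: "a \<in> words" by (auto simp: words_def a_def)
  have row: "r x < length \<mu>" if "x \<in> {1..n}" for x
  proof -
    have "(r x, c x) \<in> cells \<mu>" using rc that unfolding coords_def bij_betw_def by blast
    then show ?thesis by (simp add: cells_def)
  qed
  have stab_eq: "a \<circ> g = a \<longleftrightarrow> g \<in> stab r" if g: "g \<in> G" for g
  proof
    assume eq: "a \<circ> g = a"
    have "r (g x) = r x" for x
    proof (cases "x \<in> {1..n}")
      case True
      then have gx: "g x \<in> {1..n}" using G_mem[OF g] by blast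
      have "a (g x) = a x" using eq by (metis comp_apply)
      then have "l (r (g x)) = l (r x)" using True gx by (simp add: a_def)
      then show ?thesis using l row[OF True] row[OF gx] by (simp add: inj_on_def)
    next
      case False
      then show ?thesis using g by (simp add: G_def permutes_def)
    qed
    then show "g \<in> stab r" using g by (simp add: stab_def)
  next
    assume "g \<in> stab r"
    then show "a \<circ> g = a" using G_mem[OF g] by (auto simp: fun_eq_iff a_def stab_def)
  qed
  \<comment> \<open>The row sum absorbs right multiplication by \<open>inv g\<close>, so the
    coefficient at \<open>g\<close> equals that at the identity. Hence nothing cancels in the
    diagonal entry.\<close>
  have young_stab: "young r c g = 1" if g: "g \<in> stab r" for g
  proof -
    have gG: "g \<in> G" using g by (simp add: stab_def)
    have "young r c \<star> delta (inv g) = young r c"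
      unfolding young_def conv_assoc row_sum_def
      by (subst wsum_delta[OF signed_subgroup_row stab_inv[OF g]]) simp
    then have "(young r c \<star> delta (inv g)) id = young r c id" by simp
    then show ?thesis using gG by (simp add: conv_delta young_id[OF rc])
  qed
  have "rep (young r c) (a, a) = (\<Sum>g\<in>G. young r c g * (if g \<in> stab r then 1 else 0))"
    using a by (simp add: rep_def stab_eq)
  also have "\<dots> = (\<Sum>g\<in>G. if g \<in> stab r then 1 else 0)"
    by (intro sum.cong refl) (simp add: young_stab)
  also have "\<dots> = of_nat (card (stab r))"
  proof -
    have "G \<inter> stab r = stab r" by (auto simp: stab_def)
    then show ?thesis by (simp add: sum.If_cases)
  qed
  finally have "rep (young r c) (a, a) = of_nat (card (stab r))" .
  moreover have "id \<in> stab r" "finite (stab r)" by (auto simp: stab_def intro: finite_subset[of _ G])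
  ultimately have "rep (young r c) (a, a) \<noteq> 0" by (auto simp: card_eq_0_iff)
  then show ?thesis by metis
qed

lemma tableaux_nonempty: "\<exists>T. T \<in> tableaux \<mu>"
proof -
  have "\<exists>T. bij_betw T (cells \<mu>) {1..sum_list \<mu>}"
    by (rule finite_same_card_bij) (simp_all add: finite_cells card_cells)
  then show ?thesis by (simp add: tableaux_def)
qed

text \<open>\<open>E\<close> is the sum of the central idempotents of the shapes with at most
  \<open>CARD('d)\<close> rows. The others act as zero, so \<open>E\<close> acts as the identity and
  its left ideal already has full image. On that ideal \<open>rep\<close> is injective, and its
  dimension is \<open>n!\<close> times the coefficient of \<open>E\<close> at the identity.\<close>

lemma dim_rep:
  "of_nat (cfun.dim (rep ` alg :: ((nat \<Rightarrow> 'd::finite) \<times> (nat \<Rightarrow> 'd) \<Rightarrow> complex) set))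
    = (\<Sum>\<mu> | \<mu> \<in> partitions n \<and> length \<mu> \<le> CARD('d). (of_nat (specht_dim \<mu>))\<^sup>2 :: complex)"
proof -
  let ?J = "{\<mu> \<in> partitions n. length \<mu> \<le> CARD('d)}"
  let ?rep = "rep :: _ \<Rightarrow> (nat \<Rightarrow> 'd) \<times> (nat \<Rightarrow> 'd) \<Rightarrow> complex"
  obtain T where T: "\<And>\<mu>. T \<mu> \<in> tableaux \<mu>" using tableaux_nonempty by metis
  define e where "e \<mu> = young (row_of \<mu> (T \<mu>)) (col_of \<mu> (T \<mu>))" for \<mu>
  define \<phi> where "\<phi> \<mu> a = (e \<mu> \<star> a \<star> e \<mu>) id" for \<mu> a
  define k where "k \<mu> = (e \<mu> \<star> e \<mu>) id" for \<mu>
  define \<epsilon> where "\<epsilon> \<mu> = central_idem (e \<mu>) (k \<mu>)" for \<mu>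
  define E where "E = (\<lambda>g. \<Sum>\<mu>\<in>?J. \<epsilon> \<mu> g)"
  have fin: "finite ?J" using finite_partitions by simp
  have coords: "coords \<mu> (row_of \<mu> (T \<mu>)) (col_of \<mu> (T \<mu>))" if "\<mu> \<in> partitions n" for \<mu>
    using that T by (rule coords_tableau)
  have Q: "quasi_idempotent n (e \<mu>) (\<phi> \<mu>) (k \<mu>)" if "\<mu> \<in> partitions n" for \<mu>
    unfolding e_def \<phi>_def k_def
    by (rule quasi_idempotent_young[OF _ coords[OF that]]) (use that in \<open>simp add: partitions_def\<close>)
  have orth: "e \<mu> \<star> a \<star> e \<nu> = (\<lambda>_. 0)"
    if "\<mu> \<in> partitions n" "\<nu> \<in> partitions n" "\<mu> \<noteq> \<nu>" "a \<in> alg" for \<mu> \<nu> a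
    unfolding e_def by (rule young_orth[OF that(1-3) coords[OF that(1)] coords[OF that(2)] that(4)])
  have one: "(\<lambda>g. \<Sum>\<mu>\<in>partitions n. \<epsilon> \<mu> g) = delta id"
    unfolding \<epsilon>_def
    by (rule sum_central_idem[OF finite_partitions Q orth cycle_type_props(1) cycle_type_conj])
  have dim_k: "of_nat (specht_dim \<mu>) = fact n / k \<mu>" if mu: "\<mu> \<in> partitions n" for \<mu>
  proof -
    interpret quasi_idempotent n "e \<mu>" "\<phi> \<mu>" "k \<mu>" by (rule Q[OF mu])
    have "specht_dim \<mu> = cfun.dim (left_ideal (e \<mu>))"
      unfolding e_def by (rule specht_dim_eq[OF mu T])
    then show ?thesis using dim_left_ideal[OF e_e c_nz] e_id by simp
  qed
  have \<epsilon>_mult: "\<epsilon> \<mu> \<star> \<epsilon> \<nu> = (if \<mu> = \<nu> then \<epsilon> \<mu> else (\<lambda>_. 0))"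
    if "\<mu> \<in> partitions n" "\<nu> \<in> partitions n" for \<mu> \<nu>
    using that quasi_idempotent.central_idem_idem[OF Q] orth
    by (auto simp: \<epsilon>_def intro: central_idem_orth)
  have E_E: "E \<star> E = (\<lambda>g. 1 * E g)"
  proof -
    have "E \<star> E = (\<lambda>g. \<Sum>\<mu>\<in>?J. \<Sum>\<nu>\<in>?J. (\<epsilon> \<mu> \<star> \<epsilon> \<nu>) g)"
      by (simp add: E_def conv_sum_left conv_sum_right)
    also have "\<dots> = (\<lambda>g. \<Sum>\<mu>\<in>?J. \<Sum>\<nu>\<in>?J. if \<nu> = \<mu> then \<epsilon> \<mu> g else 0)"
      by (intro ext sum.cong refl) (auto simp: \<epsilon>_mult)
    finally show ?thesis using fin by (simp add: E_def)
  qed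
  have rep_E: "?rep E = ?rep (delta id)"
  proof
    fix p
    have "?rep (delta id) p = (\<Sum>\<mu>\<in>partitions n. ?rep (\<epsilon> \<mu>) p)"
      by (simp only: one[symmetric] rep_sum1)
    also have "\<dots> = (\<Sum>\<mu>\<in>?J. ?rep (\<epsilon> \<mu>) p)"
    proof (rule sum.mono_neutral_right[OF finite_partitions])
      show "\<forall>\<mu>\<in>partitions n - ?J. ?rep (\<epsilon> \<mu>) p = 0"
      proof
        fix \<mu> assume "\<mu> \<in> partitions n - ?J"
        then have "\<mu> \<in> partitions n" "\<forall>k\<in>set \<mu>. k > 0" "length \<mu> > CARD('d)"
          by (auto simp: partitions_def)
        then show "?rep (\<epsilon> \<mu>) p = 0"
          unfolding \<epsilon>_def e_def by (simp add: rep_central_idem_eq_0[OF coords])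
      qed
    qed auto
    finally show "?rep E p = ?rep (delta id) p" by (simp only: E_def rep_sum1)
  qed
  have "cfun.dim (?rep ` left_ideal E) = cfun.dim (left_ideal E)"
  proof (rule dim_injective_image[where X = G])
    show "f x = 0" if "f \<in> left_ideal E" "x \<notin> G" for f x
      using that conv_alg by (force simp: left_ideal_def alg_def)
    show "cfun.subspace (left_ideal E)" by (rule subspace_left_ideal)
    show "Vector_Spaces.linear (\<lambda>c f t. c * f t) (\<lambda>c f t. c * f t) ?rep" by (rule rep_linear)
    fix a assume a: "a \<in> left_ideal E" and "?rep a = 0"
    then have rep_a: "?rep a = (\<lambda>_. 0)" by (simp add: fun_eq_iff)
    have a_alg: "a \<in> alg" using a by (auto simp: left_ideal_def)
    have "a \<star> \<epsilon> \<mu> = (\<lambda>_. 0)" if mu: "\<mu> \<in> ?J" for \<mu>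
    proof -
      have mu': "\<mu> \<in> partitions n" using mu by simp
      interpret quasi_idempotent n "e \<mu>" "\<phi> \<mu>" "k \<mu>" by (rule Q[OF mu'])
      have rep_e: "?rep (e \<mu>) \<noteq> (\<lambda>_. 0)"
        unfolding e_def by (rule rep_young_nz[OF coords[OF mu']]) (use mu in simp)
      \<comment> \<open>The sandwiched element is this scalar times \<open>e \<mu>\<close>. It acts
        as zero because \<open>a\<close> does, while \<open>e \<mu>\<close> does not.\<close>
      have "\<phi> \<mu> (delta x \<star> a \<star> delta y) = 0" for x y
      proof -
        have "?rep (e \<mu> \<star> (delta x \<star> a \<star> delta y) \<star> e \<mu>) = (\<lambda>_. 0)"
          by (simp add: rep_mult rep_a)
        then have "(\<lambda>p. \<phi> \<mu> (delta x \<star> a \<star> delta y) * ?rep (e \<mu>) p) = (\<lambda>_. 0)"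
          by (simp add: sandwich rep_scale)
        then show ?thesis using rep_e by (metis mult_eq_0_iff)
      qed
      then show ?thesis unfolding \<epsilon>_def by (rule conv_central_idem_eq_0[OF a_alg])
    qed
    then have "a \<star> E = (\<lambda>_. 0)" by (simp add: E_def conv_sum_right)
    moreover have "a \<star> E = a" using left_ideal_fixed[OF E_E a] by simp
    ultimately show "a = 0" by (simp add: fun_eq_iff)
  qed simp
  moreover have "?rep ` left_ideal E = ?rep ` alg"
  proof -
    have "?rep (a \<star> E) = ?rep a" if "a \<in> alg" for a
    proof -
      have "?rep (a \<star> E) = ?rep a \<bullet>\<bullet> ?rep (delta id)" by (simp only: rep_mult rep_E)
      also have "\<dots> = ?rep a" using that by (simp flip: rep_mult)
      finally show ?thesis .
    qed
    then show ?thesis by (simp add: left_ideal_def image_image cong: image_cong)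
  qed
  ultimately have "of_nat (cfun.dim (?rep ` alg)) = fact n * E id / 1"
    using dim_left_ideal[OF E_E] by simp
  also have "\<dots> = (\<Sum>\<mu>\<in>?J. fact n * \<epsilon> \<mu> id)"
    by (simp add: E_def sum_distrib_left)
  also have "\<dots> = (\<Sum>\<mu>\<in>?J. (of_nat (specht_dim \<mu>))\<^sup>2)"
  proof (rule sum.cong[OF refl])
    fix \<mu> assume "\<mu> \<in> ?J"
    then have mu: "\<mu> \<in> partitions n" by simp
    show "fact n * \<epsilon> \<mu> id = (of_nat (specht_dim \<mu>))\<^sup>2"
      unfolding \<epsilon>_def quasi_idempotent.central_idem_id[OF Q[OF mu]] dim_k[OF mu]
      by (simp add: power2_eq_square)
  qed
  finally show ?thesis by simp
qed

end

section \<open>Haar averages of tensor powers\<close>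

lemma unitary_entry_le_1:
  assumes "U \<in> unitary_group" shows "cmod (U $ i $ j) \<le> 1"
proof -
  have "(U ** conj_transpose U) $ i $ i = 1" using assms by (simp add: unitary_group_def mat_def)
  then have "(\<Sum>k\<in>UNIV. U $ i $ k * cnj (U $ i $ k)) = 1"
    by (simp add: matrix_matrix_mult_def conj_transpose_def)
  then have "complex_of_real (\<Sum>k\<in>UNIV. (cmod (U $ i $ k))\<^sup>2) = 1"
    by (simp add: complex_norm_square del: of_real_power)
  then have "(\<Sum>k\<in>UNIV. (cmod (U $ i $ k))\<^sup>2) = 1"
    by (simp only: of_real_eq_1_iff)
  moreover have "(cmod (U $ i $ j))\<^sup>2 \<le> (\<Sum>k\<in>UNIV. (cmod (U $ i $ k))\<^sup>2)"
    by (rule member_le_sum) auto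
  ultimately show ?thesis by (simp add: power_le_one_iff abs_square_le_1)
qed

lemma conj_transpose_mult: "conj_transpose (A ** B) = conj_transpose B ** conj_transpose A"
  for A B :: "complex^'d::finite^'d"
  by (simp add: conj_transpose_def matrix_matrix_mult_def vec_eq_iff mult.commute)

lemma unitary_group_mult:
  assumes "V \<in> unitary_group" "U \<in> unitary_group" shows "V ** U \<in> unitary_group"
proof -
  have "V ** U ** (conj_transpose U ** conj_transpose V) = V ** (U ** conj_transpose U) ** conj_transpose V"
    "conj_transpose U ** conj_transpose V ** (V ** U) = conj_transpose U ** (conj_transpose V ** V) ** U"
    by (simp_all only: matrix_mul_assoc)
  then show ?thesis using assms by (simp add: unitary_group_def conj_transpose_mult)
qed

locale haar_unitary = perm_algebra +
  fixes M :: "(complex^'d::finite^'d) measure"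
  assumes haar: "haar_prob_measure M"
begin

text \<open>The matrix of conjugation by the tensor power of a unitary \<open>U\<close>, acting on
  matrices viewed as vectors indexed by pairs of words.\<close>

definition kern :: "complex^'d^'d \<Rightarrow> (nat \<Rightarrow> 'd) \<times> (nat \<Rightarrow> 'd) \<Rightarrow> (nat \<Rightarrow> 'd) \<times> (nat \<Rightarrow> 'd) \<Rightarrow> complex" where
  "kern U p q = tens U (fst p, fst q) * cnj (tens U (snd p, snd q))"

lemma sets_M: "sets M = sets (restrict_space borel unitary_group)"
  using haar by (simp add: haar_prob_measure_def)

lemma space_M: "space M = unitary_group"
  using sets_eq_imp_space_eq[OF sets_M] by (simp add: space_restrict_space)

sublocale prob_space M
  using haar by (simp add: haar_prob_measure_def)

lemma measurable_M: "f \<in> borel_measurable borel \<Longrightarrow> f \<in> borel_measurable M"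
  unfolding measurable_cong_sets[OF sets_M refl] by (rule measurable_restrict_space1)

lemma kern_measurable: "(\<lambda>U. kern U p q) \<in> borel_measurable borel"
proof -
  have "continuous_on UNIV (\<lambda>U :: complex^'d^'d. \<Prod>k\<in>{1..n}. U $ f k $ g k)" for f g :: "nat \<Rightarrow> 'd"
    by (intro continuous_intros)
  then have "(\<lambda>U :: complex^'d^'d. if P then \<Prod>k\<in>{1..n}. U $ f k $ g k else 0) \<in> borel_measurable borel"
    for P and f g :: "nat \<Rightarrow> 'd"
    by (cases P) (simp_all only: if_True if_False borel_measurable_continuous_onI borel_measurable_const)
  then have "(\<lambda>U :: complex^'d^'d. tens U r) \<in> borel_measurable borel" for r
    by (cases r) (simp only: tens_def prod.case)
  moreover have "cnj \<in> borel_measurable borel"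
    by (intro borel_measurable_continuous_onI continuous_intros)
  ultimately show ?thesis unfolding kern_def
    by (intro borel_measurable_times) (auto intro: measurable_compose)
qed

lemma kern_bound:
  assumes "U \<in> unitary_group" shows "norm (kern U p q) \<le> 1"
proof -
  have "norm (tens U r) \<le> 1" for r
    using unitary_entry_le_1[OF assms] by (cases r) (auto simp: tens_def prod_norm[symmetric] intro: prod_le_1)
  then show ?thesis unfolding kern_def norm_mult complex_mod_cnj
    by (intro mult_le_one) auto
qed

lemma kern_integrable: "integrable M (\<lambda>U. kern U p q)"
  by (rule integrable_const_bound[where B = 1])
     (auto simp: space_M kern_bound intro: measurable_M kern_measurable)

lemma kern_mult:
  assumes "p \<in> words \<times> words" "q \<in> words \<times> words"
  shows "kern (V ** U) p q = (\<Sum>r\<in>words \<times> words. kern V p r * kern U r q)"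
proof -
  have "kern (V ** U) p q = (\<Sum>a\<in>words. \<Sum>b\<in>words.
      tens V (fst p, a) * tens U (a, fst q) * (cnj (tens V (snd p, b)) * cnj (tens U (b, snd q))))"
    using assms by (simp add: kern_def tens_mult mmul_def sum_product mem_Times_iff)
  also have "\<dots> = (\<Sum>r\<in>words \<times> words. kern V p r * kern U r q)"
    unfolding sum.cartesian_product kern_def case_prod_unfold
    by (intro sum.cong refl) (simp only: mult_ac)
  finally show ?thesis .
qed

lemma sum_kern:
  assumes "Z \<in> mats" "a \<in> words" "b \<in> words"
  shows "(\<Sum>q\<in>words \<times> words. kern U (a, b) q * Z q) = (tens U \<bullet>\<bullet> Z \<bullet>\<bullet> tens (conj_transpose U)) (a, b)"
proof -
  have adj: "tens (conj_transpose U) (y, b) = cnj (tens U (b, y))" for y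
    by (auto simp: tens_def conj_transpose_def)
  have "(\<Sum>q\<in>words \<times> words. kern U (a, b) q * Z q)
      = (\<Sum>x\<in>words. \<Sum>y\<in>words. tens U (a, x) * cnj (tens U (b, y)) * Z (x, y))"
    by (simp add: sum.cartesian_product kern_def case_prod_unfold)
  also have "\<dots> = (\<Sum>y\<in>words. \<Sum>x\<in>words. tens U (a, x) * cnj (tens U (b, y)) * Z (x, y))"
    by (rule sum.swap)
  also have "\<dots> = (\<Sum>y\<in>words. (\<Sum>x\<in>words. tens U (a, x) * Z (x, y)) * cnj (tens U (b, y)))"
    unfolding sum_distrib_right by (intro sum.cong refl) (simp only: mult_ac)
  also have "\<dots> = (tens U \<bullet>\<bullet> Z \<bullet>\<bullet> tens (conj_transpose U)) (a, b)"
    using assms(2,3) by (simp add: mmul_apply adj)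
  finally show ?thesis .
qed

lemma integral_kern_invariant:
  assumes V: "V \<in> unitary_group"
  shows "(\<integral>U. kern (V ** U) p q \<partial>M) = (\<integral>U. kern U p q \<partial>M)"
proof -
  have "continuous_on UNIV (\<lambda>U :: complex^'d^'d. V ** U)"
    unfolding matrix_matrix_mult_def by (intro continuous_intros)
  then have "(\<lambda>U :: complex^'d^'d. V ** U) \<in> borel_measurable borel" by (intro borel_measurable_continuous_onI)
  then have "(\<lambda>U. V ** U) \<in> measurable M (restrict_space borel unitary_group)"
    using V by (intro measurable_restrict_space2 measurable_M) (auto simp: space_M unitary_group_mult)
  then have m: "(\<lambda>U. V ** U) \<in> measurable M M"
    by (simp add: measurable_cong_sets[OF refl sets_M])
  have "(\<integral>U. kern U p q \<partial>M) = (\<integral>U. kern U p q \<partial>(distr M M (\<lambda>U. V ** U)))"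
    using haar V by (simp add: haar_prob_measure_def)
  also have "\<dots> = (\<integral>U. kern (V ** U) p q \<partial>M)"
    by (rule integral_distr[OF m]) (rule measurable_M[OF kern_measurable])
  finally show ?thesis by simp
qed

text \<open>Averaging \<open>Z \<mapsto> U\<^sup>\<otimes>\<^sup>n Z (U\<^sup>\<otimes>\<^sup>n)\<^sup>*\<close> is a projection onto the commutant, with trace the integral of
  \<open>|Tr U|\<^sup>2\<^sup>n\<close>.\<close>

lemma integral_trace:
  "complex_of_real (\<integral>U. cmod (trace U) ^ (2 * n) \<partial>M)
    = of_nat (cfun.dim {X \<in> mats. (unitary_group :: (complex^'d^'d) set) \<subseteq> tens_comm X})"
proof -
  let ?C = "{X \<in> mats. (unitary_group :: (complex^'d^'d) set) \<subseteq> tens_comm X}"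
  let ?W = "words \<times> words :: ((nat \<Rightarrow> 'd) \<times> (nat \<Rightarrow> 'd)) set"
  have conj: "tens U \<bullet>\<bullet> tens (conj_transpose U) = mone" "tens (conj_transpose U) \<bullet>\<bullet> tens U = mone"
    if "U \<in> unitary_group" for U :: "complex^'d^'d"
    using that by (simp_all add: unitary_group_def tens_one flip: tens_mult)
  have "(\<Sum>q\<in>?W. \<integral>U. kern U q q \<partial>M) = of_nat (cfun.dim ?C)"
  proof (rule trace_eq_dim_range[where k = "\<lambda>p q. \<integral>U. kern U p q \<partial>M"])
    show "finite ?W" by simp
    show "f x = 0" if "f \<in> ?C" "x \<notin> ?W" for f x
      using that unfolding mats_def by blast
  next
    fix q :: "(nat \<Rightarrow> 'd) \<times> (nat \<Rightarrow> 'd)" assume q: "q \<in> ?W"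
    let ?Z = "\<lambda>p. if p \<in> ?W then \<integral>U. kern U p q \<partial>M else 0"
    have Z: "?Z \<in> mats" by (simp add: mats_def)
    \<comment> \<open>Each column of the averaged kernel, read as a matrix, is fixed under
      conjugation by \<open>V\<close>: this conjugation replaces \<open>U\<close> by
      \<open>V ** U\<close> under the integral, and the measure is left invariant.\<close>
    have "V \<in> tens_comm ?Z" if V: "V \<in> unitary_group" for V
    proof -
      have "tens V \<bullet>\<bullet> ?Z \<bullet>\<bullet> tens (conj_transpose V) = ?Z"
      proof (rule mats_eqI[OF mmul_mats Z])
        fix a b :: "nat \<Rightarrow> 'd" assume ab: "a \<in> words" "b \<in> words"
        have "?Z (a, b) = (\<integral>U. kern (V ** U) (a, b) q \<partial>M)"
          using ab V by (simp add: integral_kern_invariant)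
        also have "\<dots> = (\<integral>U. (\<Sum>r\<in>?W. kern V (a, b) r * kern U r q) \<partial>M)"
          using ab q by (simp add: kern_mult)
        also have "\<dots> = (\<Sum>r\<in>?W. kern V (a, b) r * (\<integral>U. kern U r q \<partial>M))"
          by (simp add: kern_integrable)
        also have "\<dots> = (\<Sum>r\<in>?W. kern V (a, b) r * ?Z r)"
          by (intro sum.cong refl) simp
        also have "\<dots> = (tens V \<bullet>\<bullet> ?Z \<bullet>\<bullet> tens (conj_transpose V)) (a, b)"
          by (rule sum_kern[OF Z ab])
        finally show "(tens V \<bullet>\<bullet> ?Z \<bullet>\<bullet> tens (conj_transpose V)) (a, b) = ?Z (a, b)" by simp
      qed
      then have "?Z \<bullet>\<bullet> tens V = tens V \<bullet>\<bullet> ?Z \<bullet>\<bullet> (tens (conj_transpose V) \<bullet>\<bullet> tens V)"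
        by (simp only: mmul_assoc[symmetric])
      then show ?thesis by (simp add: conj[OF V] tens_comm_def)
    qed
    then show "?Z \<in> ?C" using Z by blast
  next
    fix Z and p :: "(nat \<Rightarrow> 'd) \<times> (nat \<Rightarrow> 'd)" assume "Z \<in> ?C" and p: "p \<in> ?W"
    then have Z: "Z \<in> mats" "\<And>U. U \<in> unitary_group \<Longrightarrow> tens U \<bullet>\<bullet> Z = Z \<bullet>\<bullet> tens U"
      by (auto simp: tens_comm_def)
    \<comment> \<open>An element of the commutant is fixed by conjugation with each single
      \<open>U\<close>, hence also by the average, the total mass being 1.\<close>
    have "(\<Sum>q\<in>?W. kern U p q * Z q) = Z p" if "U \<in> unitary_group" for U
    proof -
      have "(\<Sum>q\<in>?W. kern U p q * Z q) = (tens U \<bullet>\<bullet> Z \<bullet>\<bullet> tens (conj_transpose U)) p"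
        using sum_kern[OF Z(1), of "fst p" "snd p" U] p by (simp add: mem_Times_iff)
      also have "tens U \<bullet>\<bullet> Z \<bullet>\<bullet> tens (conj_transpose U) = Z"
        using Z by (simp add: that mmul_assoc conj)
      finally show ?thesis .
    qed
    then have "(\<integral>U. (\<Sum>q\<in>?W. kern U p q * Z q) \<partial>M) = (\<integral>U. Z p \<partial>M)"
      by (intro Bochner_Integration.integral_cong) (auto simp: space_M)
    then show "(\<Sum>q\<in>?W. (\<integral>U. kern U p q \<partial>M) * Z q) = Z p"
      by (simp add: kern_integrable prob_space)
  qed
  moreover have "(\<Sum>q\<in>?W. \<integral>U. kern U q q \<partial>M) = (\<integral>U. complex_of_real (cmod (trace U) ^ (2 * n)) \<partial>M)"
  proof -
    \<comment> \<open>The trace of conjugation is the trace of the tensor power times its complex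
      conjugate.\<close>
    have "(\<Sum>q\<in>?W. kern U q q) = complex_of_real (cmod (trace U) ^ (2 * n))" for U
    proof -
      have "(\<Sum>q\<in>?W. kern U q q) = (\<Sum>a\<in>words. \<Sum>b\<in>words. tens U (a, a) * cnj (tens U (b, b)))"
        by (simp add: sum.cartesian_product kern_def case_prod_unfold)
      also have "\<dots> = (\<Sum>a\<in>words. tens U (a, a)) * cnj (\<Sum>b\<in>words. tens U (b, b))"
        by (simp add: sum_product)
      also have "\<dots> = (trace U * cnj (trace U)) ^ n"
        by (simp add: sum_tens_diag power_mult_distrib)
      also have "\<dots> = complex_of_real (cmod (trace U) ^ (2 * n))"
        by (simp add: complex_norm_square[symmetric] power_mult)
      finally show ?thesis .
    qed
    then show ?thesis by (simp add: kern_integrable flip: Bochner_Integration.integral_sum)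
  qed
  ultimately show ?thesis by (simp only: integral_complex_of_real)
qed

end

theorem proposition48:
  fixes haar :: "(complex^'d::finite^'d) measure" and n :: nat
  assumes "haar_prob_measure haar" and "n \<ge> 1"
  shows "(\<integral>U. cmod (trace U) ^ (2 * n) \<partial>haar) =
         (\<Sum>\<mu> | \<mu> \<in> partitions n \<and> length \<mu> \<le> CARD('d). (real (specht_dim \<mu>))\<^sup>2)"
proof -
  interpret haar_unitary n haar by unfold_locales (rule assms)
  have "complex_of_real (\<integral>U. cmod (trace U) ^ (2 * n) \<partial>haar)
      = of_nat (cfun.dim (rep ` alg :: ((nat \<Rightarrow> 'd) \<times> (nat \<Rightarrow> 'd) \<Rightarrow> complex) set))"
    by (simp only: integral_trace unitary_commutant)
  also have "\<dots> = complex_of_real (\<Sum>\<mu> | \<mu> \<in> partitions n \<and> length \<mu> \<le> CARD('d). (real (specht_dim \<mu>))\<^sup>2)"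
    by (simp add: dim_rep)
  finally show ?thesis by (simp only: of_real_eq_iff)
qed

end
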